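(* Let $n,p\ge 2$ be integers, $\mathcal{U}\in\mathbb{T}(\mathbb{C}^n,p)$ and $G\in\mathbb{T}(\mathbb{C}^n,2)$ (an $n\times n$ complex matrix). Then $$\mathrm{Edet}(\mathcal{U}\circ G)=\mathrm{Edet}(\mathcal{U})\left(\mathrm{Det}(G)\right)^{(p-1)^{n}}.$$
   Context: $\mathbb{T}(\mathbb{C}^n,m)$ is the space of $m$-th order $n$-dimensional complex tensors $\mathcal{T}=(t_{i_1\ldots i_m})$, $1\le i_1,\ldots,i_m\le n$. For $\mathbf{x}\in\mathbb{C}^n$, $\mathcal{T}\mathbf{x}^{m-1}\in\mathbb{C}^n$ is the vector with $i$-th entry $\sum_{i_2,\ldots,i_m=1}^n t_{ii_2\ldots i_m}x_{i_2}\cdots x_{i_m}$. The resultant $\mathrm{Res}$ of $n$ homogeneous polynomials in $n$ variables, each of degree $m-1$, is the irreducible polynomial in their coefficients that vanishes if and only if the polynomials have a common zero in $\mathbb{C}^n\setminus\{\mathbf{0}\}$, normalized by $\mathrm{Res}(x_1^{m-1},\ldots,x_n^{m-1})=1$. The E-determinant $\mathrm{Edet}(\mathcal{T})$ is the resultant of the $n$ components of $\mathcal{T}\mathbf{x}^{m-1}$. $\mathrm{Det}$ is the usual determinant. The composition $\mathcal{U}\circ G\in\mathbb{T}(\mathbb{C}^n,p)$ has entries $(\mathcal{U}\circ G)_{ij_2\ldots j_p}=\sum_{i_2,\ldots,i_p=1}^n u_{ii_2\ldots i_p}g_{i_2j_2}\cdots g_{i_pj_p}$, so $(\mathcal{U}\circ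 G)\mathbf{x}^{p-1}=\mathcal{U}(G\mathbf{x})^{p-1}$. *)

theory Defs
  imports "HOL-Analysis.Analysis" "HOL-Library.Poly_Mapping"
begin

section \<open>Multivariate polynomials\<close>

text \<open>
  Polynomials with variables from \<open>'v\<close> and coefficients in \<open>'a\<close> are finitely supported functions
  on exponent vectors, themselves finitely supported functions; multiplication is convolution.
\<close>

type_synonym ('v, 'a) mpoly = "('v \<Rightarrow>\<^sub>0 nat) \<Rightarrow>\<^sub>0 'a"

definition Const :: "'a \<Rightarrow> ('v, 'a::zero) mpoly"
  where "Const c = Poly_Mapping.single 0 c"

definition Var :: "'v \<Rightarrow> ('v, 'a::zero_neq_one) mpoly"
  where "Var v = Poly_Mapping.single (Poly_Mapping.single v 1) 1"

definition mdegree :: "('v \<Rightarrow>\<^sub>0 nat) \<Rightarrow> nat"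
  where "mdegree m = (\<Sum>v\<in>Poly_Mapping.keys m. Poly_Mapping.lookup m v)"

definition mvars :: "('v, 'a::zero) mpoly \<Rightarrow> 'v set"
  where "mvars P = (\<Union>m\<in>Poly_Mapping.keys P. Poly_Mapping.keys m)"

definition meval :: "('v \<Rightarrow> 'a) \<Rightarrow> ('v, 'a::comm_semiring_1) mpoly \<Rightarrow> 'a"
  where "meval a P = (\<Sum>m\<in>Poly_Mapping.keys P.
           Poly_Mapping.lookup P m * (\<Prod>v\<in>Poly_Mapping.keys m. a v ^ Poly_Mapping.lookup m v))"

text \<open>The zero polynomial is homogeneous of every degree.\<close>

definition homogeneous :: "nat \<Rightarrow> ('v, 'a::zero) mpoly \<Rightarrow> bool"
  where "homogeneous d P \<longleftrightarrow> (\<forall>m\<in>Poly_Mapping.keys P. mdegree m = d)"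

section \<open>The resultant\<close>

text \<open>
  A system of \<open>CARD('n)\<close> polynomials in \<open>CARD('n)\<close> variables is a function \<open>f\<close> on the finite type
  \<open>'n\<close>.  The pair \<open>(i, m)\<close> indexes the coefficient of the monomial \<open>m\<close> in the \<open>i\<close>-th polynomial;
  a polynomial in the coefficients of a system has such pairs as its variables.
\<close>

type_synonym 'n coeff_poly = "('n \<times> ('n \<Rightarrow>\<^sub>0 nat), complex) mpoly"

definition coeffs_of :: "('n \<Rightarrow> ('n, complex) mpoly) \<Rightarrow> 'n \<times> ('n \<Rightarrow>\<^sub>0 nat) \<Rightarrow> complex"
  where "coeffs_of f = (\<lambda>(i, m). Poly_Mapping.lookup (f i) m)"

definition has_nontrivial_zero :: "('n::finite \<Rightarrow> ('n, complex) mpoly) \<Rightarrow> bool"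
  where "has_nontrivial_zero f \<longleftrightarrow> (\<exists>x::complex^'n. x \<noteq> 0 \<and> (\<forall>i. meval (($) x) (f i) = 0))"

text \<open>
  The condition on \<open>mvars R\<close> says that \<open>R\<close> involves only the coefficients of forms of degree \<open>d\<close>.
  Irreducibility is over the complex numbers; since factors of \<open>R\<close> involve no variables
  beyond those of \<open>R\<close>, it does not matter that the ambient ring has further variables.
\<close>

definition is_resultant :: "nat \<Rightarrow> 'n::finite coeff_poly \<Rightarrow> bool"
  where "is_resultant d R \<longleftrightarrow>
    mvars R \<subseteq> {(i, m). mdegree m = d} \<and>
    irreducible R \<and>
    (\<forall>f. (\<forall>i. homogeneous d (f i)) \<longrightarrow>
      (meval (coeffs_of f) R = 0 \<longleftrightarrow> has_nontrivial_zero f)) \<and>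
    meval (coeffs_of (\<lambda>i. Var i ^ d)) R = 1"

definition resultant_poly :: "nat \<Rightarrow> 'n::finite coeff_poly"
  where "resultant_poly d = (THE R. is_resultant d R)"

definition Res :: "nat \<Rightarrow> ('n::finite \<Rightarrow> ('n, complex) mpoly) \<Rightarrow> complex"
  where "Res d f = meval (coeffs_of f) (resultant_poly d)"

section \<open>Tensors\<close>

text \<open>
  An \<open>m\<close>-th order tensor of dimension \<open>CARD('n)\<close> is given by its entries at index lists of
  length \<open>m\<close>.  The order is a separate argument of the operations below, and entries
  at lists of any other length are never used.
\<close>

type_synonym 'n tensor = "'n list \<Rightarrow> complex"

text \<open>The \<open>i\<close>-th component of \<open>T x\<^sup>m\<^sup>-\<^sup>1\<close>, as a polynomial in the components of \<open>x\<close>.\<close>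

definition tensor_form :: "nat \<Rightarrow> 'n::finite tensor \<Rightarrow> 'n \<Rightarrow> ('n, complex) mpoly"
  where "tensor_form m T i =
    (\<Sum>js\<in>{js. length js = m - 1}. Const (T (i # js)) * (\<Prod>j\<leftarrow>js. Var j))"

definition Edet :: "nat \<Rightarrow> 'n::finite tensor \<Rightarrow> complex"
  where "Edet m T = Res (m - 1) (tensor_form m T)"

text \<open>Only index lists of length \<open>p\<close> matter, so the value at the empty list is arbitrary.\<close>

definition tensor_comp :: "nat \<Rightarrow> 'n::finite tensor \<Rightarrow> complex^'n^'n \<Rightarrow> 'n tensor"
  where "tensor_comp p U G = (\<lambda>js. case js of
      [] \<Rightarrow> 0
    | i # js' \<Rightarrow> (\<Sum>is\<in>{is. length is = p - 1}.
        U (i # is) * (\<Prod>k<p - 1. G $ (is ! k) $ (js' ! k))))"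

end

(*
  The heart of the matter is that the resultant R exists: the polynomials vanishing on the set Z
  of all systems with a nontrivial zero form a principal ideal, and R generates it.  This ideal
  is prime, because Z is the image of an affine space under a polynomial map.  It contains the
  Macaulay determinants, which by the Nullstellensatz separate every system outside Z from Z.
  It contains no nonzero polynomial free of one particular coefficient, because near a suitable
  system the other coefficients can be prescribed (Brouwer's fixed point theorem).  Pseudo-division
  with respect to that coefficient and unique factorization make it principal.

  An invertible substitution G maps Z to itself, so R(F o G) = chi(G) R(F) with chi multiplicative.
  On diagonal matrices chi is given by the degree of R in the coefficients of a single F_i. That
  degree is d^(n-1): a Macaulay determinant bounds it from above, and the number of zeros of an
  explicit system from below.  A multiplicative function is determined by its values on diagonal
  matrices, as it takes the value 1 on shears; so chi = det^(d^n), where d = p - 1.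
*)

theory Submission
  imports "Jordan_Normal_Form.Determinant" "HOL-Computational_Algebra.Fundamental_Theorem_Algebra" Defs
begin

hide_const (open) Determinant.det
no_notation Matrix.vec_index (infixl "$" 100)

alias lookup = Poly_Mapping.lookup
alias keys = Poly_Mapping.keys
alias single = Poly_Mapping.single

section \<open>Polynomial arithmetic\<close>

text \<open>\<open>resultant_poly\<close> is a definite description, so \<open>Res\<close> says
  nothing until exactly one polynomial is known to satisfy \<open>is_resultant\<close>. Uniqueness
  comes from the ideal: a second candidate lies in it, is therefore a multiple of the generator, has
  a unit as cofactor by irreducibility, and the normalization makes this unit 1. The generator also
  explains covariance: after an invertible substitution R still vanishes on Z, hence is a multiple
  of R, and the inverse substitution forces the cofactor to be constant. The zero set alone does not
  reveal the exponent of the determinant. R is only known to divide a Macaulay determinant, and the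
  cofactor might involve the coefficients of the same form; this is why the degree needs a lower
  bound by a separate argument. Identities between polynomials are mostly checked at complex points,
  and claims about all points are brought down to a line, real work being left to polynomials in one
  variable: finitely many roots, no zero divisors.\<close>

definition ring_hom_fun :: "('a::comm_semiring_1 \<Rightarrow> 'b::comm_semiring_1) \<Rightarrow> bool"
  where "ring_hom_fun h \<longleftrightarrow> h 0 = 0 \<and> h 1 = 1 \<and> (\<forall>x y. h (x + y) = h x + h y) \<and> (\<forall>x y. h (x * y) = h x * h y)"

lemma ring_hom_fun_simps:
  assumes "ring_hom_fun h"
  shows "h 0 = 0" "h 1 = 1" "h (x + y) = h x + h y" "h (x * y) = h x * h y"
  using assms by (auto simp: ring_hom_fun_def)

lemma ring_hom_fun_sum:
  assumes "ring_hom_fun h" shows "h (sum f S) = (\<Sum>x\<in>S. h (f x))"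
  by (induction S rule: infinite_finite_induct) (auto simp: ring_hom_fun_simps[OF assms])

lemma ring_hom_fun_prod:
  assumes "ring_hom_fun h" shows "h (prod f S) = (\<Prod>x\<in>S. h (f x))"
  by (induction S rule: infinite_finite_induct) (auto simp: ring_hom_fun_simps[OF assms])

lemma ring_hom_fun_power:
  assumes "ring_hom_fun h" shows "h (x ^ n) = h x ^ n"
  by (induction n) (auto simp: ring_hom_fun_simps[OF assms])

lemma ring_hom_fun_uminus:
  fixes h :: "'a::comm_ring_1 \<Rightarrow> 'b::comm_ring_1"
  assumes "ring_hom_fun h" shows "h (- x) = - h x"
  using ring_hom_fun_simps(3)[OF assms, of x "-x"] ring_hom_fun_simps(1)[OF assms]
  by (simp add: eq_neg_iff_add_eq_0 add.commute)

lemma ring_hom_fun_diff: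
  fixes h :: "'a::comm_ring_1 \<Rightarrow> 'b::comm_ring_1"
  assumes "ring_hom_fun h" shows "h (x - y) = h x - h y"
  using ring_hom_fun_simps(3)[OF assms, of x "-y"] ring_hom_fun_uminus[OF assms] by simp

lemma ring_hom_fun_id: "ring_hom_fun (\<lambda>x. x)"
  by (simp add: ring_hom_fun_def)

lemma ring_hom_fun_comp: "ring_hom_fun g \<Longrightarrow> ring_hom_fun h \<Longrightarrow> ring_hom_fun (\<lambda>x. g (h x))"
  by (simp add: ring_hom_fun_def)

section \<open>Monomials and homomorphisms out of the polynomial ring\<close>

definition xpow :: "('v \<Rightarrow> 'a::comm_semiring_1) \<Rightarrow> ('v \<Rightarrow>\<^sub>0 nat) \<Rightarrow> 'a"
  where "xpow f m = (\<Prod>v\<in>keys m. f v ^ lookup m v)"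

lemma xpow_superset:
  assumes "finite S" "keys m \<subseteq> S"
  shows "xpow f m = (\<Prod>v\<in>S. f v ^ lookup m v)"
  unfolding xpow_def using assms
  by (intro prod.mono_neutral_left) (auto simp: in_keys_iff)

lemma xpow_zero [simp]: "xpow f 0 = 1"
  by (simp add: xpow_def)

lemma xpow_single [simp]: "xpow f (single v k) = f v ^ k"
  by (simp add: xpow_def)

lemma xpow_add: "xpow f (m + n) = xpow f m * xpow f n"
proof -
  have "xpow f (m + n) = (\<Prod>v\<in>keys m \<union> keys n. f v ^ lookup (m + n) v)"
    using keys_add[of m n] by (intro xpow_superset) auto
  moreover have "xpow f m = (\<Prod>v\<in>keys m \<union> keys n. f v ^ lookup m v)"
    by (intro xpow_superset) auto
  moreover have "xpow f n = (\<Prod>v\<in>keys m \<union> keys n. f v ^ lookup n v)"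
    by (intro xpow_superset) auto
  ultimately show ?thesis
    by (simp add: lookup_add power_add prod.distrib)
qed

text \<open>The map given by the universal property of the polynomial ring, for a homomorphism
  \<open>c\<close> on coefficients. Evaluation, \<open>split_var\<close>, \<open>grade\<close> and
  all substitutions are instances.\<close>

definition mhom :: "('a::comm_semiring_1 \<Rightarrow> 'b::comm_semiring_1) \<Rightarrow> ('v \<Rightarrow> 'b) \<Rightarrow> ('v, 'a) mpoly \<Rightarrow> 'b"
  where "mhom c f P = (\<Sum>m\<in>keys P. c (lookup P m) * xpow f m)"

lemma meval_eq_mhom: "meval a = mhom (\<lambda>x. x) a"
  by (simp add: fun_eq_iff meval_def mhom_def xpow_def)

lemma mhom_superset:
  assumes "c 0 = 0" "finite S" "keys P \<subseteq> S"
  shows "mhom c f P = (\<Sum>m\<in>S. c (lookup P m) * xpow f m)"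
  unfolding mhom_def using assms
  by (intro sum.mono_neutral_left) (auto simp: in_keys_iff)

lemma mpoly_single_induct [case_names zero single add]:
  fixes P :: "('v, 'a::comm_semiring_1) mpoly"
  assumes zero: "\<Phi> 0"
    and single: "\<And>m a. a \<noteq> 0 \<Longrightarrow> m \<in> keys P \<Longrightarrow> \<Phi> (single m a)"
    and add: "\<And>p q. \<Phi> p \<Longrightarrow> \<Phi> q \<Longrightarrow> \<Phi> (p + q)"
  shows "\<Phi> P"
proof -
  have eq: "P = (\<Sum>m\<in>keys P. single m (lookup P m))"
    by (rule poly_mapping_eqI) (auto simp: lookup_sum lookup_single when_def sum.delta in_keys_iff)
  have "\<Phi> (\<Sum>m\<in>S. single m (lookup P m))" if "S \<subseteq> keys P" for S
    using finite_subset[OF that finite_keys] that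
    by (induction S rule: finite_induct) (auto intro!: zero single add simp: in_keys_iff)
  from this[OF order_refl] show ?thesis using eq by simp
qed

context
  fixes c :: "'a::comm_semiring_1 \<Rightarrow> 'b::comm_semiring_1"
  assumes c: "ring_hom_fun c"
begin

lemma mhom_add: "mhom c f (P + Q) = mhom c f P + mhom c f Q"
proof -
  have c0: "c 0 = 0" by (simp add: ring_hom_fun_simps[OF c])
  have "mhom c f (P + Q) = (\<Sum>m\<in>keys P \<union> keys Q. c (lookup (P + Q) m) * xpow f m)"
    using keys_add[of P Q] by (intro mhom_superset) (auto simp: c0)
  moreover have "mhom c f P = (\<Sum>m\<in>keys P \<union> keys Q. c (lookup P m) * xpow f m)"
    by (intro mhom_superset) (auto simp: c0)
  moreover have "mhom c f Q = (\<Sum>m\<in>keys P \<union> keys Q. c (lookup Q m) * xpow f m)"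
    by (intro mhom_superset) (auto simp: c0)
  ultimately show ?thesis
    by (simp add: lookup_add ring_hom_fun_simps[OF c] ring_distribs sum.distrib)
qed

lemma mhom_zero: "mhom c f 0 = 0"
  by (simp add: mhom_def)

lemma mhom_single: "mhom c f (single m a) = c a * xpow f m"
  by (simp add: mhom_def ring_hom_fun_simps[OF c])

lemma mhom_mult: "mhom c f (P * Q) = mhom c f P * mhom c f Q"
proof (induction P rule: mpoly_single_induct)
  case (single m a)
  show ?case
  proof (induction Q rule: mpoly_single_induct)
    case (single n b)
    then show ?case
      by (simp add: mult_single mhom_single xpow_add ring_hom_fun_simps[OF c] ac_simps)
  qed (auto simp: mhom_zero mhom_add ring_distribs)
qed (auto simp: mhom_zero mhom_add ring_distribs)

lemma ring_hom_mhom: "ring_hom_fun (mhom c f)"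
  by (simp add: ring_hom_fun_def mhom_zero mhom_add mhom_mult flip: single_one)
     (simp add: mhom_single ring_hom_fun_simps[OF c] del: single_one)

lemma mhom_Const: "mhom c f (Const a) = c a"
  by (simp add: Const_def mhom_single)

lemma mhom_Var: "mhom c f (Var v) = f v"
  by (simp add: Var_def mhom_single ring_hom_fun_simps[OF c])

end

lemma Const_zero: "Const 0 = 0"
  and Const_one: "Const 1 = 1"
  by (auto simp: Const_def)

lemma ring_hom_Const: "ring_hom_fun (Const :: 'a::comm_semiring_1 \<Rightarrow> ('v, 'a) mpoly)"
  by (simp add: ring_hom_fun_def Const_def single_add mult_single)

lemmas Const_simps = ring_hom_fun_simps[OF ring_hom_Const]

lemma ring_hom_meval: "ring_hom_fun (meval a)"
  unfolding meval_eq_mhom by (rule ring_hom_mhom[OF ring_hom_fun_id])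

lemmas meval_simps [simp] = ring_hom_fun_simps[OF ring_hom_meval]
  ring_hom_fun_sum[OF ring_hom_meval] ring_hom_fun_prod[OF ring_hom_meval]
  ring_hom_fun_power[OF ring_hom_meval]

lemma meval_diff [simp]: "meval (a :: 'v \<Rightarrow> 'a::comm_ring_1) (P - Q) = meval a P - meval a Q"
  by (rule ring_hom_fun_diff[OF ring_hom_meval])

lemma meval_Const [simp]: "meval a (Const c) = c"
  and meval_Var [simp]: "meval a (Var v) = a v"
  and meval_single [simp]: "meval a (single m c) = c * xpow a m"
  unfolding meval_eq_mhom
  by (simp_all add: mhom_Const mhom_Var mhom_single ring_hom_fun_id)

lemma mvars_Const [simp]: "mvars (Const c) = {}"
  by (auto simp: mvars_def Const_def)

lemma mvars_Var [simp]: "mvars (Var v :: ('v, 'a::zero_neq_one) mpoly) = {v}"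
  by (auto simp: mvars_def Var_def)

lemma mvars_zero [simp]: "mvars 0 = {}"
  by (auto simp: mvars_def)

lemma mvars_one [simp]: "mvars (1 :: ('v, 'a::comm_semiring_1) mpoly) = {}"
  by (auto simp: mvars_def)

lemma mvars_add: "mvars (P + Q) \<subseteq> mvars P \<union> mvars Q"
  using keys_add[of P Q] by (auto simp: mvars_def)

lemma mvars_mult: "mvars (P * Q :: ('v, 'a::comm_semiring_1) mpoly) \<subseteq> mvars P \<union> mvars Q"
proof
  fix v assume "v \<in> mvars (P * Q)"
  then obtain a b where "a \<in> keys P" "b \<in> keys Q" "v \<in> keys (a + b)"
    using keys_mult[of P Q] by (auto simp: mvars_def)
  then show "v \<in> mvars P \<union> mvars Q"
    using keys_add[of a b] by (auto simp: mvars_def)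
qed

lemma mvars_uminus [simp]: "mvars (- P :: ('v, 'a::comm_ring_1) mpoly) = mvars P"
  by (auto simp: mvars_def in_keys_iff)

lemma mvars_diff: "mvars (P - Q :: ('v, 'a::comm_ring_1) mpoly) \<subseteq> mvars P \<union> mvars Q"
  using mvars_add[of P "-Q"] by simp

lemma mvars_sum: "mvars (sum f S) \<subseteq> (\<Union>x\<in>S. mvars (f x))"
  by (induction S rule: infinite_finite_induct) (use mvars_add in fastforce)+

lemma mvars_power: "mvars (P ^ n :: ('v, 'a::comm_semiring_1) mpoly) \<subseteq> mvars P"
  by (induction n) (use mvars_mult in fastforce)+

lemma finite_mvars [simp]: "finite (mvars P)"
  by (simp add: mvars_def)

lemma Var_power: "Var v ^ k = (single (single v k) 1 :: ('v, 'a::comm_semiring_1) mpoly)"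
  by (induction k) (auto simp: Var_def mult_single simp flip: single_add)

lemma single_eq: "single m (a::'a::comm_semiring_1) = Const a * (\<Prod>v\<in>keys m. Var v ^ lookup m v)"
proof -
  have "(\<Prod>v\<in>S. single (single v (lookup m v)) 1) = (single (\<Sum>v\<in>S. single v (lookup m v)) 1 :: ('b,'a) mpoly)" for S
    by (induction S rule: infinite_finite_induct) (auto simp: mult_single)
  moreover have "(\<Sum>v\<in>keys m. single v (lookup m v)) = m"
    by (rule poly_mapping_eqI) (auto simp: lookup_sum lookup_single when_def sum.delta in_keys_iff)
  ultimately show ?thesis
    by (simp add: Var_power Const_def mult_single)
qed

text \<open>The multiplication step offers only variables that occur in \<open>P\<close>. Hence two
  homomorphisms that agree on these variables agree at \<open>P\<close>, whatever they do to the
  others.\<close>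

lemma mpoly_induct [case_names Const add mult]:
  fixes P :: "('v, 'a::comm_semiring_1) mpoly"
  assumes const: "\<And>a. \<Phi> (Const a)"
    and add: "\<And>p q. \<Phi> p \<Longrightarrow> \<Phi> q \<Longrightarrow> \<Phi> (p + q)"
    and mult: "\<And>p v. \<Phi> p \<Longrightarrow> v \<in> mvars P \<Longrightarrow> \<Phi> (p * Var v)"
  shows "\<Phi> P"
proof (induction P rule: mpoly_single_induct)
  case zero
  then show ?case using const[of 0] by (simp add: Const_zero)
next
  case (single m a)
  have pow: "\<Phi> (p * Var v ^ k)" if "\<Phi> p" "v \<in> keys m" for p v k
  proof (induction k)
    case (Suc k)
    have "\<Phi> (p * Var v ^ k * Var v)"
      by (rule mult) (use Suc that single in \<open>auto simp: mvars_def\<close>)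
    then show ?case by (simp add: mult_ac)
  qed (use that in simp)
  have "\<Phi> (Const a * (\<Prod>v\<in>S. Var v ^ lookup m v))" if "S \<subseteq> keys m" for S
    using finite_subset[OF that finite_keys] that
    by (induction S rule: finite_induct)
       (auto simp: const mult.left_commute mult.commute[of "Var _ ^ _"] simp flip: mult.assoc intro!: pow)
  then show ?case by (simp add: single_eq)
qed (rule add)

lemma ring_hom_fun_eqI:
  assumes "ring_hom_fun g" "ring_hom_fun h"
    and "\<And>a. g (Const a) = h (Const a)" "\<And>v. v \<in> mvars P \<Longrightarrow> g (Var v) = h (Var v)"
  shows "g P = h P"
proof (induction P rule: mpoly_induct)
  case (mult p v)
  then show ?case using assms by (simp add: ring_hom_fun_simps)
qed (use assms in \<open>auto simp: ring_hom_fun_simps\<close>)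

lemma meval_cong: "(\<And>v. v \<in> mvars P \<Longrightarrow> a v = b v) \<Longrightarrow> meval a P = meval b P"
  by (rule ring_hom_fun_eqI[OF ring_hom_meval ring_hom_meval]) auto

section \<open>Polynomial functions of one complex variable and the identity principle\<close>

definition polyfun :: "(complex \<Rightarrow> complex) \<Rightarrow> bool"
  where "polyfun f \<longleftrightarrow> (\<exists>p. \<forall>t. f t = poly p t)"

lemma polyfunI: "(\<And>t. f t = poly p t) \<Longrightarrow> polyfun f"
  by (auto simp: polyfun_def)

lemma polyfun_const [intro]: "polyfun (\<lambda>_. c)"
  by (rule polyfunI[of _ "[:c:]"]) simp

lemma polyfun_id [intro]: "polyfun (\<lambda>t. t)"
  by (rule polyfunI[of _ "[:0,1:]"]) simp

lemma polyfun_add [intro]: "polyfun f \<Longrightarrow> polyfun g \<Longrightarrow> polyfun (\<lambda>t. f t + g t)"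
  unfolding polyfun_def by (metis poly_add)

lemma polyfun_mult [intro]: "polyfun f \<Longrightarrow> polyfun g \<Longrightarrow> polyfun (\<lambda>t. f t * g t)"
  unfolding polyfun_def by (metis poly_mult)

lemma polyfun_diff [intro]: "polyfun f \<Longrightarrow> polyfun g \<Longrightarrow> polyfun (\<lambda>t. f t - g t)"
  unfolding polyfun_def by (metis poly_diff)

lemma polyfun_power [intro]: "polyfun f \<Longrightarrow> polyfun (\<lambda>t. f t ^ n)"
  unfolding polyfun_def by (metis poly_power)

lemma polyfun_sum [intro]: "(\<And>x. x \<in> S \<Longrightarrow> polyfun (f x)) \<Longrightarrow> polyfun (\<lambda>t. \<Sum>x\<in>S. f x t)"
  by (induction S rule: infinite_finite_induct) auto

lemma polyfun_prod [intro]: "(\<And>x. x \<in> S \<Longrightarrow> polyfun (f x)) \<Longrightarrow> polyfun (\<lambda>t. \<Prod>x\<in>S. f x t)"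
  by (induction S rule: infinite_finite_induct) auto

lemma polyfun_xpow [intro]:
  assumes "\<And>v. polyfun (\<lambda>t. \<phi> t v)"
  shows "polyfun (\<lambda>t. xpow (\<phi> t) m)"
  unfolding xpow_def by (intro polyfun_prod polyfun_power assms)

lemma polyfun_meval [intro]:
  assumes "\<And>v. polyfun (\<lambda>t. \<phi> t v)"
  shows "polyfun (\<lambda>t. meval (\<phi> t) P)"
  unfolding meval_eq_mhom mhom_def
  by (intro polyfun_sum polyfun_mult polyfun_const polyfun_xpow assms)

lemma polyfun_eq_zero:
  assumes "polyfun f" "infinite {t. f t = 0}"
  shows "f t = 0"
proof -
  obtain p where p: "\<And>t. f t = poly p t" using assms(1) by (auto simp: polyfun_def)
  then have "p = 0" using assms(2) poly_roots_finite[of p] by auto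
  then show ?thesis by (simp add: p)
qed

lemma polyfun_mult_eq_zero:
  assumes "polyfun f" "polyfun g" "\<And>t. f t * g t = 0"
  shows "(\<forall>t. f t = 0) \<or> (\<forall>t. g t = 0)"
proof -
  obtain p q where pq: "\<And>t. f t = poly p t" "\<And>t. g t = poly q t"
    using assms(1,2) by (auto simp: polyfun_def)
  then have "\<And>t. poly (p * q) t = 0" using assms(3) by simp
  then have "p * q = 0" using poly_all_0_iff_0 by blast
  then show ?thesis using pq by auto
qed

lemma xpow_scale_var:
  "xpow (a(v := s * a v)) m = s ^ lookup m v * xpow a m"
proof -
  let ?S = "insert v (keys m)"
  have "xpow (a(v := s * a v)) m = (\<Prod>u\<in>?S. (a(v := s * a v)) u ^ lookup m u)"
    by (rule xpow_superset) auto
  also have "\<dots> = (\<Prod>u\<in>?S. (if u = v then s ^ lookup m v else 1) * a u ^ lookup m u)"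
    by (rule prod.cong) (auto simp: power_mult_distrib)
  also have "\<dots> = s ^ lookup m v * (\<Prod>u\<in>?S. a u ^ lookup m u)"
    by (subst prod.distrib, subst prod.delta) auto
  also have "(\<Prod>u\<in>?S. a u ^ lookup m u) = xpow a m"
    by (rule xpow_superset[symmetric]) auto
  finally show ?thesis .
qed

text \<open>Induction on the number of monomials, which works for infinitely many variables too. If
  two monomials differ in the exponent of \<open>v\<close>, multiplying the value of
  \<open>v\<close> by \<open>s\<close> makes the value of \<open>P\<close> a polynomial in
  \<open>s\<close>. It vanishes identically, so its coefficients vanish, and each of them is the
  value of a polynomial with fewer monomials than \<open>P\<close>.\<close>

lemma meval_eq_zeroD:
  fixes P :: "('v, complex) mpoly"
  assumes "\<And>a. meval a P = 0"
  shows "P = 0"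
  using assms
proof (induction "card (keys P)" arbitrary: P rule: less_induct)
  case less
  show ?case
  proof (rule ccontr)
    assume "P \<noteq> 0"
    then obtain m where m: "m \<in> keys P" by fastforce
    show False
    proof (cases "keys P = {m}")
      case True
      have "meval (\<lambda>_. 1) P = lookup P m"
        by (simp add: meval_def True)
      then show False using less(2)[of "\<lambda>_. 1"] m by (simp add: in_keys_iff)
    next
      case False
      then obtain m' where m': "m' \<in> keys P" "m' \<noteq> m" using m by auto
      then obtain v where v: "lookup m' v \<noteq> lookup m v"
        by (meson poly_mapping_eqI)
      define S where "S = {n\<in>keys P. lookup n v = lookup m v}"
      define Q where "Q = (\<Sum>n\<in>S. single n (lookup P n))"
      have lQ: "lookup Q n = (if n \<in> S then lookup P n else 0)" for n
        by (auto simp: Q_def lookup_sum lookup_single when_def sum.delta' S_def)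
      have kQ: "keys Q = S"
        by (auto simp: in_keys_iff lQ S_def split: if_splits)
      have "S \<subset> keys P" using m' v by (auto simp: S_def)
      then have "card (keys Q) < card (keys P)"
        unfolding kQ by (intro psubset_card_mono) auto
      moreover have "meval a Q = 0" for a
      proof -
        define p where "p = (\<Sum>n\<in>keys P. monom (lookup P n * xpow a n) (lookup n v))"
        have "poly p s = meval (a(v := s * a v)) P" for s
          unfolding meval_eq_mhom mhom_def xpow_scale_var p_def
          by (auto simp: poly_sum poly_monom intro!: sum.cong)
        then have "p = 0" using less(2) poly_all_0_iff_0[of p] by simp
        then have "(\<Sum>n\<in>keys P. if lookup n v = lookup m v then lookup P n * xpow a n else 0) = 0"
          by (simp add: p_def coeff_sum poly_eq_iff)
        then show ?thesis
          unfolding meval_eq_mhom mhom_def kQ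
          by (simp add: S_def lQ sum.inter_filter)
      qed
      ultimately have "Q = 0" using less(1) by blast
      then show False using kQ m by (auto simp: S_def)
    qed
  qed
qed

lemma mpoly_eqI:
  fixes P Q :: "('v, complex) mpoly"
  assumes "\<And>a. meval a P = meval a Q"
  shows "P = Q"
  using meval_eq_zeroD[of "P - Q"] assms by simp

lemma meval_line:
  fixes a b :: "'v \<Rightarrow> complex"
  shows "polyfun (\<lambda>t. meval (\<lambda>v. a v + t * (b v - a v)) P)"
  by (intro polyfun_meval polyfun_add polyfun_mult polyfun_const polyfun_id)

text \<open>On the line joining a point where \<open>P\<close> does not vanish to one where
  \<open>Q\<close> does not vanish, both become polynomials in one variable.\<close>

lemma mpoly_mult_eq_zero:
  fixes P Q :: "('v, complex) mpoly"
  assumes "P * Q = 0"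
  shows "P = 0 \<or> Q = 0"
proof (rule ccontr)
  assume "\<not> ?thesis"
  then obtain a b where ab: "meval a P \<noteq> 0" "meval b Q \<noteq> 0"
    using meval_eq_zeroD by metis
  define l where "l t = (\<lambda>v. a v + t * (b v - a v))" for t
  have "meval (l t) P * meval (l t) Q = 0" for t
    using assms meval_simps(4)[of "l t" P Q] by simp
  moreover have "polyfun (\<lambda>t. meval (l t) P)" "polyfun (\<lambda>t. meval (l t) Q)"
    unfolding l_def by (rule meval_line)+
  ultimately have "meval (l 0) P = 0 \<or> meval (l 1) Q = 0"
    using polyfun_mult_eq_zero by blast
  then show False using ab by (simp add: l_def)
qed

lemma mpoly_mult_eq_zero_iff [simp]:
  fixes P Q :: "('v, complex) mpoly"
  shows "P * Q = 0 \<longleftrightarrow> P = 0 \<or> Q = 0"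
  using mpoly_mult_eq_zero by auto

lemma mpoly_mult_cancel_left:
  fixes P Q R :: "('v, complex) mpoly"
  assumes "P * Q = P * R" "P \<noteq> 0"
  shows "Q = R"
proof -
  have "P * (Q - R) = 0" using assms(1) by (simp add: algebra_simps)
  then show ?thesis using assms(2) by simp
qed

section \<open>Polynomials as univariate polynomials over the remaining variables\<close>

lemma degree_mpoly_poly_mult:
  fixes p q :: "('v, complex) mpoly poly"
  assumes "p \<noteq> 0" "q \<noteq> 0"
  shows "degree (p * q) = degree p + degree q"
proof (rule antisym[OF degree_mult_le])
  have "coeff (p * q) (degree p + degree q) = lead_coeff p * lead_coeff q"
    by (rule coeff_mult_degree_sum)
  also have "\<dots> \<noteq> 0" using assms by auto
  finally show "degree p + degree q \<le> degree (p * q)" by (rule le_degree)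
qed

lemma ring_hom_pConst: "ring_hom_fun (\<lambda>c :: 'a::comm_semiring_1. [:c:])"
  by (auto simp: ring_hom_fun_def one_pCons mult.commute)

lemma ring_hom_poly: "ring_hom_fun (\<lambda>p. poly p (x :: 'a::comm_semiring_1))"
  by (simp add: ring_hom_fun_def mult.commute)

text \<open>The coefficients stay in the same type, so no change of ring is needed when a variable
  is singled out; that they are free of \<open>v\<close> is the content of
  \<open>mvars_coeff_split_var\<close>.\<close>

definition split_var :: "'v \<Rightarrow> ('v, complex) mpoly \<Rightarrow> ('v, complex) mpoly poly"
  where "split_var v = mhom (\<lambda>c. [:Const c:]) (\<lambda>u. if u = v then [:0, 1:] else [:Var u:])"

lemma ring_hom_split_var: "ring_hom_fun (split_var v)"
  unfolding split_var_def
  by (rule ring_hom_mhom, rule ring_hom_fun_comp[OF ring_hom_pConst ring_hom_Const])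

lemmas split_var_hom [simp] = ring_hom_fun_simps[OF ring_hom_split_var]

lemma split_var_Const [simp]: "split_var v (Const c) = [:Const c:]"
  and split_var_Var: "split_var v (Var u) = (if u = v then [:0, 1:] else [:Var u:])"
  unfolding split_var_def
  by (simp_all only: mhom_Const mhom_Var ring_hom_fun_comp[OF ring_hom_pConst ring_hom_Const])

lemma poly_split_var [simp]: "poly (split_var v P) (Var v) = P"
  by (rule ring_hom_fun_eqI[OF ring_hom_fun_comp[OF ring_hom_poly ring_hom_split_var] ring_hom_fun_id])
     (auto simp: split_var_Var)

lemma split_var_eq_0_iff [simp]: "split_var v P = 0 \<longleftrightarrow> P = 0"
  by (metis poly_0 poly_split_var split_var_hom(1))

lemma mvars_coeff_split_var: "mvars (coeff (split_var v P) k) \<subseteq> mvars P - {v}"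
proof -
  \<comment> \<open>The induction passes through polynomials with possibly other variables; all that
    is known in the multiplication step is that the new variable belongs to this fixed set.\<close>
  define W where "W = mvars P"
  have "mvars (coeff (split_var v P) k) \<subseteq> W - {v}"
  proof (induction P arbitrary: k rule: mpoly_induct)
    case (Const a)
    then show ?case by (cases k) auto
  next
    case (add p q)
    have "coeff (split_var v (p + q)) k = coeff (split_var v p) k + coeff (split_var v q) k"
      by simp
    then show ?case
      using mvars_add[of "coeff (split_var v p) k" "coeff (split_var v q) k"] add.IH[of k]
      by (metis (no_types, lifting) Un_least order_trans)
  next
    case (mult p u)
    show ?case
    proof (cases "u = v")
      case True
      then have "coeff (split_var v (p * Var u)) k = (if k = 0 then 0 else coeff (split_var v p) (k - 1))"
        by (cases k) (auto simp: split_var_Var coeff_pCons split: nat.split)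
      then show ?thesis using mult by (metis empty_subsetI mvars_zero)
    next
      case False
      have "coeff (split_var v (p * Var u)) k = Var u * coeff (split_var v p) k"
        using False by (simp add: split_var_Var)
      moreover have "mvars (Var u * coeff (split_var v p) k) \<subseteq> {u} \<union> (W - {v})"
        using mvars_mult[of "Var u" "coeff (split_var v p) k"] mult(1)[of k]
        by (metis (no_types, lifting) Un_mono mvars_Var order_refl order_trans)
      ultimately show ?thesis
        using mult(2) False by (auto simp: W_def)
    qed
  qed
  then show ?thesis by (simp add: W_def)
qed

lemma split_var_free: "v \<notin> mvars P \<Longrightarrow> split_var v P = [:P:]"
  by (rule ring_hom_fun_eqI[OF ring_hom_split_var ring_hom_pConst]) (auto simp: split_var_Var)

abbreviation deg_in :: "'v \<Rightarrow> ('v, complex) mpoly \<Rightarrow> nat"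
  where "deg_in v P \<equiv> degree (split_var v P)"

lemma deg_in_eq_0_iff: "deg_in v P = 0 \<longleftrightarrow> v \<notin> mvars P"
proof
  assume "deg_in v P = 0"
  then obtain q where q: "split_var v P = [:q:]" by (rule degree_eq_zeroE)
  have "P = q" using poly_split_var[of v P] by (simp add: q)
  then show "v \<notin> mvars P" using mvars_coeff_split_var[of v P 0] q by auto
qed (simp add: split_var_free)

lemma deg_in_mult: "P \<noteq> 0 \<Longrightarrow> Q \<noteq> 0 \<Longrightarrow> deg_in v (P * Q) = deg_in v P + deg_in v Q"
  by (simp add: degree_mpoly_poly_mult)

text \<open>The degree in each single variable is additive, so no variable can cancel in the
  product.\<close>

lemma mvars_mult_eq:
  fixes P Q :: "('v, complex) mpoly"
  assumes "P \<noteq> 0" "Q \<noteq> 0"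
  shows "mvars (P * Q) = mvars P \<union> mvars Q"
proof -
  have "v \<in> mvars (P * Q) \<longleftrightarrow> v \<in> mvars P \<union> mvars Q" for v
    using deg_in_mult[OF assms, of v] deg_in_eq_0_iff[of v "P * Q"] deg_in_eq_0_iff[of v P]
      deg_in_eq_0_iff[of v Q] by auto
  then show ?thesis by blast
qed

text \<open>Every variable is multiplied by a parameter \<open>t\<close>. The coefficient of
  \<open>t^k\<close> is the homogeneous component of degree \<open>k\<close>, the degree in
  \<open>t\<close> is the total degree, and \<open>t = 1\<close> gives the polynomial back.\<close>

definition grade :: "('v, complex) mpoly \<Rightarrow> ('v, complex) mpoly poly"
  where "grade = mhom (\<lambda>c. [:Const c:]) (\<lambda>u. [:0, Var u:])"

abbreviation tdeg :: "('v, complex) mpoly \<Rightarrow> nat"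
  where "tdeg P \<equiv> degree (grade P)"

lemma ring_hom_grade: "ring_hom_fun grade"
  unfolding grade_def
  by (rule ring_hom_mhom, rule ring_hom_fun_comp[OF ring_hom_pConst ring_hom_Const])

lemmas grade_hom [simp] = ring_hom_fun_simps[OF ring_hom_grade]

lemma grade_Const [simp]: "grade (Const c) = [:Const c:]"
  and grade_Var [simp]: "grade (Var u) = [:0, Var u:]"
  unfolding grade_def
  by (simp_all only: mhom_Const mhom_Var ring_hom_fun_comp[OF ring_hom_pConst ring_hom_Const])

lemma poly_grade_1 [simp]: "poly (grade P) 1 = P"
  by (rule ring_hom_fun_eqI[OF ring_hom_fun_comp[OF ring_hom_poly ring_hom_grade] ring_hom_fun_id])
     auto

lemma poly_grade_0: "poly (grade P) 0 = Const (meval (\<lambda>_. 0) P)"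
  by (rule ring_hom_fun_eqI[OF ring_hom_fun_comp[OF ring_hom_poly ring_hom_grade]
        ring_hom_fun_comp[OF ring_hom_Const ring_hom_meval]])
     (auto simp: Const_zero)

lemma grade_eq_0_iff [simp]: "grade P = 0 \<longleftrightarrow> P = 0"
  by (metis poly_0 poly_grade_1 grade_hom(1))

lemma tdeg_mult: "P \<noteq> 0 \<Longrightarrow> Q \<noteq> 0 \<Longrightarrow> tdeg (P * Q) = tdeg P + tdeg Q"
  by (simp add: degree_mpoly_poly_mult)

text \<open>If the grading parameter does not occur, its values 1 and 0 give the same result: the
  polynomial itself and its constant term.\<close>

lemma tdeg_eq_0E:
  assumes "tdeg P = 0"
  obtains c where "P = Const c"
proof -
  obtain q where q: "grade P = [:q:]" using assms by (rule degree_eq_zeroE)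
  have "P = q" using poly_grade_1[of P] by (simp add: q)
  moreover have "q = Const (meval (\<lambda>_. 0) P)" using poly_grade_0[of P] by (simp add: q)
  ultimately show ?thesis using that by blast
qed

lemma mpoly_dvd_1_iff: "P dvd (1 :: ('v, complex) mpoly) \<longleftrightarrow> (\<exists>c. c \<noteq> 0 \<and> P = Const c)"
proof
  assume "P dvd 1"
  then obtain Q where Q: "1 = P * Q" by (auto elim: dvdE)
  then have nz: "P \<noteq> 0" "Q \<noteq> 0" by (metis mult_zero_left mult_zero_right zero_neq_one)+
  have "tdeg (1 :: ('v, complex) mpoly) = 0" by simp
  then have "tdeg P = 0" using Q tdeg_mult[OF nz] by simp
  then obtain c where "P = Const c" by (rule tdeg_eq_0E)
  moreover from this have "c \<noteq> 0" using nz by (metis Const_zero)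
  ultimately show "\<exists>c. c \<noteq> 0 \<and> P = Const c" by blast
next
  assume "\<exists>c. c \<noteq> 0 \<and> P = Const c"
  then obtain c where "c \<noteq> 0" "P = Const c" by auto
  then have "1 = P * Const (1 / c)" by (simp add: Const_one flip: Const_simps(4))
  then show "P dvd 1" ..
qed

lemma is_unit_if_tdeg_0: "tdeg P = 0 \<Longrightarrow> P \<noteq> 0 \<Longrightarrow> P dvd 1"
  using tdeg_eq_0E[of P] mpoly_dvd_1_iff[of P] Const_zero by metis

section \<open>Unique factorization\<close>

lemma mvars_dvd:
  fixes P Q :: "('v, complex) mpoly"
  assumes "P dvd Q" "Q \<noteq> 0"
  shows "mvars P \<subseteq> mvars Q"
proof -
  obtain S where S: "Q = P * S" using assms(1) by (auto elim: dvdE)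
  then have "P \<noteq> 0" "S \<noteq> 0" using assms(2) by auto
  then show ?thesis using mvars_mult_eq[of P S] S by simp
qed

lemma irreducible_factor_exists:
  fixes P :: "('v, complex) mpoly"
  assumes "P \<noteq> 0" "\<not> P dvd 1"
  shows "\<exists>Q. irreducible Q \<and> Q dvd P"
  using assms
proof (induction "tdeg P" arbitrary: P rule: less_induct)
  case less
  show ?case
  proof (cases "irreducible P")
    case False
    then obtain A B where AB: "P = A * B" "\<not> A dvd 1" "\<not> B dvd 1"
      using less.prems by (auto simp: irreducible_def)
    then have nz: "A \<noteq> 0" "B \<noteq> 0" using less.prems(1) by auto
    have "tdeg B \<noteq> 0" using AB(3) nz(2) is_unit_if_tdeg_0 by blast
    then have "tdeg A < tdeg P" using tdeg_mult[OF nz] AB(1) by simp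
    then obtain Q where "irreducible Q" "Q dvd A" using less.hyps nz(1) AB(2) by blast
    then show ?thesis using AB(1) by (auto intro: dvd_mult2)
  qed auto
qed

text \<open>Long division in \<open>v\<close> without inverting the leading coefficient of
  \<open>R\<close>: each step multiplies the dividend by that coefficient before the leading terms
  are cancelled, and \<open>g\<close> collects these multipliers.\<close>

lemma pseudo_division:
  fixes M R :: "('v, complex) mpoly"
  assumes "R \<noteq> 0" "mvars R \<subseteq> insert v W" "v \<notin> W" "mvars M \<subseteq> insert v W"
  shows "\<exists>g q r. g \<noteq> 0 \<and> mvars g \<subseteq> W \<and> mvars q \<subseteq> insert v W \<and> mvars r \<subseteq> insert v W \<and>
           g * M = q * R + r \<and> (r = 0 \<or> deg_in v r < deg_in v R)"
  using assms(4)
proof (induction "deg_in v M" arbitrary: M rule: less_induct)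
  case less
  show ?case
  proof (cases "M = 0 \<or> deg_in v M < deg_in v R")
    case True
    then show ?thesis using less.prems
      by (intro exI[of _ 1] exI[of _ 0] exI[of _ M]) auto
  next
    case False
    define a b e where "a = lead_coeff (split_var v R)" and "b = lead_coeff (split_var v M)"
      and "e = deg_in v M - deg_in v R"
    define M1 where "M1 = a * M - b * Var v ^ e * R"
    have aW: "mvars a \<subseteq> W" and bW: "mvars b \<subseteq> W"
      using mvars_coeff_split_var[of v R] mvars_coeff_split_var[of v M] assms(2) less.prems
      by (fastforce simp: a_def b_def)+
    have a0: "a \<noteq> 0" using assms(1) by (simp add: a_def)
    have bv: "mvars (b * Var v ^ e) \<subseteq> insert v W"
      using mvars_mult[of b "Var v ^ e"] mvars_power[of "Var v" e] bW by auto
    have M1W: "mvars M1 \<subseteq> insert v W"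
      using mvars_diff[of "a * M" "b * Var v ^ e * R"] mvars_mult[of a M]
        mvars_mult[of "b * Var v ^ e" R] aW bv less.prems assms(2) unfolding M1_def by blast
    have "v \<notin> mvars a" "v \<notin> mvars b" using aW bW assms(3) by auto
    then have split: "split_var v M1 = smult a (split_var v M) - smult b (monom 1 e * split_var v R)"
      unfolding M1_def
      by (simp add: ring_hom_fun_diff[OF ring_hom_split_var] ring_hom_fun_power[OF ring_hom_split_var]
          split_var_free split_var_Var monom_altdef)
    have coeff0: "coeff (split_var v M1) k = 0" if "k \<ge> deg_in v M" for k
    proof (cases "k = deg_in v M")
      case True
      then show ?thesis using False
        by (simp add: split coeff_monom_mult e_def a_def b_def)
    next
      case False
      then have "k > deg_in v M" "k - e > deg_in v R"
        using that \<open>\<not> (M = 0 \<or> deg_in v M < deg_in v R)\<close> by (auto simp: e_def)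
      then show ?thesis by (simp add: split coeff_monom_mult coeff_eq_0)
    qed
    have "M1 = 0 \<or> deg_in v M1 < deg_in v M"
      using coeff0[of "deg_in v M1"] by (metis leading_coeff_0_iff not_le split_var_eq_0_iff)
    then obtain g q r where gqr: "g \<noteq> 0" "mvars g \<subseteq> W" "mvars q \<subseteq> insert v W" "mvars r \<subseteq> insert v W"
      "g * M1 = q * R + r" "r = 0 \<or> deg_in v r < deg_in v R"
    proof
      assume "M1 = 0"
      then show thesis by (intro that[of 1 0 0]) auto
    next
      assume "deg_in v M1 < deg_in v M"
      from less.hyps[OF this M1W] show thesis using that by blast
    qed
    have "g * a * M = (q + g * (b * Var v ^ e)) * R + r"
      using gqr(5) by (simp add: M1_def algebra_simps)
    moreover have "mvars (g * a) \<subseteq> W"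
      using mvars_mult[of g a] aW gqr(2) by auto
    moreover have "mvars (q + g * (b * Var v ^ e)) \<subseteq> insert v W"
      using mvars_add[of q "g * (b * Var v ^ e)"] mvars_mult[of g "b * Var v ^ e"] gqr(2,3) bv by blast
    moreover have "g * a \<noteq> 0" using gqr(1) a0 by simp
    ultimately show ?thesis using gqr(4,6) by blast
  qed
qed

lemma const_poly_dvdI:
  fixes p :: "'a::comm_ring_1 poly"
  assumes "\<forall>k. c dvd coeff p k"
  shows "[:c:] dvd p"
  using assms
proof (induction p)
  case (pCons a p)
  have "c dvd coeff (pCons a p) 0" using pCons.prems by blast
  then obtain b where "a = c * b" by (auto elim: dvdE)
  moreover have "\<forall>k. c dvd coeff p k" using pCons.prems by (metis coeff_pCons_Suc)
  then obtain q where "p = [:c:] * q" using pCons.IH by (auto elim: dvdE)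
  ultimately have "pCons a p = [:c:] * pCons b q" by simp
  then show ?case ..
qed auto

lemma dvd_iff_dvd_coeffs:
  assumes "v \<notin> mvars \<pi>"
  shows "\<pi> dvd P \<longleftrightarrow> (\<forall>k. \<pi> dvd coeff (split_var v P) k)"
proof
  assume "\<pi> dvd P"
  then obtain S where "P = \<pi> * S" by (auto elim: dvdE)
  then show "\<forall>k. \<pi> dvd coeff (split_var v P) k" by (simp add: split_var_free[OF assms])
next
  assume "\<forall>k. \<pi> dvd coeff (split_var v P) k"
  then have "[:\<pi>:] dvd split_var v P" by (rule const_poly_dvdI)
  then obtain S where "split_var v P = [:\<pi>:] * S" by (auto elim: dvdE)
  then have "P = \<pi> * poly S (Var v)" using poly_split_var[of v P] by simp
  then show "\<pi> dvd P" ..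
qed

text \<open>Divisibility refers to the whole ring, only the factors are confined to
  \<open>W\<close>. This permits an induction on a finite set of variables inside a ring that may
  have infinitely many.\<close>

definition prime_within :: "'v set \<Rightarrow> ('v, complex) mpoly \<Rightarrow> bool"
  where "prime_within W \<pi> \<longleftrightarrow> (\<forall>M N. mvars M \<subseteq> W \<longrightarrow> mvars N \<subseteq> W \<longrightarrow> \<pi> dvd M * N \<longrightarrow> \<pi> dvd M \<or> \<pi> dvd N)"

text \<open>Gauss's argument: look at the lowest coefficients of the two factors that
  \<open>\<pi>\<close> does not divide. In the coefficient of the product at the sum of their
  indices all other terms are divisible by \<open>\<pi>\<close>, so the product of these two would
  be as well.\<close>

lemma prime_within_insert:
  assumes "prime_within W \<pi>" "mvars \<pi> \<subseteq> W" "v \<notin> W"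
  shows "prime_within (insert v W) \<pi>"
  unfolding prime_within_def
proof (intro allI impI, rule ccontr)
  fix P Q
  assume PQ: "mvars P \<subseteq> insert v W" "mvars Q \<subseteq> insert v W" "\<pi> dvd P * Q" "\<not> (\<pi> dvd P \<or> \<pi> dvd Q)"
  have free: "v \<notin> mvars \<pi>" using assms(2,3) by auto
  define p q where "p = split_var v P" and "q = split_var v Q"
  have ex: "\<exists>k. \<not> \<pi> dvd coeff p k" "\<exists>k. \<not> \<pi> dvd coeff q k"
    using PQ(4) dvd_iff_dvd_coeffs[OF free, of P] dvd_iff_dvd_coeffs[OF free, of Q]
    unfolding p_def q_def by blast+
  define i j where "i = (LEAST k. \<not> \<pi> dvd coeff p k)" and "j = (LEAST k. \<not> \<pi> dvd coeff q k)"
  have i: "\<not> \<pi> dvd coeff p i" "\<And>k. k < i \<Longrightarrow> \<pi> dvd coeff p k"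
    unfolding i_def using LeastI_ex[OF ex(1)] not_less_Least by blast+
  have j: "\<not> \<pi> dvd coeff q j" "\<And>k. k < j \<Longrightarrow> \<pi> dvd coeff q k"
    unfolding j_def using LeastI_ex[OF ex(2)] not_less_Least by blast+
  have "\<pi> dvd coeff (p * q) (i + j)"
    using PQ(3) dvd_iff_dvd_coeffs[OF free, of "P * Q"] by (simp add: p_def q_def)
  also have "coeff (p * q) (i + j) =
      coeff p i * coeff q j + (\<Sum>k\<in>{..i + j} - {i}. coeff p k * coeff q (i + j - k))"
    by (simp add: coeff_mult sum.remove[of _ i])
  finally have "\<pi> dvd coeff p i * coeff q j + (\<Sum>k\<in>{..i + j} - {i}. coeff p k * coeff q (i + j - k))" .
  moreover have "\<pi> dvd (\<Sum>k\<in>{..i + j} - {i}. coeff p k * coeff q (i + j - k))"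
  proof (rule dvd_sum)
    fix k assume "k \<in> {..i + j} - {i}"
    then have "k < i \<or> i + j - k < j" by auto
    then show "\<pi> dvd coeff p k * coeff q (i + j - k)" using i(2) j(2) by auto
  qed
  ultimately have "\<pi> dvd coeff p i * coeff q j"
    by (simp add: dvd_add_left_iff)
  moreover have "mvars (coeff p i) \<subseteq> W" "mvars (coeff q j) \<subseteq> W"
    using mvars_coeff_split_var[of v P i] mvars_coeff_split_var[of v Q j] PQ(1,2)
    unfolding p_def q_def by blast+
  ultimately show False using assms(1) i(1) j(1) unfolding prime_within_def by blast
qed

text \<open>For \<open>v\<close> outside \<open>W\<close> and \<open>R\<close> in the variables
  \<open>insert v W\<close>, this says that the coefficients of \<open>R\<close> as a polynomial in
  \<open>v\<close> have no common factor but units.\<close>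

definition primitive_over :: "'v set \<Rightarrow> ('v, complex) mpoly \<Rightarrow> bool"
  where "primitive_over W R \<longleftrightarrow> (\<forall>\<pi>. mvars \<pi> \<subseteq> W \<longrightarrow> \<pi> dvd R \<longrightarrow> \<pi> dvd 1)"

lemma primitive_part_exists:
  assumes "h \<noteq> 0"
  shows "\<exists>c h0. h = c * h0 \<and> mvars c \<subseteq> W \<and> primitive_over W h0"
  using assms
proof (induction "tdeg h" arbitrary: h rule: less_induct)
  case less
  show ?case
  proof (cases "primitive_over W h")
    case True
    then show ?thesis by (intro exI[of _ 1] exI[of _ h]) auto
  next
    case False
    then obtain \<pi> s where \<pi>: "mvars \<pi> \<subseteq> W" "h = \<pi> * s" "\<not> \<pi> dvd 1"
      by (auto simp: primitive_over_def elim!: dvdE)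
    then have nz: "\<pi> \<noteq> 0" "s \<noteq> 0" using less.prems by auto
    have "tdeg \<pi> \<noteq> 0" using \<pi>(3) nz(1) is_unit_if_tdeg_0 by blast
    then have "tdeg s < tdeg h" using tdeg_mult[OF nz] \<pi>(2) by simp
    then obtain c h0 where "s = c * h0" "mvars c \<subseteq> W" "primitive_over W h0"
      using less.hyps nz(2) by blast
    then show ?thesis using \<pi> mvars_mult[of \<pi> c]
      by (intro exI[of _ "\<pi> * c"] exI[of _ h0]) (auto simp: mult.assoc)
  qed
qed

text \<open>An irreducible factor of \<open>g\<close> remains prime when \<open>v\<close> is
  adjoined and cannot divide the primitive \<open>R\<close>. It therefore divides the cofactor of
  \<open>R\<close> and cancels; this repeats until \<open>g\<close> is a unit.\<close>

lemma primitive_dvd_cancel: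
  assumes prime: "\<And>\<pi>. irreducible \<pi> \<Longrightarrow> mvars \<pi> \<subseteq> W \<Longrightarrow> prime_within W \<pi>"
    and "v \<notin> W" "mvars R \<subseteq> insert v W" "mvars M \<subseteq> insert v W" "primitive_over W R"
    and "mvars g \<subseteq> W" "g \<noteq> 0" "R dvd g * M"
  shows "R dvd M"
  using assms(6-8)
proof (induction "tdeg g" arbitrary: g rule: less_induct)
  case less
  show ?case
  proof (cases "M = 0 \<or> g dvd 1")
    case True
    then show ?thesis
    proof
      assume "g dvd 1"
      then obtain u where "1 = g * u" by (auto elim: dvdE)
      then have "M = (g * M) * u" by (metis mult.commute mult.left_commute mult_1)
      then show ?thesis using less.prems(3) by (metis dvd_mult2)
    qed auto
  next
    case False
    then obtain \<pi> g' where \<pi>: "irreducible \<pi>" "g = \<pi> * g'"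
      using irreducible_factor_exists[of g] less.prems(2) by (auto elim!: dvdE)
    have nz: "\<pi> \<noteq> 0" "g' \<noteq> 0" using \<pi>(2) less.prems(2) by auto
    obtain Q where Q: "g * M = R * Q" using less.prems(3) by (auto elim: dvdE)
    then have "Q dvd g * M" "g * M \<noteq> 0" using False less.prems(2) by auto
    then have "mvars Q \<subseteq> mvars (g * M)" by (rule mvars_dvd)
    then have QW: "mvars Q \<subseteq> insert v W"
      using mvars_mult[of g M] less.prems(1) assms(4) by blast
    have \<pi>W: "mvars \<pi> \<subseteq> W" "mvars g' \<subseteq> W"
      using mvars_mult_eq[OF nz] \<pi>(2) less.prems(1) by auto
    then have "prime_within (insert v W) \<pi>"
      by (intro prime_within_insert prime \<pi>(1) assms(2))
    moreover have "\<pi> dvd R * Q" unfolding Q[symmetric] \<pi>(2) by simp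
    moreover have "\<not> \<pi> dvd R"
      using assms(5) \<pi>W(1) \<pi>(1) by (auto simp: primitive_over_def irreducible_def)
    ultimately have "\<pi> dvd Q"
      using assms(3) QW unfolding prime_within_def by blast
    then obtain Q' where "Q = \<pi> * Q'" by (auto elim: dvdE)
    then have "\<pi> * (g' * M) = \<pi> * (R * Q')" using Q \<pi>(2) by (simp add: mult_ac)
    then have "g' * M = R * Q'" using nz(1) by (rule mpoly_mult_cancel_left)
    moreover have "tdeg g' < tdeg g"
    proof -
      have "tdeg \<pi> \<noteq> 0" using is_unit_if_tdeg_0[of \<pi>] nz(1) \<pi>(1) by (auto simp: irreducible_def)
      then show ?thesis using tdeg_mult[OF nz] \<pi>(2) by simp
    qed
    ultimately show ?thesis using less.hyps[of g'] \<pi>W(2) nz(2) by simp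
  qed
qed

text \<open>This replaces the Euclidean algorithm over the field of fractions in the variables
  \<open>W\<close>. Let \<open>h\<close> be a nonzero element of least degree in \<open>v\<close> in
  the ideal of \<open>R\<close> and \<open>M\<close>. By pseudo-division it divides every element of
  the ideal up to factors from \<open>W\<close>, so its primitive part \<open>h0\<close> divides
  \<open>R\<close> and \<open>M\<close>. Either \<open>h0\<close> is a unit, then \<open>h\<close>
  is free of \<open>v\<close> and \<open>R\<close> divides \<open>h * N\<close>, hence
  \<open>N\<close>; or \<open>h0\<close> is associated to \<open>R\<close>, and \<open>R\<close>
  divides \<open>M\<close>.\<close>

lemma prime_within_insert_new:
  assumes prime: "\<And>\<pi>. irreducible \<pi> \<Longrightarrow> mvars \<pi> \<subseteq> W \<Longrightarrow> prime_within W \<pi>"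
    and v: "v \<notin> W" and R: "irreducible R" "mvars R \<subseteq> insert v W" "v \<in> mvars R"
  shows "prime_within (insert v W) R"
  unfolding prime_within_def
proof (intro allI impI, rule ccontr)
  fix M N
  assume M: "mvars M \<subseteq> insert v W" and N: "mvars N \<subseteq> insert v W" and dvd: "R dvd M * N"
    and neg: "\<not> (R dvd M \<or> R dvd N)"
  have R0: "R \<noteq> 0" using R(1) by auto
  have unit_mvars: "mvars s = {}" if "s dvd 1" for s :: "('a, complex) mpoly"
    using that by (auto simp: mpoly_dvd_1_iff)
  have primR: "primitive_over W R"
    unfolding primitive_over_def
  proof (intro allI impI)
    fix \<pi> assume \<pi>: "mvars \<pi> \<subseteq> W" "\<pi> dvd R"
    then obtain s where s: "R = \<pi> * s" by (auto elim: dvdE)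
    show "\<pi> dvd 1"
    proof (rule ccontr)
      assume "\<not> \<pi> dvd 1"
      then have "s dvd 1" using R(1) s by (auto simp: irreducible_def)
      then show False using unit_mvars mvars_mult[of \<pi> s] s R(3) \<pi>(1) v by auto
    qed
  qed
  define J where "J = {x * R + y * M | x y. mvars x \<subseteq> insert v W \<and> mvars y \<subseteq> insert v W}"
  have RJ: "R \<in> J" unfolding J_def by (rule CollectI, rule exI[of _ 1], rule exI[of _ 0]) simp
  have MJ: "M \<in> J" unfolding J_def by (rule CollectI, rule exI[of _ 0], rule exI[of _ 1]) simp
  have "\<exists>h. (h \<in> J \<and> h \<noteq> 0) \<and> (\<forall>h'. h' \<in> J \<and> h' \<noteq> 0 \<longrightarrow> deg_in v h \<le> deg_in v h')"
    using RJ R0 by (intro ex_has_least_nat[of _ R]) auto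
  then obtain h where h: "h \<in> J" "h \<noteq> 0" "\<And>h'. h' \<in> J \<Longrightarrow> h' \<noteq> 0 \<Longrightarrow> deg_in v h \<le> deg_in v h'"
    by blast
  obtain x y where xy: "h = x * R + y * M" "mvars x \<subseteq> insert v W" "mvars y \<subseteq> insert v W"
    using h(1) by (auto simp: J_def)
  have JW: "mvars T \<subseteq> insert v W" if "T \<in> J" for T
  proof -
    obtain a b where ab: "T = a * R + b * M" "mvars a \<subseteq> insert v W" "mvars b \<subseteq> insert v W"
      using \<open>T \<in> J\<close> unfolding J_def by blast
    show ?thesis
      using mvars_add[of "a * R" "b * M"] mvars_mult[of a R] mvars_mult[of b M] ab R(2) M by blast
  qed
  have div: "\<exists>g. g \<noteq> 0 \<and> mvars g \<subseteq> W \<and> h dvd g * T" if "T \<in> J" for T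
  proof -
    obtain a b where ab: "T = a * R + b * M" "mvars a \<subseteq> insert v W" "mvars b \<subseteq> insert v W"
      using \<open>T \<in> J\<close> by (auto simp: J_def)
    obtain g q r where gqr: "g \<noteq> 0" "mvars g \<subseteq> W" "mvars q \<subseteq> insert v W"
      "g * T = q * h + r" "r = 0 \<or> deg_in v r < deg_in v h"
      using pseudo_division[OF h(2) JW[OF h(1)] v JW[OF \<open>T \<in> J\<close>]] by blast
    have "r = g * T - q * h" using gqr(4) by simp
    also have "\<dots> = (g * a - q * x) * R + (g * b - q * y) * M"
      by (simp add: ab(1) xy(1) algebra_simps)
    finally have "r = (g * a - q * x) * R + (g * b - q * y) * M" .
    moreover have "mvars (g * a - q * x) \<subseteq> insert v W"
      using mvars_diff[of "g * a" "q * x"] mvars_mult[of g a] mvars_mult[of q x] gqr(2,3) ab(2) xy(2) by blast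
    moreover have "mvars (g * b - q * y) \<subseteq> insert v W"
      using mvars_diff[of "g * b" "q * y"] mvars_mult[of g b] mvars_mult[of q y] gqr(2,3) ab(3) xy(3) by blast
    ultimately have "r \<in> J" unfolding J_def by blast
    then have "r = 0" using gqr(5) h(3) by fastforce
    then show ?thesis using gqr by (metis add_0_right dvd_triv_right)
  qed
  obtain c h0 where c: "h = c * h0" "mvars c \<subseteq> W" "primitive_over W h0"
    using primitive_part_exists[OF h(2), of W] by blast
  have h0: "h0 dvd h" "mvars h0 \<subseteq> insert v W"
    using c(1) mvars_dvd[of h0 h] h(2) JW[OF h(1)] by auto
  have h0T: "h0 dvd T" if T: "T \<in> J" for T
  proof -
    obtain g where "g \<noteq> 0" "mvars g \<subseteq> W" "h0 dvd g * T"
      using div[OF T] h0(1) dvd_trans by blast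
    then show ?thesis using primitive_dvd_cancel[OF prime v h0(2) JW[OF T] c(3)] by blast
  qed
  obtain s where s: "R = h0 * s" using h0T[OF RJ] by (auto elim: dvdE)
  show False
  proof (cases "h0 dvd 1")
    case True
    then have "mvars h \<subseteq> W" using c(1,2) mvars_mult[of c h0] unit_mvars by auto
    moreover have "R dvd h * N"
    proof -
      have "h * N = x * N * R + y * (M * N)" by (simp add: xy(1) algebra_simps)
      then show ?thesis using dvd by (metis dvd_add dvd_mult dvd_triv_right)
    qed
    ultimately have "R dvd N" using primitive_dvd_cancel[OF prime v R(2) N primR _ h(2)] by blast
    then show False using neg by simp
  next
    case False
    then have "s dvd 1" using R(1) s by (auto simp: irreducible_def)
    then obtain u where "1 = s * u" by (auto elim: dvdE)
    then have "h0 = R * u" using s by (metis mult.assoc mult_1_right)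
    then have "R dvd h0" by simp
    then show False using h0T[OF MJ] neg dvd_trans by blast
  qed
qed

lemma irreducible_imp_prime_within:
  assumes "finite W" "irreducible R" "mvars R \<subseteq> W"
  shows "prime_within W R"
  using assms
proof (induction W arbitrary: R rule: finite_induct)
  case empty
  have "R = Const (meval (\<lambda>_. 0) R)"
    by (rule ring_hom_fun_eqI[OF ring_hom_fun_id ring_hom_fun_comp[OF ring_hom_Const ring_hom_meval]])
       (use empty.prems(2) in auto)
  then have "R = 0 \<or> R dvd 1" using mpoly_dvd_1_iff[of R] Const_zero by metis
  then show ?case using empty.prems(1) by (auto simp: irreducible_def)
next
  case (insert v W)
  show ?case
  proof (cases "v \<in> mvars R")
    case True
    show ?thesis
      by (rule prime_within_insert_new[OF insert.IH insert.hyps(2) insert.prems True])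
  next
    case False
    then have RW: "mvars R \<subseteq> W" using insert.prems by auto
    show ?thesis
      by (rule prime_within_insert[OF insert.IH[OF insert.prems(1) RW] RW insert.hyps(2)])
  qed
qed

text \<open>Only the finitely many variables of the three polynomials matter, however large the
  ambient ring is.\<close>

theorem irreducible_dvd_mult:
  fixes R M N :: "('v, complex) mpoly"
  assumes "irreducible R" "R dvd M * N"
  shows "R dvd M \<or> R dvd N"
proof -
  have "prime_within (mvars R \<union> mvars M \<union> mvars N) R"
    by (rule irreducible_imp_prime_within) (use assms in auto)
  then show ?thesis using assms(2) unfolding prime_within_def by blast
qed

section \<open>The Nullstellensatz\<close>

definition ideal_set :: "'a::comm_ring_1 set \<Rightarrow> bool"
  where "ideal_set J \<longleftrightarrow> 0 \<in> J \<and> (\<forall>x\<in>J. \<forall>y\<in>J. x + y \<in> J) \<and> (\<forall>x\<in>J. \<forall>r. r * x \<in> J)"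

lemma ideal_setD:
  assumes "ideal_set J"
  shows "0 \<in> J" "x \<in> J \<Longrightarrow> y \<in> J \<Longrightarrow> x + y \<in> J" "x \<in> J \<Longrightarrow> r * x \<in> J"
    "x \<in> J \<Longrightarrow> x * r \<in> J" "x \<in> J \<Longrightarrow> y \<in> J \<Longrightarrow> x - y \<in> J"
proof -
  show *: "0 \<in> J" "x \<in> J \<Longrightarrow> y \<in> J \<Longrightarrow> x + y \<in> J" "x \<in> J \<Longrightarrow> r * x \<in> J" for x y r
    using assms by (auto simp: ideal_set_def)
  show "x \<in> J \<Longrightarrow> x * r \<in> J" using *(3)[of x r] by (simp add: mult.commute)
  show "x \<in> J \<Longrightarrow> y \<in> J \<Longrightarrow> x - y \<in> J" using *(2)[of x "-1 * y"] *(3)[of y "-1"] by simp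
qed

lemma ideal_set_sum:
  assumes "ideal_set J" "\<And>x. x \<in> S \<Longrightarrow> f x \<in> J"
  shows "sum f S \<in> J"
  using assms(2) by (induction S rule: infinite_finite_induct) (auto intro: ideal_setD[OF assms(1)])

text \<open>The last clause expresses that the quotient by \<open>M\<close> is a field, without
  forming the quotient: by maximality, \<open>M\<close> and \<open>f\<close> together generate
  1.\<close>

lemma maximal_ideal_exists:
  fixes J :: "'a::comm_ring_1 set"
  assumes "ideal_set J" "1 \<notin> J"
  shows "\<exists>M. ideal_set M \<and> J \<subseteq> M \<and> 1 \<notin> M \<and> (\<forall>f. f \<notin> M \<longrightarrow> (\<exists>g. g * f - 1 \<in> M))"
proof -
  define \<A> where "\<A> = {I. ideal_set I \<and> 1 \<notin> I \<and> J \<subseteq> I}"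
  have "\<exists>M\<in>\<A>. \<forall>X\<in>\<A>. M \<subseteq> X \<longrightarrow> X = M"
  proof (rule subset_Zorn_nonempty)
    show "\<A> \<noteq> {}" using assms by (auto simp: \<A>_def)
  next
    fix \<C> assume C: "\<C> \<noteq> {}" "subset.chain \<A> \<C>"
    then have CA: "\<And>I. I \<in> \<C> \<Longrightarrow> ideal_set I \<and> 1 \<notin> I \<and> J \<subseteq> I"
      and lin: "\<And>I K. I \<in> \<C> \<Longrightarrow> K \<in> \<C> \<Longrightarrow> I \<subseteq> K \<or> K \<subseteq> I"
      by (auto simp: subset.chain_def \<A>_def subset_chain_def)
    have "x + y \<in> \<Union>\<C>" if xy: "x \<in> \<Union>\<C>" "y \<in> \<Union>\<C>" for x y
    proof -
      obtain I K where IK: "I \<in> \<C>" "K \<in> \<C>" "x \<in> I" "y \<in> K" using xy by blast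
      then obtain L where "L \<in> \<C>" "x \<in> L" "y \<in> L" using lin[OF IK(1,2)] by blast
      then show ?thesis using CA[of L] ideal_setD(2)[of L x y] by blast
    qed
    moreover have "r * x \<in> \<Union>\<C>" if "x \<in> \<Union>\<C>" for x r
      using that CA ideal_setD(3) by blast
    moreover obtain I where I: "I \<in> \<C>" using C(1) by blast
    then have "0 \<in> \<Union>\<C>" "J \<subseteq> \<Union>\<C>" using CA[OF I] ideal_setD(1)[of I] by blast+
    ultimately have "ideal_set (\<Union>\<C>)" "J \<subseteq> \<Union>\<C>" by (simp_all only: ideal_set_def) blast
    moreover have "1 \<notin> \<Union>\<C>" using CA by blast
    ultimately show "\<Union>\<C> \<in> \<A>" by (simp add: \<A>_def)
  qed
  then obtain M where M: "ideal_set M" "1 \<notin> M" "J \<subseteq> M" and max: "\<And>X. X \<in> \<A> \<Longrightarrow> M \<subseteq> X \<Longrightarrow> X = M"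
    by (auto simp: \<A>_def)
  have "\<exists>g. g * f - 1 \<in> M" if f: "f \<notin> M" for f
  proof -
    define X where "X = {m + g * f | m g. m \<in> M}"
    have XI: "m + g * f \<in> X" if "m \<in> M" for m g using that by (auto simp: X_def)
    have "ideal_set X"
      unfolding ideal_set_def
    proof (intro conjI ballI allI)
      show "0 \<in> X" using XI[OF ideal_setD(1)[OF M(1)], of 0] by simp
    next
      fix x y assume "x \<in> X" "y \<in> X"
      then obtain m g m' g' where "x = m + g * f" "y = m' + g' * f" "m \<in> M" "m' \<in> M"
        by (auto simp: X_def)
      then show "x + y \<in> X" using XI[of "m + m'" "g + g'"] ideal_setD(2)[OF M(1)]
        by (simp add: algebra_simps)
    next
      fix x r assume "x \<in> X"
      then obtain m g where "x = m + g * f" "m \<in> M" by (auto simp: X_def)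
      then show "r * x \<in> X" using XI[of "r * m" "r * g"] ideal_setD(3)[OF M(1)]
        by (simp add: algebra_simps)
    qed
    moreover have MX: "M \<subseteq> X" using XI[of _ 0] by auto
    moreover have "f \<in> X" using XI[OF ideal_setD(1)[OF M(1)], of 1] by simp
    then have "X \<noteq> M" using f by blast
    ultimately have "1 \<in> X" using max[of X] M(3) by (auto simp: \<A>_def)
    then obtain m g where mg: "1 = m + g * f" "m \<in> M" by (auto simp: X_def)
    then have "g * f - 1 = (-1) * m" by (simp add: algebra_simps)
    then have "g * f - 1 \<in> M" using ideal_setD(3)[OF M(1) mg(2)] by metis
    then show ?thesis by blast
  qed
  then show ?thesis using M by blast
qed

section \<open>The weak Nullstellensatz by a cardinality argument\<close>

lemma finite_bounded_exponents: "finite {m :: 'v::finite \<Rightarrow>\<^sub>0 nat. \<forall>v. lookup m v \<le> N}"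
proof (rule finite_imageD)
  have "lookup ` {m :: 'v \<Rightarrow>\<^sub>0 nat. \<forall>v. lookup m v \<le> N} \<subseteq> (\<Pi>\<^sub>E v\<in>UNIV. {..N})"
    by auto
  then show "finite (lookup ` {m :: 'v \<Rightarrow>\<^sub>0 nat. \<forall>v. lookup m v \<le> N})"
    by (rule finite_subset) (simp add: finite_PiE)
  show "inj_on lookup {m :: 'v \<Rightarrow>\<^sub>0 nat. \<forall>v. lookup m v \<le> N}"
    by (rule inj_onI) (simp only: Poly_Mapping.lookup_inject)
qed

text \<open>
  The polynomials in finitely many variables have countable dimension: by pigeonhole, infinitely
  many members of the family have their monomials in a common finite set.
\<close>

lemma uncountable_family_dependent:
  fixes g :: "real \<Rightarrow> ('v::finite, complex) mpoly"
  assumes "inj g"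
  shows "\<exists>B c. finite B \<and> (\<exists>a\<in>B. c a \<noteq> 0) \<and> (\<Sum>a\<in>B. Const (c a) * g a) = 0"
proof -
  define bnd where "bnd a N \<longleftrightarrow> (\<forall>m\<in>keys (g a). \<forall>v. lookup m v \<le> N)" for a N
  have "\<exists>N. bnd a N" for a
  proof -
    define N where "N = Max ((\<lambda>(m, v). lookup m v) ` (keys (g a) \<times> UNIV))"
    have "lookup m v \<le> N" if "m \<in> keys (g a)" for m v
      unfolding N_def by (rule Max_ge) (use that in \<open>auto intro!: image_eqI[of _ _ "(m, v)"]\<close>)
    then show ?thesis by (auto simp: bnd_def)
  qed
  then have "UNIV \<subseteq> (\<Union>N. {a. bnd a N})" by auto
  then have "\<not> (\<forall>N. countable {a. bnd a N})"
    using uncountable_UNIV_real countable_UN[of UNIV "\<lambda>N. {a. bnd a N}"] by (meson countableI_type countable_subset)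
  then obtain N where "uncountable {a. bnd a N}" by blast
  then have inf: "infinite {a. bnd a N}" using countable_finite by blast
  define E :: "('v \<Rightarrow>\<^sub>0 nat) set" where "E = {m. \<forall>v. lookup m v \<le> N}"
  have fE: "finite E" unfolding E_def by (rule finite_bounded_exponents)
  interpret V: vector_space "\<lambda>(c::complex) (P::('v, complex) mpoly). Const c * P"
    by unfold_locales (auto simp: Const_simps algebra_simps)
  define T where "T = (\<lambda>m. single m (1::complex)) ` E"
  have "g a \<in> V.span T" if "bnd a N" for a
  proof -
    have "g a = (\<Sum>m\<in>keys (g a). Const (lookup (g a) m) * single m 1)"
      by (rule poly_mapping_eqI)
         (auto simp: lookup_sum lookup_single when_def sum.delta in_keys_iff Const_def mult_single)
    also have "\<dots> \<in> V.span T"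
      using that by (intro V.span_sum V.span_scale V.span_base) (auto simp: T_def E_def bnd_def)
    finally show ?thesis .
  qed
  then have "g ` {a. bnd a N} \<subseteq> V.span T" by auto
  moreover have "infinite (g ` {a. bnd a N})"
    using inf assms by (metis finite_imageD inj_on_subset subset_UNIV)
  moreover have "finite T" using fE by (simp add: T_def)
  ultimately have "V.dependent (g ` {a. bnd a N})"
    using V.independent_span_bound by blast
  then obtain S u where S: "finite S" "S \<subseteq> g ` {a. bnd a N}" "\<exists>v\<in>S. u v \<noteq> 0" "(\<Sum>v\<in>S. Const (u v) * v) = 0"
    by (auto simp: V.dependent_explicit)
  define B where "B = g -` S"
  have SB: "S = g ` B" using S(2) by (auto simp: B_def)
  have "finite B" unfolding B_def using S(1) assms by (rule finite_vimageI)
  moreover have "(\<Sum>a\<in>B. Const (u (g a)) * g a) = 0"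
    using S(4) unfolding SB by (subst (asm) sum.reindex) (use assms in \<open>auto intro: inj_on_subset\<close>)
  moreover have "\<exists>a\<in>B. u (g a) \<noteq> 0" using S(3) unfolding SB by auto
  ultimately show ?thesis by (intro exI[of _ B] exI[of _ "\<lambda>a. u (g a)"]) blast
qed

definition subst_poly :: "complex poly \<Rightarrow> ('v, complex) mpoly \<Rightarrow> ('v, complex) mpoly"
  where "subst_poly q f = poly (map_poly Const q) f"

lemma subst_poly_pCons [simp]: "subst_poly (pCons a q) f = Const a + f * subst_poly q f"
  by (cases "a = 0 \<and> q = 0") (auto simp: subst_poly_def map_poly_pCons Const_zero)

lemma subst_poly_0 [simp]: "subst_poly 0 f = 0"
  by (simp add: subst_poly_def)

lemma subst_poly_add: "subst_poly (p + q) f = subst_poly p f + subst_poly q f"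
proof (induction p arbitrary: q)
  case (pCons a p)
  then show ?case by (cases q) (simp add: Const_simps algebra_simps)
qed auto

lemma subst_poly_smult: "subst_poly (smult c p) f = Const c * subst_poly p f"
  by (induction p) (auto simp: Const_simps algebra_simps)

lemma subst_poly_mult: "subst_poly (p * q) f = subst_poly p f * subst_poly q f"
  by (induction p) (auto simp: subst_poly_add subst_poly_smult Const_simps algebra_simps)

lemma subst_poly_sum: "subst_poly (sum p S) f = (\<Sum>x\<in>S. subst_poly (p x) f)"
  by (induction S rule: infinite_finite_induct) (auto simp: subst_poly_add)

lemma subst_poly_prod: "subst_poly (prod p S) f = (\<Prod>x\<in>S. subst_poly (p x) f)"
  by (induction S rule: infinite_finite_induct) (auto simp: subst_poly_mult Const_one one_pCons)

text \<open>If \<open>f\<close> were congruent to no constant, every \<open>f - r\<close> with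
  \<open>r\<close> real would be invertible modulo \<open>M\<close>. These inverses form an
  uncountable family, hence are linearly dependent. Clearing denominators gives a nonzero polynomial
  in one variable that maps \<open>f\<close> into \<open>M\<close>, but such a polynomial splits
  into linear factors and \<open>M\<close> is prime.\<close>

lemma maximal_ideal_residue:
  fixes M :: "('v::finite, complex) mpoly set"
  assumes M: "ideal_set M" "1 \<notin> M" and inv: "\<And>f. f \<notin> M \<Longrightarrow> \<exists>g. g * f - 1 \<in> M"
  shows "\<exists>a. f - Const a \<in> M"
proof (rule ccontr)
  assume "\<not> (\<exists>a. f - Const a \<in> M)"
  then have notM: "f - Const a \<notin> M" for a by blast
  note I = ideal_setD[OF M(1)]
  have prime: "y \<in> M" if xy: "x * y \<in> M" "x \<notin> M" for x y
  proof -
    obtain g where g: "g * x - 1 \<in> M" using inv xy(2) by blast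
    have "y = g * (x * y) - (g * x - 1) * y" by (simp add: algebra_simps)
    also have "\<dots> \<in> M" using xy(1) g by (intro I(5)[OF I(3) I(4)])
    finally show ?thesis .
  qed
  \<comment> \<open>\<open>f\<close> is transcendental modulo \<open>M\<close>: a root of
    \<open>q\<close> splits off a factor \<open>f - z\<close>, which is not in \<open>M\<close> and
    can be cancelled because \<open>M\<close> is prime.\<close>
  have noroot: "q = 0" if "subst_poly q f \<in> M" for q
    using that
  proof (induction "degree q" arbitrary: q rule: less_induct)
    case less
    show ?case
    proof (cases "degree q = 0")
      case True
      then obtain c where q: "q = [:c:]" by (rule degree_eq_zeroE)
      show ?thesis
      proof (rule ccontr)
        assume "q \<noteq> 0"
        then have "1 = Const (1 / c) * subst_poly q f"
          by (simp add: q Const_one flip: Const_simps(4))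
        then have "1 \<in> M" using less.prems I(3) by metis
        then show False using M(2) by simp
      qed
    next
      case False
      then have "\<not> constant (poly q)" by (simp add: constant_degree)
      then obtain z where "poly q z = 0" using fundamental_theorem_of_algebra by blast
      then obtain q' where q': "q = [:-z, 1:] * q'" by (auto simp: poly_eq_0_iff_dvd elim: dvdE)
      have "(f - Const z) * subst_poly q' f \<in> M"
      proof -
        have "subst_poly [:- z, 1:] f = f - Const z"
          using ring_hom_fun_uminus[OF ring_hom_Const, of z] by (simp add: Const_one)
        then show ?thesis using less.prems by (simp only: q' subst_poly_mult)
      qed
      then have "subst_poly q' f \<in> M" using prime notM by blast
      moreover have "degree q' < degree q"
        using False by (cases "q' = 0") (auto simp: q' degree_mult_eq simp del: mult_pCons_left)
      ultimately have "q' = 0" using less.hyps by blast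
      then show ?thesis using q' by simp
    qed
  qed
  have "\<exists>g. g * (f - Const (of_real r)) - 1 \<in> M" for r :: real
    using inv notM by blast
  then obtain g where g: "\<And>r::real. g r * (f - Const (of_real r)) - 1 \<in> M" by metis
  \<comment> \<open>Subtracting the relations for \<open>r\<close> and \<open>s\<close> leaves
    \<open>(s - r) * g r\<close> in \<open>M\<close>; but \<open>g r\<close> is invertible modulo
    \<open>M\<close>.\<close>
  have "inj g"
  proof (rule injI, rule ccontr)
    fix r s assume rs: "g r = g s" "r \<noteq> s"
    define c :: complex where "c = of_real s - of_real r"
    have c0: "c \<noteq> 0" using rs(2) by (simp add: c_def)
    have "(g r * (f - Const (of_real r)) - 1) - (g s * (f - Const (of_real s)) - 1) = Const c * g r"
      by (simp add: rs(1) c_def ring_hom_fun_diff[OF ring_hom_Const] algebra_simps)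
    then have "Const c * g r \<in> M" using g I(5) by metis
    then have "Const (1 / c) * (Const c * g r) \<in> M" by (rule I(3))
    then have "g r \<in> M" using c0 by (simp add: Const_one flip: mult.assoc Const_simps(4))
    then have "g r * (f - Const (of_real r)) - (g r * (f - Const (of_real r)) - 1) \<in> M"
      by (rule I(5)[OF I(4) g])
    moreover have "g r * (f - Const (of_real r)) - (g r * (f - Const (of_real r)) - 1) = 1"
      by (rule diff_diff_eq2[THEN trans]) simp
    ultimately show False using M(2) by metis
  qed
  then obtain B c where B: "finite B" "\<exists>a\<in>B. c a \<noteq> 0" "(\<Sum>a\<in>B. Const (c a) * g a) = 0"
    using uncountable_family_dependent by blast
  define lin where "lin r = [:- complex_of_real r, 1:]" for r
  \<comment> \<open>The linear dependence multiplied by all \<open>f - b\<close> with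
    \<open>b\<close> in \<open>B\<close>, where \<open>g a * (f - a)\<close> is replaced by
    1.\<close>
  define q where "q = (\<Sum>a\<in>B. smult (c a) (\<Prod>b\<in>B - {a}. lin b))"
  have lin: "subst_poly (lin r) f = f - Const (of_real r)" for r
    using ring_hom_fun_uminus[OF ring_hom_Const, of "of_real r"] by (simp add: lin_def Const_one)
  have "subst_poly q f = subst_poly q f - (\<Sum>a\<in>B. Const (c a) * g a) * (\<Prod>b\<in>B. f - Const (of_real b))"
    by (simp add: B(3))
  also have "\<dots> = (\<Sum>a\<in>B. (- Const (c a) * (\<Prod>b\<in>B - {a}. f - Const (of_real b))) * (g a * (f - Const (of_real a)) - 1))"
    unfolding q_def subst_poly_sum sum_distrib_right sum_subtractf[symmetric]
  proof (rule sum.cong[OF refl])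
    fix a assume "a \<in> B"
    then show "subst_poly (smult (c a) (\<Prod>b\<in>B - {a}. lin b)) f -
        Const (c a) * g a * (\<Prod>b\<in>B. f - Const (of_real b)) =
        - Const (c a) * (\<Prod>b\<in>B - {a}. f - Const (of_real b)) * (g a * (f - Const (of_real a)) - 1)"
      by (simp add: subst_poly_smult subst_poly_prod lin prod.remove[OF B(1)] algebra_simps)
  qed
  also have "\<dots> \<in> M" by (intro ideal_set_sum[OF M(1)] I(3) g)
  finally have "q = 0" by (rule noroot)
  obtain a0 where a0: "a0 \<in> B" "c a0 \<noteq> 0" using B(2) by blast
  \<comment> \<open>At \<open>a0\<close> every summand but the one for \<open>a0\<close> contains a
    vanishing factor, so \<open>q\<close> is not zero.\<close>
  have "poly q (of_real a0) = (\<Sum>a\<in>B. c a * (\<Prod>b\<in>B - {a}. of_real a0 - of_real b))"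
    by (simp add: q_def poly_sum poly_prod lin_def)
  also have "\<dots> = (\<Sum>a\<in>B. if a = a0 then c a0 * (\<Prod>b\<in>B - {a0}. of_real a0 - of_real b) else 0)"
    by (rule sum.cong) (use a0(1) B(1) in \<open>auto intro!: prod_zero\<close>)
  also have "\<dots> = c a0 * (\<Prod>b\<in>B - {a0}. of_real a0 - of_real b)"
    using a0(1) B(1) by simp
  finally show False using \<open>q = 0\<close> a0(2) B(1) by auto
qed

text \<open>Modulo a maximal ideal containing \<open>J\<close> the variables are congruent to
  complex numbers. These are the coordinates of the zero, because every polynomial is congruent to
  its value at that point.\<close>

theorem weak_nullstellensatz:
  fixes J :: "('v::finite, complex) mpoly set"
  assumes "ideal_set J" "1 \<notin> J"
  shows "\<exists>a. \<forall>P\<in>J. meval a P = 0"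
proof -
  obtain M where M: "ideal_set M" "J \<subseteq> M" "1 \<notin> M" "\<And>f. f \<notin> M \<Longrightarrow> \<exists>g. g * f - 1 \<in> M"
    using maximal_ideal_exists[OF assms] by blast
  note I = ideal_setD[OF M(1)]
  have "\<exists>a. Var v - Const a \<in> M" for v
    by (rule maximal_ideal_residue[OF M(1,3)]) (rule M(4))
  then obtain a where a: "\<And>v. Var v - Const (a v) \<in> M" by metis
  have res: "P - Const (meval a P) \<in> M" for P
  proof (induction P rule: mpoly_induct)
    case (Const c)
    then show ?case using I(1) by simp
  next
    case (add p q)
    have "p + q - Const (meval a (p + q)) = (p - Const (meval a p)) + (q - Const (meval a q))"
      by (simp add: Const_simps)
    then show ?case using add I(2) by metis
  next
    case (mult p v)
    have "p * Var v - Const (meval a (p * Var v)) =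
        (p - Const (meval a p)) * Var v + Const (meval a p) * (Var v - Const (a v))"
      by (simp add: Const_simps algebra_simps)
    then show ?case using I(2)[OF I(4)[OF mult(1)] I(3)[OF a]] by metis
  qed
  have "meval a P = 0" if P: "P \<in> J" for P
  proof (rule ccontr)
    assume nz: "meval a P \<noteq> 0"
    have "P \<in> M" using P M(2) by blast
    then have "P - (P - Const (meval a P)) \<in> M" by (rule I(5)) (rule res)
    then have "Const (1 / meval a P) * Const (meval a P) \<in> M" by (intro I(3)) simp
    then show False using nz M(3) by (simp add: Const_one flip: Const_simps(4))
  qed
  then show ?thesis by blast
qed

section \<open>Homogeneous polynomials and the projective Nullstellensatz\<close>

lemma mdegree_superset:
  assumes "finite S" "keys m \<subseteq> S"
  shows "mdegree m = (\<Sum>v\<in>S. lookup m v)"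
  unfolding mdegree_def using assms
  by (intro sum.mono_neutral_left) (auto simp: in_keys_iff)

lemma mdegree_UNIV: "mdegree (m :: 'v::finite \<Rightarrow>\<^sub>0 nat) = (\<Sum>v\<in>UNIV. lookup m v)"
  by (rule mdegree_superset) auto

lemma mdegree_add: "mdegree (m + n) = mdegree m + mdegree n"
proof -
  let ?S = "keys m \<union> keys n"
  have "mdegree (m + n) = (\<Sum>v\<in>?S. lookup (m + n) v)"
    using keys_add[of m n] by (intro mdegree_superset) auto
  also have "\<dots> = (\<Sum>v\<in>?S. lookup m v) + (\<Sum>v\<in>?S. lookup n v)"
    by (simp add: lookup_add sum.distrib)
  also have "\<dots> = mdegree m + mdegree n"
    by (simp add: mdegree_superset[of ?S m] mdegree_superset[of ?S n])
  finally show ?thesis .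
qed

lemma mdegree_single [simp]: "mdegree (single v k) = k"
  by (simp add: mdegree_def)

lemma mdegree_zero [simp]: "mdegree 0 = 0"
  by (simp add: mdegree_def)

lemma homogeneous_add: "homogeneous d P \<Longrightarrow> homogeneous d Q \<Longrightarrow> homogeneous d (P + Q)"
  using keys_add[of P Q] by (auto simp: homogeneous_def)

lemma homogeneous_zero [simp]: "homogeneous d 0"
  by (simp add: homogeneous_def)

lemma homogeneous_sum: "(\<And>x. x \<in> S \<Longrightarrow> homogeneous d (f x)) \<Longrightarrow> homogeneous d (sum f S)"
  by (induction S rule: infinite_finite_induct) (auto intro: homogeneous_add)

lemma homogeneous_mult:
  fixes P Q :: "('v, 'a::comm_semiring_1) mpoly"
  assumes "homogeneous d P" "homogeneous e Q"
  shows "homogeneous (d + e) (P * Q)"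
  using assms keys_mult[of P Q] by (fastforce simp: homogeneous_def mdegree_add)

lemma homogeneous_single: "mdegree m = d \<Longrightarrow> homogeneous d (single m a)"
  by (auto simp: homogeneous_def)

lemma homogeneous_Const [simp]: "homogeneous 0 (Const c)"
  by (simp add: Const_def homogeneous_single)

lemma homogeneous_Var [simp]: "homogeneous 1 (Var v)"
  by (simp add: Var_def homogeneous_single)

lemma homogeneous_power:
  fixes P :: "('v, 'a::comm_semiring_1) mpoly"
  assumes "homogeneous d P"
  shows "homogeneous (k * d) (P ^ k)"
proof (induction k)
  case 0
  show ?case by (simp add: homogeneous_def)
next
  case (Suc k)
  then show ?case using homogeneous_mult[OF assms Suc] by simp
qed

text \<open>
  Homogenization in degree \<open>K\<close> with respect to the variable \<open>j\<close>; monomials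
  of degree above \<open>K\<close> are not meant to occur.
\<close>

definition homogenize :: "'v \<Rightarrow> nat \<Rightarrow> ('v, 'a::comm_semiring_1) mpoly \<Rightarrow> ('v, 'a) mpoly"
  where "homogenize j K P = (\<Sum>m\<in>keys P. single (m + single j (K - mdegree m)) (lookup P m))"

lemma homogenize_add: "homogenize j K (P + Q) = homogenize j K P + homogenize j K Q"
  unfolding homogenize_def
  by (rule setsum_keys_plus_distrib) (simp_all add: single_add)

lemma homogenize_zero [simp]: "homogenize j K 0 = 0"
  by (simp add: homogenize_def)

lemma homogenize_single: "homogenize j K (single m a) = single (m + single j (K - mdegree m)) a"
  by (simp add: homogenize_def)

lemma homogenize_sum: "homogenize j K (sum f S) = (\<Sum>x\<in>S. homogenize j K (f x))"
  by (induction S rule: infinite_finite_induct) (auto simp: homogenize_add)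

lemma homogeneous_homogenize:
  assumes "\<And>m. m \<in> keys P \<Longrightarrow> mdegree m \<le> K"
  shows "homogeneous K (homogenize j K P)"
  unfolding homogenize_def
  by (intro homogeneous_sum homogeneous_single) (simp add: mdegree_add assms)

lemma homogenize_mult_homogeneous:
  fixes A F :: "('v, 'a::comm_semiring_1) mpoly"
  assumes F: "homogeneous d F" and K: "\<And>m. m \<in> keys A \<Longrightarrow> d + mdegree m \<le> K"
  shows "homogenize j K (A * F) = homogenize j (K - d) A * F"
proof (induction A rule: mpoly_single_induct)
  case (single m a)
  show ?case
  proof (induction F rule: mpoly_single_induct)
    case (single n b)
    then have "mdegree n = d" using F by (simp add: homogeneous_def)
    then show ?case
      by (simp add: homogenize_single mult_single mdegree_add add_ac)
  qed (auto simp: homogenize_add distrib_left)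
qed (auto simp: homogenize_add distrib_right)

text \<open>The factor \<open>Var j\<close> takes the place of one padding factor, and the strict
  bound ensures that there is one. Thus homogenization removes the multiples of
  \<open>Var j - 1\<close>.\<close>

lemma homogenize_mult_Var:
  fixes B :: "('v, 'a::comm_semiring_1) mpoly"
  assumes K: "\<And>m. m \<in> keys B \<Longrightarrow> mdegree m < K"
  shows "homogenize j K (B * Var j) = homogenize j K B"
proof (induction B rule: mpoly_single_induct)
  case (single m a)
  then have "mdegree m < K" using K by simp
  then have "single j (Suc 0) + single j (K - Suc (mdegree m)) = single j (K - mdegree m)"
    by (simp add: Suc_diff_Suc flip: single_add)
  then show ?case
    by (simp add: homogenize_single Var_def mult_single mdegree_add add.assoc)
qed (auto simp: homogenize_add distrib_right)

text \<open>Without a common zero on the hyperplane \<open>x_j = 1\<close>, the forms and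
  \<open>Var j - 1\<close> generate 1. Homogenizing this identity with respect to \<open>j\<close>
  kills the multiples of \<open>Var j - 1\<close> and turns 1 into a power of the variable.\<close>

lemma power_in_ideal_if_no_zero:
  fixes F :: "'n::finite \<Rightarrow> ('n, complex) mpoly"
  assumes F: "\<And>i. homogeneous d (F i)"
    and nz: "\<And>x. x j = 1 \<Longrightarrow> \<exists>i. meval x (F i) \<noteq> 0"
  shows "\<exists>K0. \<forall>K\<ge>K0. \<exists>A. (\<forall>i. homogeneous (K - d) (A i)) \<and> single (single j K) 1 = (\<Sum>i\<in>UNIV. A i * F i)"
proof -
  define J where "J = {(\<Sum>i\<in>UNIV. A i * F i) + B * (Var j - 1) | A B. True}"
  have JI: "(\<Sum>i\<in>UNIV. A i * F i) + B * (Var j - 1) \<in> J" for A B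
    by (auto simp: J_def)
  have "ideal_set J"
    unfolding ideal_set_def
  proof (intro conjI ballI allI)
    show "0 \<in> J" using JI[of "\<lambda>_. 0" 0] by simp
  next
    fix x y assume "x \<in> J" "y \<in> J"
    then obtain A B A' B' where "x = (\<Sum>i\<in>UNIV. A i * F i) + B * (Var j - 1)"
      "y = (\<Sum>i\<in>UNIV. A' i * F i) + B' * (Var j - 1)" by (auto simp: J_def)
    then have "x + y = (\<Sum>i\<in>UNIV. (A i + A' i) * F i) + (B + B') * (Var j - 1)"
      unfolding distrib_right sum.distrib by (simp only: add.assoc add.left_commute add.commute)
    then show "x + y \<in> J" by (simp only: JI)
  next
    fix x r assume "x \<in> J"
    then obtain A B where "x = (\<Sum>i\<in>UNIV. A i * F i) + B * (Var j - 1)" by (auto simp: J_def)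
    then have "r * x = (\<Sum>i\<in>UNIV. (r * A i) * F i) + (r * B) * (Var j - 1)"
      by (simp only: distrib_left sum_distrib_left mult.assoc)
    then show "r * x \<in> J" by (simp only: JI)
  qed
  moreover have False if zero: "\<And>P. P \<in> J \<Longrightarrow> meval x P = 0" for x
  proof -
    have "meval x (Var j - 1) = 0" using zero[OF JI[of "\<lambda>_. 0" 1]] by simp
    then have "x j = 1" by simp
    moreover have "meval x (F i) = 0" for i
    proof -
      have "(\<Sum>k\<in>UNIV. (if k = i then 1 else 0) * F k) = F i"
        by (simp add: if_distrib[of "\<lambda>x. x * _"] cong: if_cong)
      then show ?thesis using zero[OF JI[of "\<lambda>k. if k = i then 1 else 0" 0]] by simp
    qed
    ultimately show False using nz by blast
  qed
  ultimately have "1 \<in> J" using weak_nullstellensatz[of J] by blast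
  then obtain A B where AB: "1 = (\<Sum>i\<in>UNIV. A i * F i) + B * (Var j - 1)" by (auto simp: J_def)
  \<comment> \<open>Exceeds every degree occurring in \<open>A\<close> and \<open>B\<close> by more
    than \<open>d\<close>, so that homogenizing in degree \<open>K - d\<close> or \<open>K\<close>
    is meaningful for all larger \<open>K\<close>.\<close>
  define K0 where "K0 = d + Suc (Max (mdegree ` (keys B \<union> (\<Union>i. keys (A i)))))"
  have fin: "finite (mdegree ` (keys B \<union> (\<Union>i. keys (A i))))" by simp
  have KA: "d + mdegree m \<le> K0" if "m \<in> keys (A i)" for m i
  proof -
    have "mdegree m \<le> Max (mdegree ` (keys B \<union> (\<Union>i. keys (A i))))"
      by (rule Max_ge[OF fin]) (use that in blast)
    then show ?thesis unfolding K0_def by linarith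
  qed
  have KB: "mdegree m < K0" if "m \<in> keys B" for m
  proof -
    have "mdegree m \<le> Max (mdegree ` (keys B \<union> (\<Union>i. keys (A i))))"
      by (rule Max_ge[OF fin]) (use that in blast)
    then show ?thesis unfolding K0_def by linarith
  qed
  show ?thesis
  proof (intro exI[of _ K0] allI impI)
    fix K assume K: "K0 \<le> K"
    define A' where "A' i = homogenize j (K - d) (A i)" for i
    have "homogeneous (K - d) (A' i)" for i
      unfolding A'_def by (rule homogeneous_homogenize) (use KA K in \<open>fastforce simp: le_diff_conv2\<close>)
    moreover have "single (single j K) 1 = (\<Sum>i\<in>UNIV. A' i * F i)"
    proof -
      \<comment> \<open>Arranged without subtraction: \<open>B\<close> and \<open>B * Var j\<close>
        have the same homogenization, which then cancels from both sides.\<close>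
      have eq: "1 + B = (\<Sum>i\<in>UNIV. A i * F i) + B * Var j" using AB by (simp add: algebra_simps)
      have "homogenize j K (1 + B) = (\<Sum>i\<in>UNIV. A' i * F i) + homogenize j K B"
        unfolding eq homogenize_add homogenize_sum A'_def
      proof -
        have "homogenize j K (B * Var j) = homogenize j K B"
          by (rule homogenize_mult_Var) (use KB K in fastforce)
        moreover have "homogenize j K (A i * F i) = homogenize j (K - d) (A i) * F i" for i
          by (rule homogenize_mult_homogeneous[OF F]) (use KA K in fastforce)
        ultimately show "(\<Sum>x\<in>UNIV. homogenize j K (A x * F x)) + homogenize j K (B * Var j) =
          (\<Sum>i\<in>UNIV. homogenize j (K - d) (A i) * F i) + homogenize j K B" by simp
      qed
      moreover have "homogenize j K (1 + B) = single (single j K) 1 + homogenize j K B"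
        by (simp add: homogenize_add homogenize_single flip: single_one)
      ultimately show ?thesis by simp
    qed
    ultimately show "\<exists>A. (\<forall>i. homogeneous (K - d) (A i)) \<and> single (single j K) 1 = (\<Sum>i\<in>UNIV. A i * F i)"
      by blast
  qed
qed

text \<open>In degree \<open>n * K\<close>, with \<open>n\<close> variables, some exponent of each
  monomial is at least \<open>K\<close>, so the monomial is a multiple of a power that is already in
  the ideal.\<close>

theorem projective_nullstellensatz:
  fixes F :: "'n::finite \<Rightarrow> ('n, complex) mpoly"
  assumes F: "\<And>i. homogeneous d (F i)"
    and nz: "\<And>x j. x j \<noteq> 0 \<Longrightarrow> \<exists>i. meval x (F i) \<noteq> 0"
  shows "\<exists>D\<ge>d. \<forall>\<alpha>. mdegree \<alpha> = D \<longrightarrow>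
    (\<exists>A. (\<forall>i. homogeneous (D - d) (A i)) \<and> single \<alpha> 1 = (\<Sum>i\<in>UNIV. A i * F i))"
proof -
  have "\<exists>K0. \<forall>K\<ge>K0. \<exists>A. (\<forall>i. homogeneous (K - d) (A i)) \<and> single (single j K) 1 = (\<Sum>i\<in>UNIV. A i * F i)" for j
  proof (rule power_in_ideal_if_no_zero[OF F])
    fix x assume "x j = (1::complex)"
    then show "\<exists>i. meval x (F i) \<noteq> 0" by (intro nz[of _ j]) simp
  qed
  then obtain K0 where K0: "\<And>j K. K \<ge> K0 j \<Longrightarrow>
      \<exists>A. (\<forall>i. homogeneous (K - d) (A i)) \<and> single (single j K) 1 = (\<Sum>i\<in>UNIV. A i * F i)"
    by metis
  \<comment> \<open>A common exponent for all variables; adding \<open>d\<close> ensures that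
    \<open>K - d\<close> is a true difference.\<close>
  define K where "K = Max (range K0) + d"
  have KK: "K \<ge> K0 j" for j
  proof -
    have "K0 j \<le> Max (range K0)" by (rule Max_ge) auto
    then show ?thesis unfolding K_def by linarith
  qed
  define D where "D = CARD('n) * K"
  have card: "CARD('n) \<ge> 1" using zero_less_card_finite[where 'a='n] by linarith
  then have "D \<ge> K" by (simp add: D_def)
  then have "D \<ge> d" by (simp add: K_def)
  moreover have "\<exists>A. (\<forall>i. homogeneous (D - d) (A i)) \<and> single \<alpha> 1 = (\<Sum>i\<in>UNIV. A i * F i)"
    if \<alpha>: "mdegree \<alpha> = D" for \<alpha>
  proof -
    have "\<exists>j. lookup \<alpha> j \<ge> K"
    proof (rule ccontr)
      assume "\<not> (\<exists>j. lookup \<alpha> j \<ge> K)"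
      then have "(\<Sum>v\<in>UNIV. lookup \<alpha> v) < (\<Sum>v\<in>(UNIV::'n set). K)"
        by (intro sum_strict_mono) (auto simp: not_le)
      then show False using \<alpha> by (simp add: mdegree_UNIV D_def)
    qed
    then obtain j where j: "lookup \<alpha> j \<ge> K" by blast
    define \<beta> where "\<beta> = \<alpha> - single j K"
    have \<beta>: "\<alpha> = \<beta> + single j K"
      unfolding \<beta>_def
      by (rule poly_mapping_eqI) (use j in \<open>auto simp: lookup_add lookup_minus lookup_single when_def\<close>)
    then have deg: "mdegree \<beta> + K = D" using \<alpha> by (simp add: mdegree_add)
    obtain A where A: "\<And>i. homogeneous (K - d) (A i)" "single (single j K) 1 = (\<Sum>i\<in>UNIV. A i * F i)"
      using K0[OF KK] by blast
    have "mdegree \<beta> + (K - d) = D - d" using deg by (simp add: K_def)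
    then have "homogeneous (D - d) (single \<beta> 1 * A i)" for i
      using homogeneous_mult[OF homogeneous_single[OF refl, of \<beta>] A(1)[of i], of 1] by simp
    moreover have "single \<alpha> 1 = (\<Sum>i\<in>UNIV. (single \<beta> 1 * A i) * F i)"
    proof -
      have "single \<alpha> 1 = single \<beta> 1 * single (single j K) (1::complex)" by (simp add: \<beta> mult_single)
      also have "\<dots> = (\<Sum>i\<in>UNIV. single \<beta> 1 * (A i * F i))" unfolding A(2) by (rule sum_distrib_left)
      finally show ?thesis by (simp add: mult.assoc)
    qed
    ultimately show ?thesis by (intro exI[of _ "\<lambda>i. single \<beta> 1 * A i"]) blast
  qed
  ultimately show ?thesis by blast
qed

section \<open>Macaulay determinants\<close>

lemma finite_mdegree_eq [simp]: "finite {m :: 'n::finite \<Rightarrow>\<^sub>0 nat. mdegree m = d}"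
proof (rule finite_subset[OF _ finite_bounded_exponents[of d]])
  show "{m :: 'n \<Rightarrow>\<^sub>0 nat. mdegree m = d} \<subseteq> {m. \<forall>v. lookup m v \<le> d}"
    by (auto simp: mdegree_UNIV intro: member_le_sum)
qed

text \<open>Turns a point of coefficient space into a system. Entries at monomials of degree other
  than \<open>d\<close> are ignored, which is why equalities of coefficient vectors are only claimed
  on \<open>coeff_vars d\<close>.\<close>

definition form :: "nat \<Rightarrow> ('n \<times> ('n::finite \<Rightarrow>\<^sub>0 nat) \<Rightarrow> complex) \<Rightarrow> 'n \<Rightarrow> ('n, complex) mpoly"
  where "form d c i = (\<Sum>m | mdegree m = d. single m (c (i, m)))"

lemma lookup_form: "lookup (form d c i) m = (if mdegree m = d then c (i, m) else 0)"
  by (auto simp: form_def lookup_sum lookup_single when_def sum.delta)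

lemma homogeneous_form [simp]: "homogeneous d (form d c i)"
  by (auto simp: homogeneous_def in_keys_iff lookup_form split: if_splits)

lemma meval_form: "meval x (form d c i) = (\<Sum>m | mdegree m = d. c (i, m) * xpow x m)"
  by (simp add: form_def)

lemma form_coeffs_of: "homogeneous d (f i) \<Longrightarrow> form d (coeffs_of f) i = f i"
  by (rule poly_mapping_eqI) (auto simp: lookup_form coeffs_of_def homogeneous_def in_keys_iff)

lemma form_cong: "(\<And>m. mdegree m = d \<Longrightarrow> c (i, m) = c' (i, m)) \<Longrightarrow> form d c i = form d c' i"
  by (rule poly_mapping_eqI) (auto simp: lookup_form)

lemma has_nontrivial_zero_iff:
  "has_nontrivial_zero f \<longleftrightarrow> (\<exists>x. (\<exists>j. x j \<noteq> 0) \<and> (\<forall>i. meval x (f i) = 0))"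
proof
  assume "has_nontrivial_zero f"
  then obtain x :: "complex^'a" where "x \<noteq> 0" "\<forall>i. meval (vec_nth x) (f i) = 0"
    by (auto simp: has_nontrivial_zero_def)
  then show "\<exists>x. (\<exists>j. x j \<noteq> 0) \<and> (\<forall>i. meval x (f i) = 0)"
    by (intro exI[of _ "vec_nth x"]) (auto simp: Finite_Cartesian_Product.vec_eq_iff)
next
  assume "\<exists>x. (\<exists>j. x j \<noteq> 0) \<and> (\<forall>i. meval x (f i) = 0)"
  then obtain x j where x: "x j \<noteq> 0" "\<forall>i. meval x (f i) = 0" by blast
  have "vec_nth (vec_lambda x) = x" by (rule ext) simp
  then show "has_nontrivial_zero f"
    unfolding has_nontrivial_zero_def using x
    by (intro exI[of _ "vec_lambda x"]) (auto simp: Finite_Cartesian_Product.vec_eq_iff)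
qed

definition zset :: "nat \<Rightarrow> ('n \<times> ('n::finite \<Rightarrow>\<^sub>0 nat) \<Rightarrow> complex) set"
  where "zset d = {c. \<exists>x. (\<exists>j. x j \<noteq> 0) \<and> (\<forall>i. meval x (form d c i) = 0)}"

lemma zset_iff_has_nontrivial_zero: "c \<in> zset d \<longleftrightarrow> has_nontrivial_zero (form d c)"
  by (simp add: zset_def has_nontrivial_zero_iff)

lemma lookup_Const_mult: "lookup (Const c * P) m = (c::'a::comm_semiring_1) * lookup P m"
proof (induction P rule: mpoly_single_induct)
  case (single n a)
  then show ?case by (simp add: Const_def mult_single lookup_single when_def)
qed (auto simp: lookup_add algebra_simps)

lemma mvars_prod: "mvars (prod f S :: ('v, 'a::comm_semiring_1) mpoly) \<subseteq> (\<Union>x\<in>S. mvars (f x))"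
proof (induction S rule: infinite_finite_induct)
  case (insert x S)
  then have "mvars (f x * prod f S) \<subseteq> mvars (f x) \<union> (\<Union>x\<in>S. mvars (f x))"
    using mvars_mult[of "f x" "prod f S"] by blast
  then show ?case using insert.hyps by simp
qed auto

lemma mvars_det:
  assumes "E \<in> carrier_mat K K" "\<And>i j. i < K \<Longrightarrow> j < K \<Longrightarrow> mvars (E $$ (i, j)) \<subseteq> V"
  shows "mvars (Determinant.det E :: ('v, complex) mpoly) \<subseteq> V"
proof -
  have "mvars (signof p * (\<Prod>i = 0..<K. E $$ (i, p i))) \<subseteq> V" if p: "p permutes {0..<K}" for p
  proof -
    have "mvars (signof p :: ('v, complex) mpoly) = {}" by (auto simp: sign_def)
    moreover have "mvars (\<Prod>i = 0..<K. E $$ (i, p i)) \<subseteq> V"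
    proof (rule order_trans[OF mvars_prod], rule UN_least, rule assms(2))
      fix i assume "i \<in> {0..<K}"
      then show "i < K" "p i < K" using permutes_in_image[OF p, of i] by simp_all
    qed
    ultimately show ?thesis using mvars_mult[of "signof p" "\<Prod>i = 0..<K. E $$ (i, p i)"] by blast
  qed
  then show ?thesis
    unfolding det_def'[OF assms(1)]
    by (intro order_trans[OF mvars_sum] UN_least) auto
qed

text \<open>
  The determinant of a Macaulay matrix: row \<open>\<alpha>\<close> holds the coefficients of
  \<open>\<Sum>\<^sub>i A\<^sub>\<alpha>\<^sub>i F\<^sub>i\<close>, a form of degree \<open>D\<close>.  A common zero \<open>x\<close> of the \<open>F\<^sub>i\<close> puts the vector
  of monomials of \<open>x\<close> in the kernel.
\<close>

lemma macaulay_determinant: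
  fixes A :: "('n::finite \<Rightarrow>\<^sub>0 nat) \<Rightarrow> 'n \<Rightarrow> ('n, complex) mpoly"
  assumes "d \<le> D" and A: "\<And>\<alpha> i. mdegree \<alpha> = D \<Longrightarrow> homogeneous (D - d) (A \<alpha> i)"
  obtains \<Delta> :: "'n coeff_poly" where
    "mvars \<Delta> \<subseteq> {(i, m). mdegree m = d}"
    "\<And>c. c \<in> zset d \<Longrightarrow> meval c \<Delta> = 0"
    "\<And>c s. (\<And>\<alpha>. mdegree \<alpha> = D \<Longrightarrow> (\<Sum>i\<in>UNIV. A \<alpha> i * form d c i) = single \<alpha> (s \<alpha>)) \<Longrightarrow>
       meval c \<Delta> = (\<Prod>\<alpha> | mdegree \<alpha> = D. s \<alpha>)"
proof -
  define M :: "('n \<Rightarrow>\<^sub>0 nat) set" where "M = {m. mdegree m = D}"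
  define K where "K = card M"
  have fM: "finite M" by (simp add: M_def)
  obtain h where h: "bij_betw h {0..<K} M"
    using ex_bij_betw_nat_finite[OF fM] by (auto simp: K_def)
  have hM: "mdegree (h a) = D" if "a < K" for a
    using bij_betw_apply[OF h, of a] that by (auto simp: M_def)
  define P where "P c \<alpha> = (\<Sum>i\<in>UNIV. A \<alpha> i * form d c i)" for c \<alpha>
  \<comment> \<open>The coefficient of \<open>\<beta>\<close> in row \<open>\<alpha>\<close> as a
    linear form in the indeterminate coefficients of the system; the multipliers \<open>A\<close>
    are fixed polynomials.\<close>
  define entry :: "('n \<Rightarrow>\<^sub>0 nat) \<Rightarrow> ('n \<Rightarrow>\<^sub>0 nat) \<Rightarrow> 'n coeff_poly" where
    "entry \<alpha> \<beta> = (\<Sum>i\<in>UNIV. \<Sum>m | mdegree m = d. Const (lookup (A \<alpha> i * single m 1) \<beta>) * Var (i, m))" for \<alpha> \<beta>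
  have meval_entry: "meval c (entry \<alpha> \<beta>) = lookup (P c \<alpha>) \<beta>" for c \<alpha> \<beta>
  proof -
    have *: "lookup (A \<alpha> i * form d c i) \<beta> = (\<Sum>m | mdegree m = d. lookup (A \<alpha> i * single m 1) \<beta> * c (i, m))" for i
    proof -
      have "A \<alpha> i * form d c i = (\<Sum>m | mdegree m = d. Const (c (i, m)) * (A \<alpha> i * single m 1))"
        by (auto simp: form_def sum_distrib_left Const_def mult_single mult.left_commute intro!: sum.cong)
      then show ?thesis by (simp add: lookup_sum lookup_Const_mult mult.commute)
    qed
    show ?thesis by (simp add: entry_def P_def lookup_sum *)
  qed
  have mvars_entry: "mvars (entry \<alpha> \<beta>) \<subseteq> {(i, m). mdegree m = d}" for \<alpha> \<beta>
  proof -
    have "mvars (Const (lookup (A \<alpha> i * single m 1) \<beta>) * Var (i, m)) \<subseteq> {(i, m)}" for i m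
      using mvars_mult[of "Const (lookup (A \<alpha> i * single m 1) \<beta>)" "Var (i, m)"] by auto
    then have "mvars (\<Sum>m | mdegree m = d. Const (lookup (A \<alpha> i * single m 1) \<beta>) * Var (i, m))
        \<subseteq> {(i, m). mdegree m = d}" for i
      by (intro order_trans[OF mvars_sum]) auto
    then show ?thesis unfolding entry_def by (intro order_trans[OF mvars_sum]) auto
  qed
  define E where "E = Matrix.mat K K (\<lambda>(a, b). entry (h a) (h b))"
  define \<Delta> where "\<Delta> = Determinant.det E"
  have E: "E \<in> carrier_mat K K" by (simp add: E_def)
  have \<Delta>: "meval c \<Delta> = Determinant.det (Matrix.mat K K (\<lambda>(a, b). lookup (P c (h a)) (h b)))" for c
  proof -
    interpret hom: comm_ring_hom "meval c" by unfold_locales simp_all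
    have "map_mat (meval c) E = Matrix.mat K K (\<lambda>(a, b). lookup (P c (h a)) (h b))"
      by (rule eq_matI) (auto simp: E_def meval_entry)
    then show ?thesis unfolding \<Delta>_def by (simp flip: hom.hom_det)
  qed
  have P: "homogeneous D (P c \<alpha>)" if "mdegree \<alpha> = D" for c \<alpha>
    unfolding P_def
    using homogeneous_mult[OF A[OF that] homogeneous_form[of d c]] assms(1)
    by (intro homogeneous_sum) simp
  show ?thesis
  proof (rule that[of \<Delta>])
    show "mvars \<Delta> \<subseteq> {(i, m). mdegree m = d}"
      unfolding \<Delta>_def by (rule mvars_det[OF E]) (simp add: E_def mvars_entry)
  next
    fix c :: "'n \<times> ('n \<Rightarrow>\<^sub>0 nat) \<Rightarrow> complex" assume "c \<in> zset d"
    then obtain x j where x: "x j \<noteq> 0" "\<And>i. meval x (form d c i) = 0" by (auto simp: zset_def)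
    define B where "B = Matrix.mat K K (\<lambda>(a, b). lookup (P c (h a)) (h b))"
    define w where "w = Matrix.vec K (\<lambda>b. xpow x (h b))"
    have "B *\<^sub>v w = 0\<^sub>v K"
    proof (rule eq_vecI)
      fix a assume "a < dim_vec (0\<^sub>v K :: complex Matrix.vec)"
      then have a: "a < K" by simp
      have "vec_index (B *\<^sub>v w) a = (\<Sum>b = 0..<K. lookup (P c (h a)) (h b) * xpow x (h b))"
        using a by (simp add: B_def w_def scalar_prod_def)
      also have "\<dots> = (\<Sum>\<beta>\<in>M. lookup (P c (h a)) \<beta> * xpow x \<beta>)"
        by (rule sum.reindex_bij_betw[OF h])
      also have "\<dots> = meval x (P c (h a))"
        unfolding meval_eq_mhom using P[OF hM[OF a]]
        by (intro mhom_superset[symmetric] fM) (auto simp: homogeneous_def M_def)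
      also have "\<dots> = 0" by (simp add: P_def x(2))
      finally show "vec_index (B *\<^sub>v w) a = vec_index (0\<^sub>v K) a" using a by simp
    qed (simp add: B_def)
    moreover have "w \<noteq> 0\<^sub>v K"
    proof
      assume w0: "w = 0\<^sub>v K"
      have "single j D \<in> M" by (simp add: M_def)
      then obtain b where b: "b < K" "h b = single j D"
        using bij_betw_imp_surj_on[OF h] by (metis atLeastLessThan_iff imageE)
      then have "x j ^ D = vec_index w b" by (simp add: w_def)
      then show False using w0 b(1) x(1) by simp
    qed
    ultimately have "Determinant.det B = 0"
    proof -
      have "B \<in> carrier_mat K K" "w \<in> carrier_vec K" by (simp_all add: B_def w_def)
      then show ?thesis using det_0_iff_vec_prod_zero[of B K] \<open>B *\<^sub>v w = 0\<^sub>v K\<close> \<open>w \<noteq> 0\<^sub>v K\<close> by blast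
    qed
    then show "meval c \<Delta> = 0" by (simp add: \<Delta> B_def)
  next
    fix c :: "'n \<times> ('n \<Rightarrow>\<^sub>0 nat) \<Rightarrow> complex" and s
    assume s: "\<And>\<alpha>. mdegree \<alpha> = D \<Longrightarrow> (\<Sum>i\<in>UNIV. A \<alpha> i * form d c i) = single \<alpha> (s \<alpha>)"
    define B where "B = Matrix.mat K K (\<lambda>(a, b). lookup (P c (h a)) (h b))"
    have Ps: "P c (h a) = single (h a) (s (h a))" if "a < K" for a
      using s[OF hM[OF that]] by (simp add: P_def)
    have inj: "h a = h b \<longleftrightarrow> a = b" if "a < K" "b < K" for a b
      using bij_betw_imp_inj_on[OF h] that by (auto simp: inj_on_def)
    \<comment> \<open>Row \<open>\<alpha>\<close> consists of \<open>s \<alpha>\<close> at position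
      \<open>\<alpha>\<close> and zeros, so the matrix is in fact diagonal.\<close>
    have "upper_triangular B"
      by (auto simp: B_def Ps lookup_single when_def inj intro!: upper_triangularI)
    then have "Determinant.det B = prod_list (diag_mat B)"
      by (rule det_upper_triangular[of _ K]) (simp add: B_def)
    also have "\<dots> = (\<Prod>a = 0..<K. s (h a))"
      unfolding prod_list_diag_prod by (auto simp: B_def Ps intro!: prod.cong)
    also have "\<dots> = (\<Prod>\<alpha>\<in>M. s \<alpha>)" by (rule prod.reindex_bij_betw[OF h])
    finally show "meval c \<Delta> = (\<Prod>\<alpha> | mdegree \<alpha> = D. s \<alpha>)" by (simp add: \<Delta> B_def M_def)
  qed
qed

section \<open>The ideal of the resultant\<close>

abbreviation coeff_vars :: "nat \<Rightarrow> ('n \<times> ('n \<Rightarrow>\<^sub>0 nat)) set"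
  where "coeff_vars d \<equiv> {(i, m). mdegree m = d}"

lemma finite_coeff_vars [simp]: "finite (coeff_vars d :: ('n::finite \<times> ('n \<Rightarrow>\<^sub>0 nat)) set)"
proof -
  have "coeff_vars d = (UNIV :: 'n set) \<times> {m :: 'n \<Rightarrow>\<^sub>0 nat. mdegree m = d}" by auto
  then show ?thesis by simp
qed

definition vanishing :: "nat \<Rightarrow> 'n::finite coeff_poly \<Rightarrow> bool"
  where "vanishing d P \<longleftrightarrow> mvars P \<subseteq> coeff_vars d \<and> (\<forall>c\<in>zset d. meval c P = 0)"

lemma xpow_eq_0_at_0:
  assumes "mdegree m > 0" "\<And>j. x j = (0::complex)"
  shows "xpow x m = 0"
proof -
  have "keys m \<noteq> {}" using assms(1) by (auto simp: mdegree_def)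
  then obtain v where "v \<in> keys m" by blast
  then have "x v ^ lookup m v = 0" using assms(2) by (simp add: in_keys_iff)
  then show ?thesis unfolding xpow_def using \<open>v \<in> keys m\<close> by (intro prod_zero) auto
qed

lemma zset_zero_coeffs: "(\<lambda>_. 0) \<in> zset d"
  unfolding zset_def by (auto simp: meval_form intro!: exI[of _ "\<lambda>_. 1"])

text \<open>
  The systems with a nontrivial zero form the image of an affine space under the polynomial
  map \<open>(G, x, q) \<mapsto> q(x) G - G(x) q\<close>, with \<open>q\<close> a single form of degree \<open>d\<close>; hence the
  vanishing ideal is prime.
\<close>

definition zparam :: "nat \<Rightarrow> ('n \<times> ('n::finite \<Rightarrow>\<^sub>0 nat) \<Rightarrow> complex) \<Rightarrow> ('n \<Rightarrow> complex) \<Rightarrow>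
    (('n \<Rightarrow>\<^sub>0 nat) \<Rightarrow> complex) \<Rightarrow> 'n \<times> ('n \<Rightarrow>\<^sub>0 nat) \<Rightarrow> complex"
  where "zparam d G x q = (\<lambda>(i, m). G (i, m) * (\<Sum>n | mdegree n = d. q n * xpow x n) -
     (\<Sum>n | mdegree n = d. G (i, n) * xpow x n) * q m)"

text \<open>At \<open>x\<close> the system takes the value \<open>q(x) G(x) - G(x) q(x) = 0\<close>.
  For \<open>x = 0\<close> positive degree makes both values vanish, so the system is zero and every
  point is a zero; hence the parameters need no restriction.\<close>

lemma zparam_in_zset:
  assumes "d > 0"
  shows "zparam d G x q \<in> zset d"
proof (cases "\<exists>j. x j \<noteq> 0")
  case True
  have "meval x (form d (zparam d G x q) i) = 0" for i
  proof -
    define g s where "g = (\<Sum>n | mdegree n = d. G (i, n) * xpow x n)"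
      and "s = (\<Sum>n | mdegree n = d. q n * xpow x n)"
    have "meval x (form d (zparam d G x q) i) = (\<Sum>m | mdegree m = d. s * (G (i, m) * xpow x m) - g * (q m * xpow x m))"
      unfolding meval_form zparam_def prod.case g_def[symmetric] s_def[symmetric]
      by (rule sum.cong) (simp_all add: algebra_simps)
    also have "\<dots> = s * g - g * s"
      by (simp add: sum_subtractf g_def s_def flip: sum_distrib_left)
    finally show ?thesis by simp
  qed
  then show ?thesis using True by (auto simp: zset_def)
next
  case False
  then have "zparam d G x q = (\<lambda>_. 0)"
    using assms by (auto simp: zparam_def fun_eq_iff xpow_eq_0_at_0)
  then show ?thesis using zset_zero_coeffs by simp
qed

text \<open>Take \<open>G = c\<close> and for \<open>q\<close> the \<open>d\<close>-th power of a
  coordinate that is nonzero at the zero \<open>x\<close>, scaled to the value 1 there. The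
  correction term disappears because \<open>c\<close> vanishes at \<open>x\<close>.\<close>

lemma zparam_surj:
  assumes "c \<in> zset d"
  shows "\<exists>x q. \<forall>v\<in>coeff_vars d. zparam d c x q v = c v"
proof -
  obtain x j where x: "x j \<noteq> 0" "\<And>i. meval x (form d c i) = 0" using assms by (auto simp: zset_def)
  define q where "q m = (if m = single j d then 1 / x j ^ d else 0)" for m
  have "(\<Sum>n | mdegree n = d. q n * xpow x n) = (\<Sum>n | mdegree n = d. if n = single j d then 1 else 0)"
    using x(1) by (intro sum.cong) (auto simp: q_def)
  also have "\<dots> = 1" by (subst sum.delta) auto
  finally have "zparam d c x q v = c v" if "v \<in> coeff_vars d" for v
    using x(2) that by (auto simp: zparam_def meval_form)
  then show ?thesis by blast
qed

text \<open>A line between two points of \<open>zset d\<close> may leave that set. A line between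
  their parameters does not, and along its image \<open>P\<close> and \<open>Q\<close> are
  polynomials in one variable with product zero.\<close>

lemma vanishing_prime:
  assumes d: "d > 0" and mv: "mvars P \<subseteq> coeff_vars d" "mvars Q \<subseteq> coeff_vars d"
    and PQ: "vanishing d (P * Q)"
  shows "vanishing d P \<or> vanishing d Q"
proof (rule ccontr)
  assume "\<not> ?thesis"
  then obtain c c' where c: "c \<in> zset d" "meval c P \<noteq> 0" and c': "c' \<in> zset d" "meval c' Q \<noteq> 0"
    using mv by (auto simp: vanishing_def)
  obtain x q where xq: "\<And>v. v \<in> coeff_vars d \<Longrightarrow> zparam d c x q v = c v"
    using zparam_surj[OF c(1)] by blast
  obtain x' q' where xq': "\<And>v. v \<in> coeff_vars d \<Longrightarrow> zparam d c' x' q' v = c' v"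
    using zparam_surj[OF c'(1)] by blast
  define \<phi> where "\<phi> t = zparam d (\<lambda>v. c v + t * (c' v - c v)) (\<lambda>v. x v + t * (x' v - x v))
    (\<lambda>v. q v + t * (q' v - q v))" for t
  have "polyfun (\<lambda>t. \<phi> t v)" for v
    unfolding \<phi>_def zparam_def split_beta
    by (intro polyfun_diff polyfun_mult polyfun_sum polyfun_add polyfun_const polyfun_id polyfun_xpow)
  then have "polyfun (\<lambda>t. meval (\<phi> t) P)" "polyfun (\<lambda>t. meval (\<phi> t) Q)" by (auto intro: polyfun_meval)
  moreover have "meval (\<phi> t) P * meval (\<phi> t) Q = 0" for t
  proof -
    have "\<phi> t \<in> zset d" unfolding \<phi>_def by (rule zparam_in_zset[OF d])
    then have "meval (\<phi> t) (P * Q) = 0" using PQ by (simp only: vanishing_def)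
    then show ?thesis by simp
  qed
  ultimately have "meval (\<phi> 0) P = 0 \<or> meval (\<phi> 1) Q = 0" using polyfun_mult_eq_zero by blast
  moreover have "meval (\<phi> 0) P = meval c P"
    by (rule meval_cong) (use xq mv(1) in \<open>auto simp: \<phi>_def\<close>)
  moreover have "meval (\<phi> 1) Q = meval c' Q"
    by (rule meval_cong) (use xq' mv(2) in \<open>auto simp: \<phi>_def\<close>)
  ultimately show False using c(2) c'(2) by simp
qed

section \<open>No nonzero element of the ideal avoids the coefficient of a pure power\<close>

lemma norm_xpow_le_1:
  assumes "\<And>i. norm (x i) \<le> 1"
  shows "norm (xpow x m :: complex) \<le> 1"
  unfolding xpow_def prod_norm[symmetric]
  by (rule prod_le_1) (auto simp: norm_power intro: power_le_one assms)

text \<open>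
  Near the system \<open>F\<^sub>i = x\<^sub>i x\<^sub>k\<^sup>d\<^sup>-\<^sup>1\<close> the equations with \<open>i \<noteq> k\<close> have a common zero with \<open>x\<^sub>k = 1\<close>, by
  Brouwer's theorem applied to \<open>x \<mapsto> x - F(x)\<close>.
\<close>

definition base_system :: "nat \<Rightarrow> 'n \<Rightarrow> 'n \<times> ('n::finite \<Rightarrow>\<^sub>0 nat) \<Rightarrow> complex"
  where "base_system d k = (\<lambda>(i, m). if i \<noteq> k \<and> m = single i 1 + single k (d - 1) then 1 else 0)"

lemma zero_near_base_system:
  fixes c :: "'n::finite \<times> ('n \<Rightarrow>\<^sub>0 nat) \<Rightarrow> complex"
  assumes d: "d > 0"
    and close: "\<And>i m. mdegree m = d \<Longrightarrow>
      norm (base_system d k (i, m) - c (i, m)) \<le> 1 / card {m :: 'n \<Rightarrow>\<^sub>0 nat. mdegree m = d}"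
  shows "\<exists>x. x k = 1 \<and> (\<forall>i. i \<noteq> k \<longrightarrow> meval x (form d c i) = 0)"
proof -
  \<comment> \<open>A fixed point in the polydisc \<open>S\<close> with \<open>x_k = 1\<close> is a
    zero of all equations but the \<open>k\<close>-th.\<close>
  define T :: "complex^'n \<Rightarrow> complex^'n" where
    "T y = (\<chi> i. if i = k then 1 else vec_nth y i - meval (vec_nth y) (form d c i))" for y
  define S :: "(complex^'n) set" where "S = {y. vec_nth y k = 1 \<and> (\<forall>i. norm (vec_nth y i) \<le> 1)}"
  have "bounded S"
    unfolding bounded_iff
  proof (intro exI ballI)
    fix y assume y: "y \<in> S"
    have "norm y \<le> (\<Sum>i\<in>UNIV. norm (vec_nth y i))"
      unfolding norm_vec_def by (rule L2_set_le_sum) simp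
    also have "\<dots> \<le> (\<Sum>i\<in>(UNIV::'n set). 1)" using y by (intro sum_mono) (auto simp: S_def)
    finally show "norm y \<le> (\<Sum>i\<in>(UNIV::'n set). 1)" .
  qed
  moreover have "closed S"
    unfolding S_def
    by (intro closed_Collect_conj closed_Collect_all closed_Collect_eq closed_Collect_le continuous_intros)
  ultimately have "compact S" by (simp add: compact_eq_bounded_closed)
  moreover have "convex S"
    unfolding S_def
  proof (rule convexI, safe)
    fix y z :: "complex^'n" and u v :: real and i
    assume uv: "0 \<le> u" "0 \<le> v" "u + v = 1" and y: "vec_nth y k = 1" "\<forall>i. norm (vec_nth y i) \<le> 1"
      and z: "vec_nth z k = 1" "\<forall>i. norm (vec_nth z i) \<le> 1"
    show "vec_nth (u *\<^sub>R y + v *\<^sub>R z) k = 1"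
      by (simp add: uv(3) y(1) z(1) flip: scaleR_left_distrib)
    have "norm (vec_nth (u *\<^sub>R y + v *\<^sub>R z) i) \<le> u * norm (vec_nth y i) + v * norm (vec_nth z i)"
      using uv norm_triangle_ineq[of "u *\<^sub>R vec_nth y i" "v *\<^sub>R vec_nth z i"] by simp
    also have "\<dots> \<le> u * 1 + v * 1"
      using uv y(2) z(2) by (intro add_mono mult_left_mono) auto
    finally show "norm (vec_nth (u *\<^sub>R y + v *\<^sub>R z) i) \<le> 1" using uv(3) by simp
  qed
  moreover have "S \<noteq> {}"
    unfolding S_def by (auto intro!: exI[of _ "\<chi> i. 1"])
  moreover have "continuous_on S T"
    unfolding T_def meval_form xpow_def
  proof (rule continuous_on_vec_lambda)
    fix i
    show "continuous_on S (\<lambda>y. if i = k then 1 else vec_nth y i -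
       (\<Sum>m | mdegree m = d. c (i, m) * (\<Prod>v\<in>keys m. vec_nth y v ^ lookup m v)))"
      by (cases "i = k") (auto intro!: continuous_intros)
  qed
  moreover have "T \<in> S \<rightarrow> S"
  proof
    fix y assume y: "y \<in> S"
    have "norm (vec_nth (T y) i) \<le> 1" for i
    proof (cases "i = k")
      case False
      let ?m = "single i 1 + single k (d - 1)"
      \<comment> \<open>Where \<open>x_k = 1\<close> the base form equals \<open>x_i\<close>, so
        \<open>T\<close> is just the deviation of \<open>c\<close> from the base system. The assumed
        bound divides the admissible total 1 evenly among the monomials.\<close>
      have "meval (vec_nth y) (form d (base_system d k) i) =
          (\<Sum>m | mdegree m = d. if m = ?m then xpow (vec_nth y) ?m else 0)"
        unfolding meval_form using False by (intro sum.cong) (auto simp: base_system_def)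
      also have "\<dots> = xpow (vec_nth y) ?m"
        using d by (subst sum.delta) (auto simp: mdegree_add)
      also have "\<dots> = vec_nth y i" using y by (simp add: xpow_add S_def)
      finally have "vec_nth (T y) i = (\<Sum>m | mdegree m = d. (base_system d k (i, m) - c (i, m)) * xpow (vec_nth y) m)"
        using False by (simp add: T_def meval_form sum_subtractf left_diff_distrib)
      also have "norm \<dots> \<le> (\<Sum>m::'n \<Rightarrow>\<^sub>0 nat | mdegree m = d. (1 / card {m :: 'n \<Rightarrow>\<^sub>0 nat. mdegree m = d}) * 1)"
      proof (rule sum_norm_le)
        fix m :: "'n \<Rightarrow>\<^sub>0 nat" assume "m \<in> {m. mdegree m = d}"
        then have "norm (base_system d k (i, m) - c (i, m)) \<le> 1 / card {m :: 'n \<Rightarrow>\<^sub>0 nat. mdegree m = d}"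
          using close by blast
        moreover have "norm (xpow (vec_nth y) m) \<le> 1"
          using y by (intro norm_xpow_le_1) (auto simp: S_def)
        ultimately show "norm ((base_system d k (i, m) - c (i, m)) * xpow (vec_nth y) m)
            \<le> 1 / card {m :: 'n \<Rightarrow>\<^sub>0 nat. mdegree m = d} * 1"
          unfolding norm_mult by (intro mult_mono) auto
      qed
      also have "\<dots> \<le> 1" by simp
      finally show ?thesis .
    qed (simp add: T_def)
    then show "T y \<in> S" by (auto simp: S_def T_def)
  qed
  ultimately obtain y where y: "y \<in> S" "T y = y" using brouwer by metis
  have "meval (vec_nth y) (form d c i) = 0" if "i \<noteq> k" for i
  proof -
    have "vec_nth (T y) i = vec_nth y i" using y(2) by simp
    then show ?thesis using that by (simp add: T_def)
  qed
  then show ?thesis using y(1) by (intro exI[of _ "vec_nth y"]) (auto simp: S_def)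
qed

text \<open>A system close to the base system enters \<open>zset d\<close> by changing the
  coefficient of \<open>x_k^d\<close> in the \<open>k\<close>-th form alone, and \<open>P\<close>
  does not notice the change. So \<open>P\<close> vanishes near the base system and, by the identity
  principle, along every line through it.\<close>

lemma vanishing_free_eq_0:
  fixes P :: "'n::finite coeff_poly"
  assumes d: "d > 0" and P: "vanishing d P" and free: "(k, single k d) \<notin> mvars P"
  shows "P = 0"
proof (rule meval_eq_zeroD)
  fix a :: "'n \<times> ('n \<Rightarrow>\<^sub>0 nat) \<Rightarrow> complex"
  define \<epsilon> :: real where "\<epsilon> = 1 / card {m :: 'n \<Rightarrow>\<^sub>0 nat. mdegree m = d}"
  have "single k d \<in> {m :: 'n \<Rightarrow>\<^sub>0 nat. mdegree m = d}" by simp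
  then have "card {m :: 'n \<Rightarrow>\<^sub>0 nat. mdegree m = d} > 0" by (metis card_gt_0_iff empty_iff finite_mdegree_eq)
  then have \<epsilon>: "\<epsilon> > 0" by (simp add: \<epsilon>_def)
  define b where "b = base_system d k"
  \<comment> \<open>Bounds the direction of the line, so that parameters below
    \<open>\<epsilon> / B\<close> stay close to the base system; the summand 1 makes it
    positive.\<close>
  define B where "B = (\<Sum>v\<in>coeff_vars d. norm (a v - b v)) + 1"
  have B: "norm (a v - b v) \<le> B" if "v \<in> coeff_vars d" for v
    using member_le_sum[of v "coeff_vars d" "\<lambda>v. norm (a v - b v)"] that by (simp add: B_def)
  have B0: "B > 0" unfolding B_def by (intro add_nonneg_pos sum_nonneg) auto
  define l where "l t = (\<lambda>v. b v + t * (a v - b v))" for t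
  have zero: "meval (l t) P = 0" if t: "t \<in> ball 0 (\<epsilon> / B)" for t
  proof -
    have close: "norm (b (i, m) - l t (i, m)) \<le> \<epsilon>" if "mdegree m = d" for i m
    proof -
      have "norm (b (i, m) - l t (i, m)) = norm t * norm (a (i, m) - b (i, m))"
        by (simp add: l_def norm_mult)
      also have "\<dots> \<le> \<epsilon> / B * B"
        using t B[of "(i, m)"] that B0 \<epsilon> by (intro mult_mono) auto
      finally show ?thesis using B0 by simp
    qed
    obtain x where x: "x k = 1" "\<And>i. i \<noteq> k \<Longrightarrow> meval x (form d (l t) i) = 0"
      using zero_near_base_system[OF d, of k "l t"] close unfolding b_def \<epsilon>_def by blast
    let ?v = "(k, single k d)"
    \<comment> \<open>At \<open>x\<close> the monomial \<open>x_k^d\<close> has the value 1, so this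
      coefficient alone can absorb the value of the \<open>k\<close>-th form.\<close>
    define c where "c = (l t)(?v := l t ?v - meval x (form d (l t) k))"
    have "form d c k = form d (l t) k - single (single k d) (meval x (form d (l t) k))"
      by (rule poly_mapping_eqI) (auto simp: lookup_form lookup_minus lookup_single when_def c_def)
    then have "meval x (form d c k) = 0" by (simp add: x(1))
    moreover have "form d c i = form d (l t) i" if "i \<noteq> k" for i
      using that by (intro form_cong) (auto simp: c_def)
    ultimately have "meval x (form d c i) = 0" for i
      using x(2) by (cases "i = k") auto
    then have "c \<in> zset d" using x(1) by (auto simp: zset_def intro!: exI[of _ x] exI[of _ k])
    then have "meval c P = 0" using P by (simp add: vanishing_def)
    moreover have "meval c P = meval (l t) P"
      by (rule meval_cong) (use free in \<open>auto simp: c_def\<close>)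
    ultimately show ?thesis by simp
  qed
  have "infinite (ball (0::complex) (\<epsilon> / B))"
    using uncountable_ball[of "\<epsilon> / B" "0::complex"] \<epsilon> B0 countable_finite by auto
  moreover have "ball 0 (\<epsilon> / B) \<subseteq> {t. meval (l t) P = 0}" using zero by auto
  ultimately have "infinite {t. meval (l t) P = 0}" by (metis finite_subset)
  moreover have "polyfun (\<lambda>t. meval (l t) P)" unfolding l_def by (rule meval_line)
  ultimately have "meval (l 1) P = 0" using polyfun_eq_zero by blast
  then show "meval a P = 0" by (simp add: l_def)
qed

text \<open>For \<open>\<mu> = 1\<close> this is the system of the normalization. The power of
  \<open>\<mu>\<close> in a value at this system measures the degree in the coefficients of the
  \<open>i0\<close>-th form.\<close>

definition pure_powers :: "nat \<Rightarrow> 'n \<Rightarrow> complex \<Rightarrow> 'n \<times> ('n::finite \<Rightarrow>\<^sub>0 nat) \<Rightarrow> complex"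
  where "pure_powers d i0 \<mu> = (\<lambda>(i, m). if m = single i d then (if i = i0 then \<mu> else 1) else 0)"

lemma form_pure_powers:
  "form d (pure_powers d i0 \<mu>) i = single (single i d) (if i = i0 then \<mu> else 1)"
  by (rule poly_mapping_eqI) (auto simp: lookup_form pure_powers_def lookup_single when_def)

lemma coeffs_of_pure_powers: "coeffs_of (\<lambda>i. Var i ^ d) = pure_powers d i0 1"
  by (auto simp: coeffs_of_def pure_powers_def Var_power lookup_single when_def fun_eq_iff)

text \<open>The exponents of the other variables are free below \<open>d\<close>, and that of
  \<open>i0\<close> makes up the rest of the degree; the bound on \<open>D\<close> says that this
  rest is never negative.\<close>

lemma card_reduced_monomials:
  fixes i0 :: "'n::finite"
  assumes "(CARD('n) - 1) * (d - 1) \<le> D"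
  shows "card {\<alpha>. mdegree \<alpha> = D \<and> (\<forall>j. j \<noteq> i0 \<longrightarrow> lookup \<alpha> j < d)} = d ^ (CARD('n) - 1)"
    (is "card ?S = _")
proof -
  let ?J = "UNIV - {i0}"
  define T where "T = (\<Pi>\<^sub>E j\<in>?J. {..<d})"
  define to where "to \<alpha> = restrict (lookup \<alpha>) ?J" for \<alpha> :: "'n \<Rightarrow>\<^sub>0 nat"
  define from' where "from' f = (\<Sum>j\<in>?J. single j (f j)) + single i0 (D - (\<Sum>j\<in>?J. f j))" for f :: "'n \<Rightarrow> nat"
  have lookup_from: "lookup (from' f) j = (if j = i0 then D - (\<Sum>j\<in>?J. f j) else f j)" for f j
    by (auto simp: from'_def lookup_add lookup_sum lookup_single when_def sum.delta)
  have deg: "mdegree \<alpha> = lookup \<alpha> i0 + (\<Sum>j\<in>?J. lookup \<alpha> j)" for \<alpha> :: "'n \<Rightarrow>\<^sub>0 nat"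
    unfolding mdegree_UNIV by (rule sum.remove) auto
  have "bij_betw to ?S T"
  proof (rule bij_betw_byWitness[of _ from'])
    show "\<forall>\<alpha>\<in>?S. from' (to \<alpha>) = \<alpha>"
    proof
      fix \<alpha> assume "\<alpha> \<in> ?S"
      then have "mdegree \<alpha> = D" by blast
      then show "from' (to \<alpha>) = \<alpha>"
        using deg[of \<alpha>] by (intro poly_mapping_eqI) (auto simp: lookup_from to_def)
    qed
    show "\<forall>f\<in>T. to (from' f) = f"
      by (auto simp: T_def to_def lookup_from fun_eq_iff PiE_def extensional_def)
    show "to ` ?S \<subseteq> T" by (auto simp: to_def T_def split: if_splits)
    show "from' ` T \<subseteq> ?S"
    proof
      fix \<alpha> assume "\<alpha> \<in> from' ` T"
      then obtain f where f: "f \<in> T" "\<alpha> = from' f" by blast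
      have lt: "f j < d" if "j \<noteq> i0" for j using f(1) that by (auto simp: T_def)
      have "(\<Sum>j\<in>?J. f j) \<le> (\<Sum>j\<in>?J. d - 1)"
        using lt by (intro sum_mono) (force simp: less_eq_Suc_le[symmetric])
      also have "\<dots> \<le> D" using assms by (simp add: card_Diff_singleton)
      finally have "(\<Sum>j\<in>?J. f j) \<le> D" .
      then have "mdegree \<alpha> = D" unfolding deg f(2) lookup_from by simp
      then show "\<alpha> \<in> ?S" using lt by (simp add: f(2) lookup_from)
    qed
  qed
  then have "card ?S = card T" by (rule bij_betw_same_card)
  also have "\<dots> = d ^ (CARD('n) - 1)" by (simp add: T_def card_PiE card_Diff_singleton)
  finally show ?thesis .
qed

text \<open>
  Macaulay's matrix in degree \<open>n (d - 1) + 1\<close>, with the equation \<open>F\<^sub>i\<^sub>0\<close> used only for the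
  monomials not divisible by any other \<open>x\<^sub>j\<^sup>d\<close>.
\<close>

lemma macaulay_pure_powers:
  fixes i0 :: "'n::finite"
  assumes d: "d > 0"
  shows "\<exists>\<Delta> :: 'n coeff_poly. vanishing d \<Delta> \<and>
    (\<forall>\<mu>. meval (pure_powers d i0 \<mu>) \<Delta> = \<mu> ^ (d ^ (CARD('n) - 1)))"
proof -
  \<comment> \<open>From this degree on every monomial is divisible by the \<open>d\<close>-th power
    of some variable.\<close>
  define D where "D = CARD('n) * (d - 1) + 1"
  have card: "CARD('n) \<ge> 1" using zero_less_card_finite[where 'a='n] by linarith
  have Deq: "D = (CARD('n) - 1) * (d - 1) + d"
  proof -
    obtain n' d' where "CARD('n) = Suc n'" "d = Suc d'" using card d by (metis Suc_le_D One_nat_def gr0_implies_Suc)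
    then show ?thesis by (simp add: D_def)
  qed
  define big where "big \<alpha> \<longleftrightarrow> (\<exists>j. j \<noteq> i0 \<and> lookup \<alpha> j \<ge> d)" for \<alpha> :: "'n \<Rightarrow>\<^sub>0 nat"
  \<comment> \<open>The equation responsible for row \<open>\<alpha>\<close>. Giving
    \<open>i0\<close> the last choice keeps the number of its rows, and hence the degree bound, as
    small as possible.\<close>
  define \<iota> where "\<iota> \<alpha> = (if big \<alpha> then SOME j. j \<noteq> i0 \<and> lookup \<alpha> j \<ge> d else i0)" for \<alpha>
  have \<iota>_big: "\<iota> \<alpha> \<noteq> i0 \<and> lookup \<alpha> (\<iota> \<alpha>) \<ge> d" if "big \<alpha>" for \<alpha>
    using someI_ex[of "\<lambda>j. j \<noteq> i0 \<and> lookup \<alpha> j \<ge> d"] that by (simp add: \<iota>_def big_def)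
  have \<iota>: "lookup \<alpha> (\<iota> \<alpha>) \<ge> d" if \<alpha>: "mdegree \<alpha> = D" for \<alpha>
  proof (cases "big \<alpha>")
    case False
    have "D = lookup \<alpha> i0 + (\<Sum>j\<in>UNIV - {i0}. lookup \<alpha> j)"
      unfolding \<alpha>[symmetric] mdegree_UNIV by (rule sum.remove) auto
    also have "(\<Sum>j\<in>UNIV - {i0}. lookup \<alpha> j) \<le> (\<Sum>j\<in>UNIV - {i0}. d - 1)"
      using False by (intro sum_mono) (force simp: big_def not_le)
    finally have "D \<le> lookup \<alpha> i0 + (CARD('n) - 1) * (d - 1)" by (simp add: card_Diff_singleton)
    then show ?thesis using False by (simp add: \<iota>_def Deq)
  qed (use \<iota>_big in blast)
  define A :: "('n \<Rightarrow>\<^sub>0 nat) \<Rightarrow> 'n \<Rightarrow> ('n, complex) mpoly" where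
    "A \<alpha> i = (if i = \<iota> \<alpha> then single (\<alpha> - single i d) 1 else 0)" for \<alpha> i
  have split: "\<alpha> - single (\<iota> \<alpha>) d + single (\<iota> \<alpha>) d = \<alpha>" if "mdegree \<alpha> = D" for \<alpha>
    by (rule poly_mapping_eqI) (use \<iota>[OF that] in \<open>auto simp: lookup_add lookup_minus lookup_single when_def\<close>)
  have hom: "homogeneous (D - d) (A \<alpha> i)" if \<alpha>: "mdegree \<alpha> = D" for \<alpha> i
  proof -
    have "mdegree (\<alpha> - single (\<iota> \<alpha>) d) + d = D"
      using split[OF \<alpha>] \<alpha> by (metis mdegree_add mdegree_single)
    then show ?thesis by (auto simp: A_def intro!: homogeneous_single)
  qed
  have "d \<le> D" using Deq by simp
  obtain \<Delta> :: "'n coeff_poly" where \<Delta>: "mvars \<Delta> \<subseteq> coeff_vars d" "\<And>c. c \<in> zset d \<Longrightarrow> meval c \<Delta> = 0"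
    "\<And>c s. (\<And>\<alpha>. mdegree \<alpha> = D \<Longrightarrow> (\<Sum>i\<in>UNIV. A \<alpha> i * form d c i) = single \<alpha> (s \<alpha>)) \<Longrightarrow>
       meval c \<Delta> = (\<Prod>\<alpha> | mdegree \<alpha> = D. s \<alpha>)"
    using macaulay_determinant[of d D A, OF \<open>d \<le> D\<close> hom] by blast
  have "meval (pure_powers d i0 \<mu>) \<Delta> = \<mu> ^ (d ^ (CARD('n) - 1))" for \<mu>
  proof -
    have "meval (pure_powers d i0 \<mu>) \<Delta> = (\<Prod>\<alpha> | mdegree \<alpha> = D. if \<iota> \<alpha> = i0 then \<mu> else 1)"
    proof (rule \<Delta>(3))
      fix \<alpha> :: "'n \<Rightarrow>\<^sub>0 nat" assume \<alpha>: "mdegree \<alpha> = D"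
      have "(\<Sum>i\<in>UNIV. A \<alpha> i * form d (pure_powers d i0 \<mu>) i) =
          (\<Sum>i\<in>UNIV. if i = \<iota> \<alpha> then single \<alpha> (if \<iota> \<alpha> = i0 then \<mu> else 1) else 0)"
        by (rule sum.cong) (auto simp: A_def form_pure_powers mult_single split[OF \<alpha>])
      then show "(\<Sum>i\<in>UNIV. A \<alpha> i * form d (pure_powers d i0 \<mu>) i) = single \<alpha> (if \<iota> \<alpha> = i0 then \<mu> else 1)"
        by simp
    qed
    also have "\<dots> = (\<Prod>\<alpha> | mdegree \<alpha> = D \<and> \<iota> \<alpha> = i0. \<mu>)"
      by (subst prod.inter_filter[symmetric]) (auto intro!: prod.cong)
    also have "{\<alpha>. mdegree \<alpha> = D \<and> \<iota> \<alpha> = i0} = {\<alpha>. mdegree \<alpha> = D \<and> (\<forall>j. j \<noteq> i0 \<longrightarrow> lookup \<alpha> j < d)}"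
      using \<iota>_big by (auto simp: big_def \<iota>_def not_le[symmetric])
    also have "(\<Prod>\<alpha>\<in>\<dots>. \<mu>) = \<mu> ^ (d ^ (CARD('n) - 1))"
      by (subst prod_constant, subst card_reduced_monomials) (simp_all add: Deq)
    finally show ?thesis .
  qed
  then show ?thesis using \<Delta>(1,2) by (auto simp: vanishing_def)
qed

text \<open>The projective Nullstellensatz for \<open>c\<close> expresses every monomial of some
  degree \<open>D\<close> through the forms. With its cofactors kept fixed, the Macaulay matrix is
  the identity at \<open>c\<close>, while it is singular on \<open>zset d\<close>.\<close>

lemma vanishing_separates:
  fixes c :: "'n \<times> ('n::finite \<Rightarrow>\<^sub>0 nat) \<Rightarrow> complex"
  assumes "c \<notin> zset d"
  shows "\<exists>\<Delta>. vanishing d \<Delta> \<and> meval c \<Delta> = 1"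
proof -
  have "\<exists>i. meval x (form d c i) \<noteq> 0" if "x j \<noteq> 0" for x j
    using assms that by (auto simp: zset_def)
  then obtain D where D: "D \<ge> d" "\<And>\<alpha>. mdegree \<alpha> = D \<Longrightarrow>
      \<exists>A. (\<forall>i. homogeneous (D - d) (A i)) \<and> single \<alpha> 1 = (\<Sum>i\<in>UNIV. A i * form d c i)"
    using projective_nullstellensatz[of d "form d c"] by auto
  then obtain A where A: "\<And>\<alpha> i. mdegree \<alpha> = D \<Longrightarrow> homogeneous (D - d) (A \<alpha> i)"
      "\<And>\<alpha>. mdegree \<alpha> = D \<Longrightarrow> single \<alpha> 1 = (\<Sum>i\<in>UNIV. A \<alpha> i * form d c i)"
    by metis
  obtain \<Delta> :: "'n coeff_poly" where \<Delta>: "mvars \<Delta> \<subseteq> coeff_vars d" "\<And>c. c \<in> zset d \<Longrightarrow> meval c \<Delta> = 0"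
    "\<And>c s. (\<And>\<alpha>. mdegree \<alpha> = D \<Longrightarrow> (\<Sum>i\<in>UNIV. A \<alpha> i * form d c i) = single \<alpha> (s \<alpha>)) \<Longrightarrow>
       meval c \<Delta> = (\<Prod>\<alpha> | mdegree \<alpha> = D. s \<alpha>)"
    using macaulay_determinant[of d D A, OF D(1) A(1)] by blast
  have "meval c \<Delta> = (\<Prod>\<alpha> :: 'n \<Rightarrow>\<^sub>0 nat | mdegree \<alpha> = D. 1)"
    by (rule \<Delta>(3)) (simp add: A(2))
  then show ?thesis using \<Delta>(1,2) by (auto simp: vanishing_def)
qed

text \<open>\<open>R\<close> has least degree in \<open>v\<close> among the nonzero elements of the
  ideal and, among those, least total degree. One factor of \<open>R\<close> lies in the prime
  ideal; the first minimality shows that it has the full degree in \<open>v\<close>, the second that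
  the other factor is a unit. Pseudo-division by \<open>R\<close> leaves remainder 0, and the
  irreducible \<open>R\<close> involves \<open>v\<close>, so it cannot divide the
  multiplier.\<close>

lemma vanishing_generator:
  assumes d: "d > 0"
  shows "\<exists>R :: 'n::finite coeff_poly. irreducible R \<and> vanishing d R \<and> (\<forall>M. vanishing d M \<longrightarrow> R dvd M)"
proof -
  define k :: 'n where "k = undefined"
  define v where "v = (k, single k d)"
  have vV: "v \<in> coeff_vars d" by (simp add: v_def)
  \<comment> \<open>Shows that the ideal is not zero.\<close>
  obtain \<Delta> :: "'n coeff_poly" where \<Delta>: "vanishing d \<Delta>" "meval (pure_powers d k 1) \<Delta> = 1"
    using macaulay_pure_powers[OF d, of k] by auto
  then have "\<Delta> \<noteq> 0" by auto
  define I where "I = {P :: 'n coeff_poly. vanishing d P \<and> P \<noteq> 0}"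
  define N where "N = (LEAST N. \<exists>P\<in>I. deg_in v P = N)"
  have "\<exists>N. \<exists>P\<in>I. deg_in v P = N" using \<Delta>(1) \<open>\<Delta> \<noteq> 0\<close> by (auto simp: I_def)
  then have N: "\<exists>P\<in>I. deg_in v P = N" unfolding N_def by (rule LeastI_ex)
  have Nmin: "N \<le> deg_in v P" if "P \<in> I" for P
    unfolding N_def by (rule Least_le) (use that in blast)
  have "\<exists>R. (R \<in> I \<and> deg_in v R = N) \<and> (\<forall>P. P \<in> I \<and> deg_in v P = N \<longrightarrow> tdeg R \<le> tdeg P)"
    using N ex_has_least_nat[of "\<lambda>P. P \<in> I \<and> deg_in v P = N" _ tdeg] by blast
  then obtain R where R: "R \<in> I" "deg_in v R = N" "\<And>P. P \<in> I \<Longrightarrow> deg_in v P = N \<Longrightarrow> tdeg R \<le> tdeg P"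
    by blast
  have R0: "R \<noteq> 0" "vanishing d R" "mvars R \<subseteq> coeff_vars d" using R(1) by (auto simp: I_def vanishing_def)
  have factor: "B dvd 1" if AB: "R = A * B" and A: "vanishing d A" for A B
  proof -
    have nz: "A \<noteq> 0" "B \<noteq> 0" using AB R0(1) by auto
    have "A \<in> I" using A nz by (simp add: I_def)
    then have "deg_in v A = N" using Nmin[of A] R(2) deg_in_mult[OF nz, of v] AB by simp
    then have "tdeg R \<le> tdeg A" using R(3) \<open>A \<in> I\<close> by blast
    then have "tdeg B = 0" using tdeg_mult[OF nz] AB by simp
    then show ?thesis using nz(2) by (rule is_unit_if_tdeg_0)
  qed
  have "irreducible R"
    unfolding irreducible_def
  proof (intro conjI allI impI)
    show "R \<noteq> 0" by (rule R0(1))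
    show "\<not> R dvd 1"
    proof
      assume "R dvd 1"
      then obtain c where "c \<noteq> 0" "R = Const c" by (auto simp: mpoly_dvd_1_iff)
      moreover have "meval (\<lambda>_. 0) R = 0" using R0(2) zset_zero_coeffs unfolding vanishing_def by blast
      ultimately show False by simp
    qed
    fix A B assume AB: "R = A * B"
    then have nz: "A \<noteq> 0" "B \<noteq> 0" using R0(1) by auto
    have "mvars A \<subseteq> coeff_vars d" "mvars B \<subseteq> coeff_vars d"
      using R0(3) unfolding AB mvars_mult_eq[OF nz] by auto
    then have "vanishing d A \<or> vanishing d B"
      using vanishing_prime[OF d] R0(2) AB by blast
    then show "A dvd 1 \<or> B dvd 1" using factor AB by (metis mult.commute)
  qed
  moreover have "R dvd M" if M: "vanishing d M" for M
  proof -
    define W where "W = coeff_vars d - {v}"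
    have ins: "insert v W = coeff_vars d" using vV by (auto simp: W_def)
    have "mvars R \<subseteq> insert v W" "mvars M \<subseteq> insert v W"
      unfolding ins using R0(3) M by (auto simp: vanishing_def)
    then obtain g q r where gqr: "g \<noteq> 0" "mvars g \<subseteq> W" "mvars q \<subseteq> coeff_vars d" "mvars r \<subseteq> coeff_vars d"
      "g * M = q * R + r" "r = 0 \<or> deg_in v r < deg_in v R"
      using pseudo_division[of R v W M] R0(1) unfolding ins by (auto simp: W_def)
    have "meval c r = 0" if c: "c \<in> zset d" for c
    proof -
      have "meval c (g * M) = meval c (q * R + r)" by (simp only: gqr(5))
      then show ?thesis using M R0(2) c by (simp add: vanishing_def)
    qed
    then have "vanishing d r" using gqr(4) by (simp add: vanishing_def)
    then have "r = 0" using gqr(6) Nmin[of r] R(2) by (cases "r = 0") (auto simp: I_def)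
    then have "R dvd g * M" using gqr(5) by simp
    then have "R dvd g \<or> R dvd M" using irreducible_dvd_mult[OF \<open>irreducible R\<close>] by blast
    moreover have "\<not> R dvd g"
    proof
      assume "R dvd g"
      then have "v \<notin> mvars R" using mvars_dvd[OF _ gqr(1)] gqr(2) by (auto simp: W_def)
      then show False using vanishing_free_eq_0[OF d R0(2)] R0(1) by (simp add: v_def)
    qed
    ultimately show ?thesis by blast
  qed
  ultimately show ?thesis using R0(2) by blast
qed

section \<open>Existence and uniqueness of the resultant\<close>

lemma irreducible_Const_mult:
  fixes R :: "('v, complex) mpoly"
  assumes "irreducible R" "c \<noteq> 0"
  shows "irreducible (Const c * R)"
proof -
  have inv: "Const (1 / c) * (Const c * P) = P" for P :: "('v, complex) mpoly"
    using assms(2) by (simp add: Const_one flip: mult.assoc Const_simps(4))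
  have unit: "Const (1 / c) * P dvd 1 \<longleftrightarrow> P dvd 1" for P :: "('v, complex) mpoly"
  proof
    assume "Const (1 / c) * P dvd 1"
    then show "P dvd 1" by (rule dvd_mult_right)
  next
    assume "P dvd 1"
    moreover have "Const (1 / c) dvd (1 :: ('v, complex) mpoly)"
      by (subst mpoly_dvd_1_iff) (use assms(2) in \<open>auto intro!: exI[of _ "1 / c"]\<close>)
    ultimately show "Const (1 / c) * P dvd 1" using mult_dvd_mono[of _ 1 P 1] by simp
  qed
  show ?thesis
    unfolding irreducible_def
  proof (intro conjI allI impI)
    show "Const c * R \<noteq> 0" using inv[of R] assms(1) by (auto simp: irreducible_def)
    show "\<not> Const c * R dvd 1" using unit[of "Const c * R"] inv[of R] assms(1) by (auto simp: irreducible_def)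
    fix A B assume "Const c * R = A * B"
    then have "R = (Const (1 / c) * A) * B" using inv[of R] by (simp add: mult.assoc)
    then have "Const (1 / c) * A dvd 1 \<or> B dvd 1" using assms(1) unfolding irreducible_def by blast
    then show "A dvd 1 \<or> B dvd 1" by (simp only: unit)
  qed
qed

lemma coeffs_of_form: "v \<in> coeff_vars d \<Longrightarrow> coeffs_of (form d c) v = c v"
  by (auto simp: coeffs_of_def lookup_form)

text \<open>The one place where the definite description is resolved; everything later about the
  resultant rests on these four properties.\<close>

theorem resultant_poly_properties:
  fixes R :: "'n::finite coeff_poly"
  assumes d: "d > 0"
  defines "R \<equiv> resultant_poly d"
  shows "vanishing d R" "vanishing d M \<Longrightarrow> R dvd M" "meval c R = 0 \<longleftrightarrow> c \<in> zset d"
    "meval (pure_powers d i0 1) R = 1"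
proof -
  obtain R0 :: "'n coeff_poly" where R0: "irreducible R0" "vanishing d R0" "\<And>M. vanishing d M \<Longrightarrow> R0 dvd M"
    using vanishing_generator[OF d] by blast
  have zero: "meval c R0 = 0 \<longleftrightarrow> c \<in> zset d" for c
  proof
    assume c: "meval c R0 = 0"
    show "c \<in> zset d"
    proof (rule ccontr)
      assume "c \<notin> zset d"
      then obtain \<Delta> where \<Delta>: "vanishing d \<Delta>" "meval c \<Delta> = 1" using vanishing_separates by blast
      then obtain S where "\<Delta> = R0 * S" using R0(3) by (auto elim: dvdE)
      then show False using c \<Delta>(2) by simp
    qed
  qed (use R0(2) in \<open>auto simp: vanishing_def\<close>)
  define E :: "'n \<times> ('n \<Rightarrow>\<^sub>0 nat) \<Rightarrow> complex" where "E = pure_powers d i0 1"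
  have "E \<notin> zset d"
    using macaulay_pure_powers[OF d, of i0] by (force simp: E_def vanishing_def)
  then have E0: "meval E R0 \<noteq> 0" using zero by blast
  define S where "S = Const (1 / meval E R0) * R0"
  have S1: "meval E S = 1" using E0 by (simp add: S_def)
  have Sv: "vanishing d S"
    using R0(2) mvars_mult[of "Const (1 / meval E R0)" R0] by (auto simp: vanishing_def S_def)
  have R0S: "R0 = Const (meval E R0) * S"
    using E0 by (simp add: S_def Const_one flip: mult.assoc Const_simps(4))
  have Sdvd: "S dvd M" if "vanishing d M" for M
  proof -
    have "S dvd R0" by (subst R0S) (rule dvd_triv_right)
    then show ?thesis using R0(3)[OF that] dvd_trans by blast
  qed
  have Sirr: "irreducible S" unfolding S_def using R0(1) E0 by (intro irreducible_Const_mult) auto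
  have Szero: "meval c S = 0 \<longleftrightarrow> c \<in> zset d" for c
    using zero[of c] E0 by (simp add: S_def)
  have "is_resultant d S"
    unfolding is_resultant_def
  proof (intro conjI allI impI)
    show "mvars S \<subseteq> coeff_vars d" using Sv by (simp add: vanishing_def)
    show "irreducible S" by (rule Sirr)
    show "meval (coeffs_of (\<lambda>i. Var i ^ d)) S = 1"
      using S1 by (simp add: coeffs_of_pure_powers[of d i0] E_def)
    fix f :: "'n \<Rightarrow> ('n, complex) mpoly" assume "\<forall>i. homogeneous d (f i)"
    then have "form d (coeffs_of f) = f" by (auto simp: form_coeffs_of)
    then show "meval (coeffs_of f) S = 0 \<longleftrightarrow> has_nontrivial_zero f"
      by (simp add: Szero zset_iff_has_nontrivial_zero)
  qed
  moreover have "R' = S" if R': "is_resultant d R'" for R'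
  proof -
    have mv: "mvars R' \<subseteq> coeff_vars d" using R' by (simp add: is_resultant_def)
    have "meval c R' = 0" if c: "c \<in> zset d" for c
    proof -
      have "meval c R' = meval (coeffs_of (form d c)) R'"
        by (rule meval_cong, rule coeffs_of_form[symmetric]) (use mv in blast)
      then show ?thesis using R' c by (simp add: is_resultant_def zset_iff_has_nontrivial_zero)
    qed
    then have "vanishing d R'" using mv by (simp add: vanishing_def)
    then obtain u where u: "R' = S * u" using Sdvd by (auto elim: dvdE)
    have "u dvd 1" using R' u Sirr by (auto simp: is_resultant_def irreducible_def)
    then obtain a where a: "u = Const a" by (auto simp: mpoly_dvd_1_iff)
    have "meval E R' = 1" using R' by (simp add: is_resultant_def coeffs_of_pure_powers[of d i0] E_def)
    then have "a = 1" using u a S1 by simp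
    then show ?thesis using u a by (simp add: Const_one)
  qed
  ultimately have "R = S" unfolding R_def resultant_poly_def by (rule the_equality)
  then show "vanishing d R" "vanishing d M \<Longrightarrow> R dvd M" "meval c R = 0 \<longleftrightarrow> c \<in> zset d"
    "meval (pure_powers d i0 1) R = 1"
    using Sv Sdvd Szero S1 by (simp_all add: E_def)
qed

section \<open>Degree and covariance of the resultant\<close>

lemma meval_subst: "meval c (mhom Const \<sigma> P) = meval (\<lambda>v. meval c (\<sigma> v)) P"
  by (rule ring_hom_fun_eqI[OF ring_hom_fun_comp[OF ring_hom_meval ring_hom_mhom[OF ring_hom_Const]] ring_hom_meval])
     (simp_all add: mhom_Const mhom_Var ring_hom_Const)

lemma mvars_subst:
  assumes "\<And>v. v \<in> mvars P \<Longrightarrow> mvars (\<sigma> v :: ('w, 'a::comm_semiring_1) mpoly) \<subseteq> W"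
  shows "mvars (mhom Const \<sigma> P) \<subseteq> W"
  unfolding mhom_def xpow_def
proof (rule order_trans[OF mvars_sum], rule UN_least)
  fix m assume m: "m \<in> keys P"
  have "mvars (\<sigma> v ^ lookup m v) \<subseteq> W" if "v \<in> keys m" for v
  proof -
    have "v \<in> mvars P" using m that by (auto simp: mvars_def)
    then show ?thesis by (rule order_trans[OF mvars_power assms])
  qed
  then have "mvars (\<Prod>v\<in>keys m. \<sigma> v ^ lookup m v) \<subseteq> W"
    by (intro order_trans[OF mvars_prod] UN_least)
  then show "mvars (Const (lookup P m) * (\<Prod>v\<in>keys m. \<sigma> v ^ lookup m v)) \<subseteq> W"
    using mvars_mult[of "Const (lookup P m)" "\<Prod>v\<in>keys m. \<sigma> v ^ lookup m v"] by auto
qed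

text \<open>Both substitutions send \<open>R\<close> to an element of the ideal, that is, to
  \<open>R * Q\<close> and \<open>R * Q'\<close>. Performing one after the other restores
  \<open>R\<close>, so \<open>Q'\<close> times a transform of \<open>Q\<close> is 1, and
  \<open>Q'\<close> is constant.\<close>

lemma resultant_invariance:
  fixes \<sigma> \<sigma>' :: "'n \<times> ('n::finite \<Rightarrow>\<^sub>0 nat) \<Rightarrow> 'n coeff_poly"
  assumes d: "d > 0"
    and mv: "\<And>v. v \<in> coeff_vars d \<Longrightarrow> mvars (\<sigma> v) \<subseteq> coeff_vars d"
      "\<And>v. v \<in> coeff_vars d \<Longrightarrow> mvars (\<sigma>' v) \<subseteq> coeff_vars d"
    and zs: "\<And>c. c \<in> zset d \<Longrightarrow> (\<lambda>v. meval c (\<sigma> v)) \<in> zset d"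
      "\<And>c. c \<in> zset d \<Longrightarrow> (\<lambda>v. meval c (\<sigma>' v)) \<in> zset d"
    and inv: "\<And>c v. v \<in> coeff_vars d \<Longrightarrow> meval (\<lambda>w. meval c (\<sigma>' w)) (\<sigma> v) = c v"
  shows "\<exists>a. \<forall>c. meval (\<lambda>v. meval c (\<sigma>' v)) (resultant_poly d) = a * meval c (resultant_poly d)"
proof -
  define R where "R = (resultant_poly d :: 'n coeff_poly)"
  note Rp = resultant_poly_properties[where 'n = 'n, OF d, folded R_def]
  have Rmv: "mvars R \<subseteq> coeff_vars d" using Rp(1) by (simp add: vanishing_def)
  have Rz: "meval c R = 0" if "c \<in> zset d" for c using Rp(3) that by blast
  have "vanishing d (mhom Const \<sigma> R)" "vanishing d (mhom Const \<sigma>' R)"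
    unfolding vanishing_def meval_subst
    using mvars_subst[of R \<sigma> "coeff_vars d"] mvars_subst[of R \<sigma>' "coeff_vars d"] mv zs Rz Rmv by blast+
  then obtain Q Q' where Q: "mhom Const \<sigma> R = R * Q" "mhom Const \<sigma>' R = R * Q'"
    using Rp(2) by (meson dvdE)
  have "R * (Q' * mhom Const \<sigma>' Q) = R * 1"
  proof (rule mpoly_eqI)
    fix c
    define c' where "c' = (\<lambda>v. meval c (\<sigma>' v))"
    have "meval c R = meval (\<lambda>v. meval c' (\<sigma> v)) R"
      by (rule meval_cong) (use inv Rmv in \<open>auto simp: c'_def\<close>)
    also have "\<dots> = meval c' R * meval c' Q"
      by (simp add: Q(1) flip: meval_subst)
    also have "meval c' R = meval c R * meval c Q'"
      by (simp add: c'_def Q(2) flip: meval_subst)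
    also have "meval c' Q = meval c (mhom Const \<sigma>' Q)" by (simp add: meval_subst c'_def)
    finally show "meval c (R * (Q' * mhom Const \<sigma>' Q)) = meval c (R * 1)" by simp
  qed
  moreover have "R \<noteq> 0" using Rp(4)[of undefined] by auto
  ultimately have "Q' * mhom Const \<sigma>' Q = 1" by (rule mpoly_mult_cancel_left)
  then have "Q' dvd 1" by (metis dvd_triv_left)
  then obtain a where "Q' = Const a" by (auto simp: mpoly_dvd_1_iff)
  then have "meval (\<lambda>v. meval c (\<sigma>' v)) R = a * meval c R" for c
    using Q(2) by (simp add: mult.commute flip: meval_subst)
  then show ?thesis unfolding R_def by blast
qed

text \<open>Once the full power of the variable is split off, no root is left and the cofactor is
  constant.\<close>

lemma poly_nonzero_off_0:
  fixes p :: "complex poly"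
  assumes "\<And>t. t \<noteq> 0 \<Longrightarrow> poly p t \<noteq> 0"
  shows "\<exists>a k. p = monom a k"
proof -
  have "p \<noteq> 0" using assms[of 1] by auto
  then obtain q where q: "p = [:-0, 1:] ^ order 0 p * q" "\<not> [:-0, 1:] dvd q"
    using order_decomp by blast
  have "poly q t \<noteq> 0" for t
  proof (cases "t = 0")
    case True
    then show ?thesis using q(2) by (simp add: poly_eq_0_iff_dvd)
  next
    case False
    then show ?thesis using assms[of t] q(1) by (metis mult_zero_right poly_mult)
  qed
  then have "degree q = 0" using fundamental_theorem_of_algebra[of q] by (auto simp: constant_degree)
  then obtain a where "q = [:a:]" by (rule degree_eq_zeroE)
  then show ?thesis using q(1) by (auto simp: monom_altdef intro!: exI[of _ a] exI[of _ "order 0 p"])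
qed

section \<open>The degree of the resultant in the coefficients of one form\<close>

definition scale_form :: "'n \<Rightarrow> complex \<Rightarrow> ('n \<times> ('n \<Rightarrow>\<^sub>0 nat) \<Rightarrow> complex) \<Rightarrow> 'n \<times> ('n \<Rightarrow>\<^sub>0 nat) \<Rightarrow> complex"
  where "scale_form i s c = (\<lambda>v. (if fst v = i then s else 1) * c v)"

lemma form_scale_form: "form d (scale_form i s c) j = Const (if j = i then s else 1) * form d c j"
  by (rule poly_mapping_eqI) (auto simp: lookup_form scale_form_def lookup_Const_mult)

lemma scale_form_zset: "c \<in> zset d \<Longrightarrow> scale_form i s c \<in> zset d"
  by (force simp: zset_def form_scale_form)

lemma scale_pure_powers: "scale_form i s (pure_powers d i 1) = pure_powers d i s"
  by (auto simp: scale_form_def pure_powers_def fun_eq_iff)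

lemma polyfun_scale_form: "polyfun (\<lambda>s. meval (scale_form i s c) P)"
proof (rule polyfun_meval)
  fix v show "polyfun (\<lambda>s. scale_form i s c v)"
    by (cases "fst v = i") (auto simp: scale_form_def)
qed

lemma pure_powers_not_zset:
  assumes "d > 0" "s \<noteq> 0"
  shows "pure_powers d i s \<notin> zset d"
  using macaulay_pure_powers[OF assms(1), of i] assms(2) by (force simp: vanishing_def)

text \<open>Multiplying one form by \<open>s \<noteq> 0\<close> is an invertible substitution that
  preserves \<open>zset d\<close>, so it multiplies the resultant by a factor depending on
  \<open>s\<close> only. This factor is polynomial in \<open>s\<close> and nonzero off 0, hence a
  power of \<open>s\<close>.\<close>

lemma resultant_scale_form_exponent:
  fixes i :: "'n::finite"
  assumes d: "d > 0"
  obtains k where "\<And>s c. meval (scale_form i s c) (resultant_poly d) = s ^ k * meval c (resultant_poly d)"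
    and "k \<le> d ^ (CARD('n) - 1)"
proof -
  define R where "R = (resultant_poly d :: 'n coeff_poly)"
  note Rp = resultant_poly_properties[where 'n = 'n, OF d, folded R_def]
  define E where "E = pure_powers d i 1"
  have RE: "meval E R = 1" unfolding E_def by (rule Rp(4))
  have scale: "meval (scale_form i s c) R = meval (scale_form i s E) R * meval c R" if s: "s \<noteq> 0" for s c
  proof -
    define \<sigma> where "\<sigma> r v = Const (if fst v = i then r else 1) * (Var v :: 'n coeff_poly)" for r v
    have ev: "(\<lambda>v. meval c (\<sigma> r v)) = scale_form i r c" for r c
      by (auto simp: \<sigma>_def scale_form_def)
    have "\<exists>a. \<forall>c. meval (\<lambda>v. meval c (\<sigma> s v)) (resultant_poly d) = a * meval c (resultant_poly d)"
    proof (rule resultant_invariance[OF d, of "\<sigma> (1 / s)"])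
      fix r and v :: "'n \<times> ('n \<Rightarrow>\<^sub>0 nat)" assume "v \<in> coeff_vars d"
      then show "mvars (\<sigma> (1/s) v) \<subseteq> coeff_vars d" "mvars (\<sigma> s v) \<subseteq> coeff_vars d"
        using mvars_mult[of "Const _" "Var v"] unfolding \<sigma>_def by fastforce+
    next
      fix c v
      show "meval (\<lambda>w. meval c (\<sigma> s w)) (\<sigma> (1 / s) v) = c v"
        using s by (simp add: \<sigma>_def)
    qed (auto simp: ev scale_form_zset)
    then obtain a where a: "\<And>c. meval (scale_form i s c) R = a * meval c R"
      unfolding ev R_def by blast
    then show ?thesis using RE by simp
  qed
  obtain p where p: "\<And>s. meval (scale_form i s E) R = poly p s"
    using polyfun_scale_form[of i E R] by (auto simp: polyfun_def)
  have "poly p s \<noteq> 0" if "s \<noteq> 0" for s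
    using Rp(3) pure_powers_not_zset[OF d that, of i] by (metis E_def p scale_pure_powers)
  then obtain a k where ak: "p = monom a k" using poly_nonzero_off_0 by blast
  have "poly p 1 = 1" using p[of 1] RE by (simp add: scale_form_def)
  then have pk: "poly p s = s ^ k" for s using ak by (simp add: poly_monom)
  \<comment> \<open>Both sides are polynomial in \<open>s\<close>, so the identity extends to
    \<open>s = 0\<close>.\<close>
  have *: "meval (scale_form i s c) R = s ^ k * meval c R" for s c
  proof -
    have "meval (scale_form i s c) R - s ^ k * meval c R = 0"
    proof (rule polyfun_eq_zero[where f = "\<lambda>s. meval (scale_form i s c) R - s ^ k * meval c R"])
      show "polyfun (\<lambda>s. meval (scale_form i s c) R - s ^ k * meval c R)"
        by (intro polyfun_diff polyfun_scale_form polyfun_mult polyfun_power polyfun_id polyfun_const)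
      have "UNIV - {0} \<subseteq> {s. meval (scale_form i s c) R - s ^ k * meval c R = 0}"
        using scale p pk by auto
      moreover have "infinite (UNIV - {0::complex})"
        using infinite_UNIV_char_0 by (simp add: Diff_infinite_finite)
      ultimately show "infinite {s. meval (scale_form i s c) R - s ^ k * meval c R = 0}"
        using finite_subset by blast
    qed
    then show ?thesis by simp
  qed
  obtain \<Delta> where \<Delta>: "vanishing d \<Delta>"
      "\<And>s. meval (pure_powers d i s) \<Delta> = s ^ (d ^ (CARD('n) - 1))"
    using macaulay_pure_powers[OF d, of i] by blast
  obtain S where S: "\<Delta> = R * S" using Rp(2)[OF \<Delta>(1)] by (auto elim: dvdE)
  obtain q where q: "\<And>s. meval (scale_form i s E) S = poly q s"
    using polyfun_scale_form[of i E S] by (auto simp: polyfun_def)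
  \<comment> \<open>The resultant divides the determinant, so \<open>s ^ k\<close> divides the known
    power of \<open>s\<close>; this is the upper bound.\<close>
  have "poly (monom 1 (d ^ (CARD('n) - 1))) s = poly (monom 1 k * q) s" for s
    using \<Delta>(2)[of s] p[of s] q[of s]
    by (simp add: S E_def scale_pure_powers pk poly_monom)
  then have eq: "monom 1 (d ^ (CARD('n) - 1)) = monom 1 k * q" using poly_eq_poly_eq_iff by blast
  then have "q \<noteq> 0" by (metis monom_eq_0_iff mult_zero_right zero_neq_one)
  then have "d ^ (CARD('n) - 1) = k + degree q"
    using arg_cong[OF eq, of degree] by (simp add: degree_mult_eq degree_monom_eq monom_eq_0_iff)
  then show thesis using that[of k] * by (simp add: R_def)
qed

text \<open>The weights are distinct powers of a generic \<open>t\<close>. For two different points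
  the difference of the values is a nonzero polynomial in \<open>t\<close>, and finitely many such
  polynomials have a common non-root.\<close>

lemma separating_functional:
  fixes Z :: "('n::finite \<Rightarrow> complex) set"
  assumes "finite Z" "Z \<subseteq> extensional J"
  shows "\<exists>g. inj_on (\<lambda>z. \<Sum>j\<in>J. g j * z j) Z"
proof -
  obtain f :: "'n \<Rightarrow> nat" where f: "inj f"
    using finite_imp_inj_to_nat_seg[of "UNIV :: 'n set"] by auto
  define p where "p z w = (\<Sum>j\<in>J. monom (z j - w j) (f j))" for z w :: "'n \<Rightarrow> complex"
  have p0: "p z w \<noteq> 0" if zw: "z \<in> Z" "w \<in> Z" "z \<noteq> w" for z w
  proof
    assume 0: "p z w = 0"
    obtain j where j: "j \<in> J" "z j \<noteq> w j"
      using zw assms(2) by (meson extensionalityI subsetD)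
    have "coeff (p z w) (f j) = (\<Sum>i\<in>J. if i = j then z j - w j else 0)"
      using f by (auto simp: p_def coeff_sum inj_eq intro!: sum.cong)
    also have "\<dots> = z j - w j" using j(1) by simp
    finally show False using 0 j(2) by simp
  qed
  have "finite (\<Union>z\<in>Z. \<Union>w\<in>Z - {z}. {t. poly (p z w) t = 0})"
    using assms(1) p0 by (intro finite_UN_I poly_roots_finite) auto
  then obtain t where t: "t \<notin> (\<Union>z\<in>Z. \<Union>w\<in>Z - {z}. {t. poly (p z w) t = 0})"
    using ex_new_if_finite infinite_UNIV_char_0 by blast
  have "inj_on (\<lambda>z. \<Sum>j\<in>J. t ^ f j * z j) Z"
  proof (rule inj_onI, rule ccontr)
    fix z w assume zw: "z \<in> Z" "w \<in> Z" "z \<noteq> w" and eq: "(\<Sum>j\<in>J. t ^ f j * z j) = (\<Sum>j\<in>J. t ^ f j * w j)"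
    have "poly (p z w) t = (\<Sum>j\<in>J. t ^ f j * z j) - (\<Sum>j\<in>J. t ^ f j * w j)"
      by (simp add: p_def poly_sum poly_monom algebra_simps sum_subtractf)
    then show False using t zw eq by auto
  qed
  then show ?thesis by (rule exI[of _ "\<lambda>j. t ^ f j"])
qed

text \<open>
  The degree of the resultant in the coefficients of \<open>F\<^sub>i\<close> is bounded below by intersecting
  the \<open>d\<^sup>n\<^sup>-\<^sup>1\<close> common zeros of \<open>x\<^sub>j\<^sup>d = x\<^sub>i\<^sup>d\<close> (\<open>j \<noteq> i\<close>) with the pencil
  \<open>(\<Sum>\<^sub>j g\<^sub>j x\<^sub>j) x\<^sub>i\<^sup>d\<^sup>-\<^sup>1 + v x\<^sub>i\<^sup>d\<close>: each zero lies on a different member.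
\<close>

lemma resultant_scale_form:
  fixes i :: "'n::finite"
  assumes d: "d > 0"
  shows "meval (scale_form i s c) (resultant_poly d) = s ^ (d ^ (CARD('n) - 1)) * meval c (resultant_poly d)"
proof -
  define R where "R = (resultant_poly d :: 'n coeff_poly)"
  note Rp = resultant_poly_properties[where 'n = 'n, OF d, folded R_def]
  obtain k where k: "\<And>s c. meval (scale_form i s c) R = s ^ k * meval c R"
    and upper: "k \<le> d ^ (CARD('n) - 1)"
    using resultant_scale_form_exponent[OF d, of i] unfolding R_def by blast
  define J where "J = UNIV - {i}"
  define Z where "Z = (\<Pi>\<^sub>E j\<in>J. {z::complex. z ^ d = 1})"
  have cardZ: "card Z = d ^ (CARD('n) - 1)"
    using d by (simp add: Z_def J_def card_PiE card_Diff_singleton card_roots_unity_eq)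
  have finZ: "finite Z"
    unfolding Z_def using d by (intro finite_PiE) (auto simp: finite_roots_unity)
  then obtain g where g: "inj_on (\<lambda>z. \<Sum>j\<in>J. g j * z j) Z"
    using separating_functional[of Z J] by (auto simp: Z_def PiE_def)
  define L where "L = (\<Sum>j\<in>J. Const (g j) * Var j) * Var i ^ (d - 1)"
  \<comment> \<open>The pencil is the case \<open>a = 1\<close>. The second parameter makes the
    \<open>i\<close>-th form homogeneous in \<open>(a, b)\<close>, which will bound the degree in
    \<open>b\<close>.\<close>
  define f where "f a b j = (if j = i then Const a * L + Const b * Var i ^ d else Var j ^ d - Var i ^ d)" for a b j
  have hv: "homogeneous d (Var j ^ d :: ('n, complex) mpoly)" for j
    using homogeneous_power[OF homogeneous_Var, of d j] by simp
  have "homogeneous 1 (\<Sum>j\<in>J. Const (g j) * Var j)"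
    using homogeneous_mult[OF homogeneous_Const homogeneous_Var] by (intro homogeneous_sum) auto
  from homogeneous_mult[OF this homogeneous_power[OF homogeneous_Var, of "d - 1" i]]
  have "homogeneous d L" using d by (simp add: L_def)
  then have "homogeneous d (Const a * L + Const b * Var i ^ d)" for a b
    using homogeneous_mult[OF homogeneous_Const[of a], of d L] homogeneous_mult[OF homogeneous_Const[of b] hv]
    by (intro homogeneous_add) auto
  moreover have "homogeneous d (Var j ^ d - Var i ^ d :: ('n, complex) mpoly)" for j
    using hv[of j] hv[of i] by (auto simp: homogeneous_def in_keys_iff lookup_minus)
  ultimately have hf: "homogeneous d (f a b j)" for a b j by (simp add: f_def)
  define c where "c a b = coeffs_of (f a b)" for a b
  have form_c: "form d (c a b) = f a b" for a b
    unfolding c_def by (rule ext) (rule form_coeffs_of[where f = "f a b", OF hf])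
  have c: "c a b (j, m) = (if j = i then a * lookup L m + b * lookup (Var i ^ d) m
      else lookup (Var j ^ d - Var i ^ d) m)" for a b j m
    by (simp add: c_def coeffs_of_def f_def lookup_add lookup_Const_mult)
  have polyc: "polyfun (\<lambda>b. c a b v)" "polyfun (\<lambda>a. c a b v)" for a b v
  proof -
    obtain j m where v: "v = (j, m)" by (cases v)
    show "polyfun (\<lambda>b. c a b v)" "polyfun (\<lambda>a. c a b v)"
      unfolding v c by (cases "j = i"; simp; intro polyfun_add polyfun_mult polyfun_const polyfun_id)+
  qed
  obtain r where r: "\<And>b. meval (c 1 b) R = poly r b"
    using polyfun_meval[of "\<lambda>b. c 1 b" R] polyc(1) by (auto simp: polyfun_def)
  obtain q where q: "\<And>a. meval (c a 1) R = poly q a"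
    using polyfun_meval[of "\<lambda>a. c a 1" R] polyc(2) by (auto simp: polyfun_def)
  \<comment> \<open>The pair \<open>(1, b)\<close> is \<open>b\<close> times
    \<open>(1 / b, 1)\<close>, and scaling the \<open>i\<close>-th form by \<open>b\<close>
    contributes \<open>b ^ k\<close>.\<close>
  have rq: "poly r b = b ^ k * poly q (inverse b)" if "b \<noteq> 0" for b
  proof -
    have "c 1 b = scale_form i b (c (inverse b) 1)"
      using that by (auto simp: scale_form_def c fun_eq_iff algebra_simps)
    then have "poly r b = meval (scale_form i b (c (inverse b) 1)) R" by (simp flip: r)
    then show ?thesis by (simp add: k q)
  qed
  \<comment> \<open>For \<open>a = 0\<close> the system reads \<open>x_i^d = 0\<close> and
    \<open>x_j^d = x_i^d\<close>, which leaves only the origin. So \<open>q\<close>, and with it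
    \<open>r\<close>, is not zero.\<close>
  have "c 0 1 \<notin> zset d"
  proof
    assume "c 0 1 \<in> zset d"
    then obtain x j where x: "x j \<noteq> 0" "\<And>j. meval x (f 0 1 j) = 0" by (auto simp: zset_def form_c)
    have "x i = 0" using x(2)[of i] d by (simp add: f_def)
    moreover have "x j ^ d = x i ^ d" using x(2)[of j] by (cases "j = i") (auto simp: f_def)
    ultimately show False using x(1) d by (simp add: zero_power)
  qed
  then have "poly q 0 \<noteq> 0" using q Rp(3) by metis
  then have q0: "q \<noteq> 0" by auto
  \<comment> \<open>The factor \<open>b ^ degree q\<close> clears the negative powers of
    \<open>b\<close>. As \<open>reflect_poly q\<close> has at most the degree of \<open>q\<close>,
    this gives \<open>degree r \<le> k\<close>.\<close>
  have "poly (monom 1 (degree q) * r) b = poly (monom 1 k * reflect_poly q) b" if "b \<noteq> 0" for b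
    using that by (simp add: poly_monom rq poly_reflect_poly_nz)
  then have "UNIV - {0} \<subseteq> {b. poly (monom 1 (degree q) * r - monom 1 k * reflect_poly q) b = 0}"
    by auto
  moreover have "infinite (UNIV - {0::complex})"
    using infinite_UNIV_char_0 by (simp add: Diff_infinite_finite)
  ultimately have "infinite {b. poly (monom 1 (degree q) * r - monom 1 k * reflect_poly q) b = 0}"
    by (rule infinite_super)
  then have "monom 1 (degree q) * r - monom 1 k * reflect_poly q = 0"
    using poly_roots_finite by blast
  then have eq: "monom 1 (degree q) * r = monom 1 k * reflect_poly q" by simp
  have refl: "reflect_poly q \<noteq> 0" using q0 by simp
  then have r0: "r \<noteq> 0" using eq by (metis monom_eq_0_iff mult_eq_0_iff one_neq_zero)
  have "degree q + degree r = k + degree (reflect_poly q)"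
    using arg_cong[OF eq, of degree] r0 refl by (simp add: degree_mult_eq degree_monom_eq monom_eq_0_iff)
  then have deg: "degree r \<le> k" using degree_reflect_poly_le[of q] by simp
  \<comment> \<open>The tuple of roots of unity, completed by \<open>x_i = 1\<close>, solves the
    other equations; this \<open>b\<close> makes the \<open>i\<close>-th form vanish as well.
    Injectivity of the functional on \<open>Z\<close> then yields \<open>d ^ (CARD('n) - 1)\<close>
    different roots.\<close>
  have root: "poly r (- (\<Sum>j\<in>J. g j * z j)) = 0" if z: "z \<in> Z" for z
  proof -
    define b where "b = - (\<Sum>j\<in>J. g j * z j)"
    define x where "x = z(i := 1)"
    have "(\<Sum>j\<in>J. g j * x j) = (\<Sum>j\<in>J. g j * z j)" by (rule sum.cong) (auto simp: x_def J_def)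
    then have "meval x (f 1 b i) = 0" by (simp add: f_def L_def b_def x_def)
    moreover have "meval x (f 1 b j) = 0" if "j \<noteq> i" for j
      using z that by (auto simp: f_def x_def Z_def J_def PiE_iff)
    ultimately have "meval x (f 1 b j) = 0" for j by (cases "j = i") auto
    moreover have "x i \<noteq> 0" by (simp add: x_def)
    ultimately have "c 1 b \<in> zset d"
      unfolding zset_def by (intro CollectI exI[of _ x] conjI exI[of _ i] allI) (simp_all add: form_c)
    then show ?thesis using Rp(3)[of "c 1 b"] r[of b] by (simp add: b_def)
  qed
  have "d ^ (CARD('n) - 1) = card ((\<lambda>z. - (\<Sum>j\<in>J. g j * z j)) ` Z)"
    using g cardZ by (subst card_image) (auto simp: inj_on_def)
  also have "\<dots> \<le> card {b. poly r b = 0}"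
    using root by (intro card_mono poly_roots_finite r0) auto
  also have "\<dots> \<le> degree r" by (rule card_poly_roots_bound[OF r0])
  finally have "k = d ^ (CARD('n) - 1)" using deg upper by linarith
  then show ?thesis using k by (simp add: R_def)
qed

lemma resultant_scale_all:
  fixes s :: "'n::finite \<Rightarrow> complex"
  assumes d: "d > 0"
  shows "meval (\<lambda>v. s (fst v) * c v) (resultant_poly d) = (\<Prod>i\<in>UNIV. s i) ^ (d ^ (CARD('n) - 1)) * meval c (resultant_poly d)"
proof -
  have "meval (\<lambda>v. (if fst v \<in> S then s (fst v) else 1) * c v) (resultant_poly d) =
      (\<Prod>i\<in>S. s i) ^ (d ^ (CARD('n) - 1)) * meval c (resultant_poly d)" for S
    using finite[of S]
  proof (induction S rule: finite_induct)
    case (insert i S)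
    have "(\<lambda>v. (if fst v \<in> insert i S then s (fst v) else 1) * c v) =
        scale_form i (s i) (\<lambda>v. (if fst v \<in> S then s (fst v) else 1) * c v)"
      using insert.hyps by (auto simp: scale_form_def fun_eq_iff)
    then show ?case using insert by (simp add: resultant_scale_form[OF d] power_mult_distrib)
  qed simp
  from this[of UNIV] show ?thesis by simp
qed

section \<open>Multiplicative functions of matrices\<close>

definition diagonal_matrix :: "complex^'n^'n \<Rightarrow> bool"
  where "diagonal_matrix A \<longleftrightarrow> (\<forall>i j. i \<noteq> j \<longrightarrow> A $ i $ j = 0)"

text \<open>The identity with \<open>v\<close> added to column \<open>k\<close>. For
  \<open>v k = 0\<close>, left multiplication adds multiples of row \<open>k\<close> to the other
  rows, which clears a whole column at once.\<close>

definition shear :: "'n::finite \<Rightarrow> ('n \<Rightarrow> complex) \<Rightarrow> complex^'n^'n"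
  where "shear k v = (\<chi> i j. (if i = j then 1 else 0) + (if j = k then v i else 0))"

lemma shear_nth: "shear k v $ i $ j = (if i = j then 1 else 0) + (if j = k then v i else 0)"
  by (simp add: shear_def)

lemma shear_mult_left: "(shear k v ** A) $ i $ j = A $ i $ j + v i * A $ k $ j"
proof -
  have "(shear k v ** A) $ i $ j =
      (\<Sum>l\<in>UNIV. (if l = i then A $ i $ j else 0) + (if l = k then v i * A $ k $ j else 0))"
    unfolding matrix_matrix_mult_def by (auto simp: shear_nth algebra_simps intro!: sum.cong)
  then show ?thesis by (simp add: sum.distrib)
qed

lemma shear_mult_right:
  "(A ** shear k v) $ i $ j = A $ i $ j + (if j = k then (\<Sum>l\<in>UNIV. A $ i $ l * v l) else 0)"
proof -
  have "(A ** shear k v) $ i $ j =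
      (\<Sum>l\<in>UNIV. (if l = j then A $ i $ j else 0) + (if j = k then A $ i $ l * v l else 0))"
    unfolding matrix_matrix_mult_def by (auto simp: shear_nth algebra_simps intro!: sum.cong)
  then show ?thesis by (simp add: sum.distrib)
qed

lemma shear_mult_shear:
  assumes "v k = 0"
  shows "shear k u ** shear k v = shear k (\<lambda>i. u i + v i)"
  by (simp add: Finite_Cartesian_Product.vec_eq_iff shear_mult_left) (auto simp: shear_nth assms)

context
  fixes f :: "complex^'n^'n \<Rightarrow> complex"
  assumes mult: "\<And>A B. f (A ** B) = f A * f B"
    and diag: "\<And>A. diagonal_matrix A \<Longrightarrow> (\<And>i. A $ i $ i \<noteq> 0) \<Longrightarrow> f A \<noteq> 0"
begin

text \<open>
  Conjugation by a diagonal matrix turns a shear into its square, so a multiplicative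
  function takes the value 1 on it.
\<close>

lemma multiplicative_shear:
  assumes v: "v k = 0"
  shows "f (shear k v) = 1"
proof -
  have "shear k (\<lambda>_. 0) ** shear k (\<lambda>_. 0) = (shear k (\<lambda>_. 0) :: complex^'n^'n)"
    by (simp add: shear_mult_shear)
  then have "f (shear k (\<lambda>_. 0)) * f (shear k (\<lambda>_. 0)) = f (shear k (\<lambda>_. 0))" by (metis mult)
  moreover have "f (shear k (\<lambda>_. 0)) \<noteq> 0"
    by (rule diag) (auto simp: diagonal_matrix_def shear_nth)
  ultimately have one: "f (shear k (\<lambda>_. 0)) = 1" by simp
  have "shear k v ** shear k (\<lambda>i. - v i) = shear k (\<lambda>_. 0)"
    using v by (simp add: shear_mult_shear)
  then have nz: "f (shear k v) \<noteq> 0" using mult[of "shear k v" "shear k (\<lambda>i. - v i)"] one by auto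
  \<comment> \<open>The entry 1/2 at \<open>k\<close> makes conjugation double \<open>v\<close>, and
    doubling \<open>v\<close> squares the shear.\<close>
  define D :: "complex^'n^'n" where "D = (\<chi> i j. if i = j then (if i = k then 1 / 2 else 1) else 0)"
  have "f D \<noteq> 0" by (rule diag) (auto simp: D_def diagonal_matrix_def)
  have "(\<Sum>l\<in>UNIV. D $ i $ l * v l) = v i" for i
  proof -
    have "(\<Sum>l\<in>UNIV. D $ i $ l * v l) = (\<Sum>l\<in>UNIV. if l = i then v i else 0)"
      by (rule sum.cong) (auto simp: D_def v)
    then show ?thesis by simp
  qed
  then have "D ** shear k v = shear k (\<lambda>i. v i + v i) ** D"
    by (auto simp: Finite_Cartesian_Product.vec_eq_iff shear_mult_left shear_mult_right D_def v)
  then have "f D * f (shear k v) = f (shear k v) * f (shear k v) * f D"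
    using v by (metis mult shear_mult_shear)
  then show ?thesis using nz \<open>f D \<noteq> 0\<close> by simp
qed

end

text \<open>Gaussian elimination by shears, on which both functions are 1; the induction counts the
  columns with nonzero entries off the diagonal. With a nonzero pivot one shear clears column
  \<open>k\<close>, and a column that was already diagonal has a zero in row \<open>k\<close> and
  stays as it is.\<close>

lemma multiplicative_eq_on_invertible:
  fixes f g :: "complex^'n^'n \<Rightarrow> complex"
  assumes f: "\<And>A B. f (A ** B) = f A * f B" and g: "\<And>A B. g (A ** B) = g A * g B"
    and eq: "\<And>A. diagonal_matrix A \<Longrightarrow> f A = g A"
    and nz: "\<And>A. diagonal_matrix A \<Longrightarrow> (\<And>i. A $ i $ i \<noteq> 0) \<Longrightarrow> g A \<noteq> 0"
    and "det A \<noteq> 0"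
  shows "f A = g A"
proof -
  have shear_f: "f (shear k v) = 1" if "v k = 0" for k v
  proof (rule multiplicative_shear[of f])
    fix A :: "complex^'n^'n" assume A: "diagonal_matrix A" "\<And>i. A $ i $ i \<noteq> 0"
    then have "g A \<noteq> 0" by (rule nz)
    then show "f A \<noteq> 0" using eq[OF A(1)] by simp
  qed (simp_all add: f that)
  have shear_g: "g (shear k v) = 1" if "v k = 0" for k v
  proof (rule multiplicative_shear[of g])
    fix A :: "complex^'n^'n" assume "diagonal_matrix A" "\<And>i. A $ i $ i \<noteq> 0"
    then show "g A \<noteq> 0" by (rule nz)
  qed (simp_all add: g that)
  have shear_det: "det (shear k v) = 1" if "v k = 0" for k and v :: "'n \<Rightarrow> complex"
  proof (rule multiplicative_shear[of det])
    fix A :: "complex^'n^'n" assume "diagonal_matrix A" "\<And>i. A $ i $ i \<noteq> 0"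
    then show "det A \<noteq> 0" by (subst det_diagonal) (auto simp: diagonal_matrix_def)
  qed (simp_all add: det_mul that)
  define K where "K A = {j. \<exists>i. i \<noteq> j \<and> A $ i $ j \<noteq> 0}" for A :: "complex^'n^'n"
  show ?thesis
    using assms(5)
  proof (induction "card (K A)" arbitrary: A rule: less_induct)
    case less
    have pivot: "f B = g B" if B: "card (K B) \<le> card (K A)" "det B \<noteq> 0" "k \<in> K B" "B $ k $ k \<noteq> 0" for B k
    proof -
      define w where "w i = (if i = k then 0 else - B $ i $ k / B $ k $ k)" for i
      define C where "C = shear k w ** B"
      have w: "w k = 0" by (simp add: w_def)
      have "K C \<subseteq> K B - {k}"
      proof
        fix j assume "j \<in> K C"
        then obtain i where i: "i \<noteq> j" "B $ i $ j + w i * B $ k $ j \<noteq> 0"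
          by (auto simp: K_def C_def shear_mult_left)
        have "j \<noteq> k" using i B(4) by (auto simp: w_def)
        moreover have "j \<in> K B"
          using i \<open>j \<noteq> k\<close> by (cases "B $ i $ j = 0") (auto simp: K_def)
        ultimately show "j \<in> K B - {k}" by simp
      qed
      then have "K C \<subset> K B" using B(3) by blast
      then have "card (K C) < card (K B)" by (intro psubset_card_mono) auto
      moreover have "det C = det B" unfolding C_def det_mul shear_det[of w k, OF w] by simp
      ultimately have "f C = g C" using less.hyps B by simp
      then show ?thesis unfolding C_def f g shear_f[of w k, OF w] shear_g[of w k, OF w] by simp
    qed
    show ?case
    proof (cases "K A = {}")
      case True
      then show ?thesis by (intro eq) (auto simp: K_def diagonal_matrix_def)
    next
      case False
      then obtain k where k: "k \<in> K A" by blast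
      show ?thesis
      proof (cases "A $ k $ k = 0")
        case False
        then show ?thesis using pivot less.prems k by blast
      next
        case True
        have "row k A \<noteq> 0" using det_zero_row(2)[of k A] less.prems by (auto simp: row_def)
        then obtain l where l: "A $ k $ l \<noteq> 0"
          by (auto simp: row_def Finite_Cartesian_Product.vec_eq_iff)
        \<comment> \<open>The pivot is zero, but row \<open>k\<close> is not: adding column
          \<open>l\<close> to column \<open>k\<close> makes the pivot nonzero. Only column
          \<open>k\<close> changes, and it was counted before.\<close>
        define v :: "'n \<Rightarrow> complex" where "v i = (if i = l then 1 else 0)" for i
        have v: "v k = 0" using l True by (auto simp: v_def)
        define B where "B = A ** shear k v"
        have B: "B $ i $ j = A $ i $ j + (if j = k then A $ i $ l else 0)" for i j
          unfolding B_def shear_mult_right by (simp add: v_def if_distrib cong: if_cong)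
        have "K B \<subseteq> K A"
        proof
          fix j assume "j \<in> K B"
          then show "j \<in> K A" using k by (cases "j = k") (auto simp: K_def B)
        qed
        then have "card (K B) \<le> card (K A)" by (intro card_mono) auto
        moreover have "det B = det A" unfolding B_def det_mul shear_det[of v k, OF v] by simp
        moreover have "B $ k $ k \<noteq> 0" using l True by (simp add: B)
        moreover have "f B = f A" "g B = g A"
          unfolding B_def f g shear_f[of v k, OF v] shear_g[of v k, OF v] by simp_all
        ultimately show ?thesis
        proof (cases "k \<in> K B")
          case True
          then show ?thesis using pivot[of B k] less.prems \<open>card (K B) \<le> card (K A)\<close> \<open>det B = det A\<close>
            \<open>B $ k $ k \<noteq> 0\<close> \<open>f B = f A\<close> \<open>g B = g A\<close> by simp
        next
          case False
          then have "K B \<subset> K A" using \<open>K B \<subseteq> K A\<close> k by blast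
          then have "card (K B) < card (K A)" by (intro psubset_card_mono) auto
          then show ?thesis using less.hyps[of B] less.prems \<open>det B = det A\<close> \<open>f B = f A\<close> \<open>g B = g A\<close> by simp
        qed
      qed
    qed
  qed
qed

section \<open>Linear substitutions and their effect on the resultant\<close>

definition linear_subst :: "complex^'n^'n \<Rightarrow> ('n::finite, complex) mpoly \<Rightarrow> ('n, complex) mpoly"
  where "linear_subst G = mhom Const (\<lambda>j. \<Sum>k\<in>UNIV. Const (G $ j $ k) * Var k)"

lemma ring_hom_linear_subst: "ring_hom_fun (linear_subst G)"
  unfolding linear_subst_def by (rule ring_hom_mhom[OF ring_hom_Const])

lemma meval_linear_subst:
  "meval x (linear_subst G P) = meval (\<lambda>j. \<Sum>k\<in>UNIV. G $ j $ k * x k) P"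
  by (simp add: linear_subst_def meval_subst)

lemma meval_linear_subst_vec:
  "meval (vec_nth x) (linear_subst G P) = meval (vec_nth (G *v x)) P"
  unfolding meval_linear_subst by (rule meval_cong) (simp add: matrix_vector_mult_def)

lemma mpoly_eqI_vec:
  fixes P Q :: "('n::finite, complex) mpoly"
  assumes "\<And>x :: complex^'n. meval (vec_nth x) P = meval (vec_nth x) Q"
  shows "P = Q"
proof (rule mpoly_eqI)
  fix a :: "'n \<Rightarrow> complex"
  have "vec_nth (vec_lambda a) = a" by (rule ext) simp
  then show "meval a P = meval a Q" using assms[of "vec_lambda a"] by simp
qed

lemma linear_subst_linear_subst:
  "linear_subst H (linear_subst G P) = linear_subst (G ** H) P"
  by (rule mpoly_eqI_vec) (simp add: meval_linear_subst_vec matrix_vector_mul_assoc)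

lemma homogeneous_prod:
  fixes f :: "'b \<Rightarrow> ('v, 'a::comm_semiring_1) mpoly"
  assumes "\<And>x. x \<in> S \<Longrightarrow> homogeneous (e x) (f x)"
  shows "homogeneous (\<Sum>x\<in>S. e x) (\<Prod>x\<in>S. f x)"
  using assms
proof (induction S rule: infinite_finite_induct)
  case (insert x S)
  then show ?case using homogeneous_mult[of "e x" "f x" "\<Sum>x\<in>S. e x" "\<Prod>x\<in>S. f x"] by simp
qed (auto simp: homogeneous_def)

lemma homogeneous_linear_subst:
  assumes "homogeneous d P"
  shows "homogeneous d (linear_subst G P)"
  unfolding linear_subst_def mhom_def
proof (rule homogeneous_sum)
  fix m assume "m \<in> keys P"
  then have d: "mdegree m = d" using assms by (simp add: homogeneous_def)
  define l where "l j = (\<Sum>k\<in>UNIV. Const (G $ j $ k) * Var k :: ('a, complex) mpoly)" for j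
  have "homogeneous 1 (l j)" for j
    unfolding l_def using homogeneous_mult[OF homogeneous_Const homogeneous_Var]
    by (intro homogeneous_sum) simp
  from homogeneous_power[OF this] have "homogeneous (lookup m j) (l j ^ lookup m j)" for j by simp
  then have "homogeneous (mdegree m) (xpow l m)"
    unfolding xpow_def mdegree_def by (rule homogeneous_prod)
  then show "homogeneous d (Const (lookup P m) * xpow l m)"
    using homogeneous_mult[OF homogeneous_Const] d by fastforce
qed

text \<open>The action of matrices on coefficient space by \<open>F \<mapsto> F \<circ> G\<close>.
  It is a right action: applying \<open>G\<close> and then \<open>H\<close> amounts to
  \<open>G ** H\<close>.\<close>

definition pull :: "nat \<Rightarrow> complex^'n^'n \<Rightarrow> ('n \<times> ('n::finite \<Rightarrow>\<^sub>0 nat) \<Rightarrow> complex) \<Rightarrow> 'n \<times> ('n \<Rightarrow>\<^sub>0 nat) \<Rightarrow> complex"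
  where "pull d G c = coeffs_of (\<lambda>i. linear_subst G (form d c i))"

lemma form_pull: "form d (pull d G c) i = linear_subst G (form d c i)"
  unfolding pull_def
  by (rule form_coeffs_of[where f = "\<lambda>i. linear_subst G (form d c i)"]) (simp add: homogeneous_linear_subst)

lemma meval_resultant_cong:
  fixes c c' :: "'n \<times> ('n::finite \<Rightarrow>\<^sub>0 nat) \<Rightarrow> complex"
  assumes d: "d > 0" and eq: "\<And>i. form d c i = form d c' i"
  shows "meval c (resultant_poly d) = meval c' (resultant_poly d)"
proof (rule meval_cong)
  fix v :: "'n \<times> ('n \<Rightarrow>\<^sub>0 nat)" assume "v \<in> mvars (resultant_poly d)"
  then have "v \<in> coeff_vars d"
    using resultant_poly_properties(1)[where 'n = 'n, OF d] by (auto simp: vanishing_def)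
  then obtain i m where v: "v = (i, m)" "mdegree m = d" by auto
  then show "c v = c' v" using eq[of i] lookup_form[of d c i m] lookup_form[of d c' i m] by simp
qed

text \<open>The inverse of \<open>G\<close> carries a nontrivial zero of the original system to one
  of the transformed system.\<close>

lemma pull_zset:
  fixes G :: "complex^'n^'n"
  assumes "det G \<noteq> 0" "c \<in> zset d"
  shows "pull d G c \<in> zset d"
proof -
  obtain x j where x: "x j \<noteq> 0" "\<And>i. meval x (form d c i) = 0" using assms(2) by (auto simp: zset_def)
  obtain H where H: "G ** H = Finite_Cartesian_Product.mat 1"
    using assms(1) invertible_det_nz[of G] unfolding invertible_def by blast
  define y where "y = H *v vec_lambda x"
  have Gy: "G *v y = vec_lambda x" by (simp add: y_def matrix_vector_mul_assoc H)
  have xx: "vec_nth (vec_lambda x) = x" by (rule ext) simp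
  have "y \<noteq> 0"
  proof
    assume "y = 0"
    then have "vec_lambda x = 0" using Gy by simp
    then show False using x(1) by (metis xx zero_index)
  qed
  then have "\<exists>j. y $ j \<noteq> 0" by (simp add: Finite_Cartesian_Product.vec_eq_iff)
  moreover have "meval (vec_nth y) (form d (pull d G c) i) = 0" for i
    unfolding form_pull meval_linear_subst_vec Gy xx by (rule x(2))
  ultimately show ?thesis unfolding zset_def by blast
qed

text \<open>A nonzero vector in the kernel of \<open>G\<close> is a zero, since forms of positive
  degree vanish at the origin.\<close>

lemma pull_singular_zset:
  fixes G :: "complex^'n^'n"
  assumes "d > 0" "det G = 0"
  shows "pull d G c \<in> zset d"
proof -
  have "\<not> (\<exists>B. B ** G = Finite_Cartesian_Product.mat 1)"
    using assms(2) invertible_det_nz[of G] invertible_left_inverse[of G] by blast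
  then obtain y where y: "G *v y = 0" "y \<noteq> 0"
    unfolding matrix_left_invertible_ker by blast
  have "meval (vec_nth y) (form d (pull d G c) i) = 0" for i
    unfolding form_pull meval_linear_subst_vec y(1) meval_form
    by (rule sum.neutral) (use assms(1) in \<open>simp add: xpow_eq_0_at_0\<close>)
  moreover have "\<exists>j. y $ j \<noteq> 0" using y(2) by (simp add: Finite_Cartesian_Product.vec_eq_iff)
  ultimately show ?thesis unfolding zset_def by blast
qed

text \<open>For singular \<open>G\<close> both sides vanish. Otherwise invariance gives a constant
  factor, which is read off at the normalization system, where the resultant is 1.\<close>

lemma resultant_pull_const:
  fixes G :: "complex^'n^'n"
  assumes d: "d > 0"
  shows "meval (pull d G c) (resultant_poly d) =
    meval (pull d G (pure_powers d i0 1)) (resultant_poly d) * meval c (resultant_poly d)"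
proof (cases "det G = 0")
  case True
  have "meval (pull d G c') (resultant_poly d) = 0" for c'
    using pull_singular_zset[OF d True, of c'] resultant_poly_properties(3)[where 'n = 'n, OF d] by blast
  then show ?thesis by simp
next
  case False
  \<comment> \<open>The transformed coefficients as linear forms in the original ones, as
    \<open>resultant_invariance\<close> requires.\<close>
  define \<sigma> :: "complex^'n^'n \<Rightarrow> 'n \<times> ('n \<Rightarrow>\<^sub>0 nat) \<Rightarrow> 'n coeff_poly" where
    "\<sigma> H v = (\<Sum>m | mdegree m = d. Const (lookup (linear_subst H (single m 1)) (snd v)) * Var (fst v, m))" for H v
  have ev: "(\<lambda>v. meval c (\<sigma> H v)) = pull d H c" for H c
  proof
    fix v :: "'n \<times> ('n \<Rightarrow>\<^sub>0 nat)"
    obtain i n where v: "v = (i, n)" by (cases v)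
    have "linear_subst H (form d c i) = (\<Sum>m | mdegree m = d. Const (c (i, m)) * linear_subst H (single m 1))"
    proof -
      have "form d c i = (\<Sum>m | mdegree m = d. Const (c (i, m)) * single m 1)"
        by (simp add: form_def Const_def mult_single)
      then show ?thesis
        by (simp add: ring_hom_fun_sum[OF ring_hom_linear_subst] ring_hom_fun_simps(4)[OF ring_hom_linear_subst])
           (simp add: linear_subst_def mhom_Const[OF ring_hom_Const])
    qed
    then show "meval c (\<sigma> H v) = pull d H c v"
      by (simp add: v \<sigma>_def pull_def coeffs_of_def lookup_sum lookup_Const_mult)
         (simp add: mult.commute)
  qed
  have mv: "mvars (\<sigma> H v) \<subseteq> coeff_vars d" for H v
    unfolding \<sigma>_def
  proof (rule order_trans[OF mvars_sum], rule UN_least)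
    fix m assume "m \<in> {m :: 'n \<Rightarrow>\<^sub>0 nat. mdegree m = d}"
    then show "mvars (Const (lookup (linear_subst H (single m 1)) (snd v)) * Var (fst v, m)) \<subseteq> coeff_vars d"
      by (intro order_trans[OF mvars_mult]) auto
  qed
  obtain H where H: "G ** H = Finite_Cartesian_Product.mat 1"
    using False invertible_det_nz[of G] unfolding invertible_def by blast
  then have dH: "det H \<noteq> 0" using det_mul[of G H] by auto
  have inv: "pull d H (pull d G c) v = c v" if v: "v \<in> coeff_vars d" for c v
  proof -
    obtain i m where im: "v = (i, m)" "mdegree m = d" using v by auto
    have "form d (pull d H (pull d G c)) i = form d c i"
      unfolding form_pull linear_subst_linear_subst H
      by (rule mpoly_eqI_vec) (simp add: meval_linear_subst_vec)
    from arg_cong[OF this, of "\<lambda>P. lookup P m"] show ?thesis by (simp add: lookup_form im)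
  qed
  have "\<exists>a. \<forall>c. meval (\<lambda>v. meval c (\<sigma> G v)) (resultant_poly d) = a * meval c (resultant_poly d)"
  proof (rule resultant_invariance[OF d, of "\<sigma> H"])
    fix c and v :: "'n \<times> ('n \<Rightarrow>\<^sub>0 nat)" assume "v \<in> coeff_vars d"
    then show "meval (\<lambda>w. meval c (\<sigma> G w)) (\<sigma> H v) = c v"
      using fun_cong[OF ev[of "pull d G c" H], of v] inv by (simp add: ev)
  qed (simp_all add: mv ev pull_zset False dH)
  then obtain a where a: "\<And>c. meval (pull d G c) (resultant_poly d) = a * meval c (resultant_poly d)"
    unfolding ev by blast
  show ?thesis
    using a[of c] a[of "pure_powers d i0 1"] resultant_poly_properties(4)[OF d, of i0] by simp
qed

theorem resultant_pull:
  fixes G :: "complex^'n^'n"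
  assumes d: "d > 0"
  shows "meval (pull d G c) (resultant_poly d) = det G ^ (d ^ CARD('n)) * meval c (resultant_poly d)"
proof -
  define R where "R = (resultant_poly d :: 'n coeff_poly)"
  define E :: "'n \<times> ('n \<Rightarrow>\<^sub>0 nat) \<Rightarrow> complex" where "E = pure_powers d undefined 1"
  define \<psi> where "\<psi> A = meval (pull d A E) R" for A
  have RE: "meval E R = 1" unfolding E_def R_def by (rule resultant_poly_properties(4)[OF d])
  have const: "meval (pull d A c) R = \<psi> A * meval c R" for A c
    unfolding \<psi>_def R_def E_def by (rule resultant_pull_const[OF d])
  have mult: "\<psi> (A ** B) = \<psi> A * \<psi> B" for A B
  proof -
    have "\<psi> (A ** B) = meval (pull d B (pull d A E)) R"
      unfolding \<psi>_def R_def
      by (rule meval_resultant_cong[OF d]) (simp add: form_pull linear_subst_linear_subst)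
    then show ?thesis using const[of B "pull d A E"] const[of A E] RE by simp
  qed
  have diag: "\<psi> A = det A ^ (d ^ CARD('n))" if A: "diagonal_matrix A" for A
  proof -
    have sub: "(\<Sum>k\<in>UNIV. A $ j $ k * x k) = A $ j $ j * x j" for j x
    proof -
      have "(\<Sum>k\<in>UNIV. A $ j $ k * x k) = (\<Sum>k\<in>UNIV. if k = j then A $ j $ j * x j else 0)"
        using A by (intro sum.cong) (auto simp: diagonal_matrix_def)
      then show ?thesis by simp
    qed
    \<comment> \<open>A diagonal substitution turns \<open>x_i^d\<close> into this multiple of
      itself. The outer power \<open>d\<close> joins the degree \<open>d ^ (CARD('n) - 1)\<close> to
      give the exponent \<open>d ^ CARD('n)\<close>.\<close>
    define s where "s i = (A $ i $ i) ^ d" for i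
    have "\<psi> A = meval (\<lambda>v. s (fst v) * E v) R"
      unfolding \<psi>_def R_def
    proof (rule meval_resultant_cong[OF d])
      fix i
      have "form d (\<lambda>v. s (fst v) * E v) i = Const (s i) * form d E i"
        by (rule poly_mapping_eqI) (auto simp: lookup_form lookup_Const_mult)
      then show "form d (pull d A E) i = form d (\<lambda>v. s (fst v) * E v) i"
        by (intro mpoly_eqI)
           (simp add: form_pull meval_linear_subst sub E_def form_pure_powers s_def power_mult_distrib)
    qed
    also have "\<dots> = (\<Prod>i\<in>UNIV. s i) ^ (d ^ (CARD('n) - 1)) * meval E R"
      unfolding R_def by (rule resultant_scale_all[OF d])
    also have "(\<Prod>i\<in>UNIV. s i) = det A ^ d"
      using A by (subst det_diagonal) (auto simp: s_def diagonal_matrix_def prod_power_distrib)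
    also have "(det A ^ d) ^ (d ^ (CARD('n) - 1)) = det A ^ (d ^ CARD('n))"
    proof -
      have "d * d ^ (CARD('n) - 1) = d ^ CARD('n)"
        using zero_less_card_finite[where 'a = 'n] by (metis power_eq_if less_numeral_extra(3))
      then show ?thesis by (simp flip: power_mult)
    qed
    finally show ?thesis using RE by simp
  qed
  have "\<psi> G = det G ^ (d ^ CARD('n))"
  proof (cases "det G = 0")
    case True
    then have "\<psi> G = 0"
      unfolding \<psi>_def R_def
      using pull_singular_zset[OF d True, of E] resultant_poly_properties(3)[where 'n = 'n, OF d] by blast
    then show ?thesis using True d by (simp add: zero_power)
  next
    case False
    show ?thesis
    proof (rule multiplicative_eq_on_invertible[of \<psi> "\<lambda>A. det A ^ (d ^ CARD('n))"])
      fix A B :: "complex^'n^'n"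
      show "\<psi> (A ** B) = \<psi> A * \<psi> B" by (rule mult)
      show "det (A ** B) ^ (d ^ CARD('n)) = det A ^ (d ^ CARD('n)) * det B ^ (d ^ CARD('n))"
        by (simp add: det_mul power_mult_distrib)
      assume A: "diagonal_matrix A"
      show "\<psi> A = det A ^ (d ^ CARD('n))" by (rule diag[OF A])
      assume "\<And>i. A $ i $ i \<noteq> 0"
      then show "det A ^ (d ^ CARD('n)) \<noteq> 0"
        using A by (subst det_diagonal) (auto simp: diagonal_matrix_def)
    qed (rule False)
  qed
  then show ?thesis using const[of G c] by (simp add: R_def)
qed

section \<open>Tensors\<close>

lemma sum_lists_Suc:
  fixes f :: "'n::finite list \<Rightarrow> 'a::comm_monoid_add"
  shows "(\<Sum>js | length js = Suc n. f js) = (\<Sum>j\<in>UNIV. \<Sum>js | length js = n. f (j # js))"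
proof -
  have "{js :: 'n list. length js = Suc n} = (\<lambda>(j, js). j # js) ` (UNIV \<times> {js. length js = n})"
    by (auto simp: length_Suc_conv)
  then have "(\<Sum>js | length js = Suc n. f js) = (\<Sum>(j, js)\<in>UNIV \<times> {js. length js = n}. f (j # js))"
    by (simp add: sum.reindex inj_on_def case_prod_unfold)
  then show ?thesis by (simp add: sum.cartesian_product)
qed

text \<open>Expanding the product selects one index \<open>k\<close> per factor, and the selections
  are the lists \<open>js\<close>.\<close>

lemma prod_list_linear_expand:
  fixes G :: "complex^'n^'n"
  shows "(\<Prod>l\<leftarrow>is. \<Sum>k\<in>UNIV. G $ l $ k * x k) =
    (\<Sum>js | length js = length is. (\<Prod>k<length is. G $ (is ! k) $ (js ! k)) * (\<Prod>j\<leftarrow>js. x j))"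
proof (induction "is")
  case (Cons l ls)
  have "(\<Prod>l\<leftarrow>l # ls. \<Sum>k\<in>UNIV. G $ l $ k * x k) = (\<Sum>k\<in>UNIV. G $ l $ k * x k) *
      (\<Sum>js | length js = length ls. (\<Prod>k<length ls. G $ (ls ! k) $ (js ! k)) * (\<Prod>j\<leftarrow>js. x j))"
    by (simp add: Cons.IH)
  also have "\<dots> = (\<Sum>k\<in>UNIV. \<Sum>js | length js = length ls.
      (G $ l $ k * x k) * ((\<Prod>k<length ls. G $ (ls ! k) $ (js ! k)) * (\<Prod>j\<leftarrow>js. x j)))"
    by (rule sum_product)
  also have "\<dots> = (\<Sum>js | length js = length (l # ls).
      (\<Prod>k<length (l # ls). G $ ((l # ls) ! k) $ (js ! k)) * (\<Prod>j\<leftarrow>js. x j))"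
    by (simp add: sum_lists_Suc prod.lessThan_Suc_shift mult_ac del: prod.lessThan_Suc)
  finally show ?case .
qed simp

lemma meval_prod_list: "meval a (\<Prod>x\<leftarrow>xs. f x) = (\<Prod>x\<leftarrow>xs. meval a (f x))"
  by (induction xs) auto

lemma meval_tensor_form:
  "meval x (tensor_form p T i) = (\<Sum>js | length js = p - 1. T (i # js) * (\<Prod>j\<leftarrow>js. x j))"
  by (simp add: tensor_form_def meval_prod_list)

lemma homogeneous_tensor_form: "homogeneous (p - 1) (tensor_form p T i)"
  unfolding tensor_form_def
proof (rule homogeneous_sum)
  fix js :: "'a list" assume "js \<in> {js. length js = p - 1}"
  have "homogeneous (length js) (\<Prod>j\<leftarrow>js. Var j :: ('a, complex) mpoly)"
  proof (induction js)
    case (Cons j js)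
    then show ?case using homogeneous_mult[OF homogeneous_Var Cons, of j] by simp
  qed (simp add: homogeneous_def)
  then show "homogeneous (p - 1) (Const (T (i # js)) * (\<Prod>j\<leftarrow>js. Var j))"
    using homogeneous_mult[OF homogeneous_Const, of "length js" _ "T (i # js)"] \<open>js \<in> _\<close> by simp
qed

text \<open>After exchanging the sums over \<open>js\<close> and \<open>is\<close>, the inner sum is
  an expanded product of the linear forms given by \<open>G\<close>.\<close>

lemma tensor_form_comp: "tensor_form p (tensor_comp p U G) i = linear_subst G (tensor_form p U i)"
proof (rule mpoly_eqI)
  fix x
  let ?L = "{js. length js = p - 1}"
  have "meval x (tensor_form p (tensor_comp p U G) i) =
      (\<Sum>js\<in>?L. \<Sum>is\<in>?L. U (i # is) * ((\<Prod>k<p - 1. G $ (is ! k) $ (js ! k)) * (\<Prod>j\<leftarrow>js. x j)))"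
    by (simp add: meval_tensor_form tensor_comp_def sum_distrib_right mult.assoc)
  also have "\<dots> = (\<Sum>is\<in>?L. U (i # is) * (\<Sum>js\<in>?L. (\<Prod>k<p - 1. G $ (is ! k) $ (js ! k)) * (\<Prod>j\<leftarrow>js. x j)))"
    by (subst sum.swap) (simp add: sum_distrib_left)
  also have "\<dots> = (\<Sum>is\<in>?L. U (i # is) * (\<Prod>l\<leftarrow>is. \<Sum>k\<in>UNIV. G $ l $ k * x k))"
    by (rule sum.cong) (auto simp: prod_list_linear_expand)
  also have "\<dots> = meval x (linear_subst G (tensor_form p U i))"
    by (simp add: meval_linear_subst meval_tensor_form)
  finally show "meval x (tensor_form p (tensor_comp p U G) i) = meval x (linear_subst G (tensor_form p U i))" .
qed

theorem proposition4p4: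
  fixes U :: "'n::finite tensor" and G :: "complex^'n^'n" and p :: nat
  assumes "CARD('n) \<ge> 2" and "p \<ge> 2"
  shows "Edet p (tensor_comp p U G) = Edet p U * det G ^ ((p - 1) ^ CARD('n))"
proof -
  define d where "d = p - 1"
  have d: "d > 0" using assms(2) by (simp add: d_def)
  \<comment> \<open>In coefficient space, composition of the tensor with \<open>G\<close> becomes
    \<open>pull\<close>, so the covariance of the resultant applies.\<close>
  define c where "c = coeffs_of (tensor_form p U)"
  have "form d c i = tensor_form p U i" for i
    unfolding c_def d_def by (rule form_coeffs_of) (rule homogeneous_tensor_form)
  then have eq: "coeffs_of (tensor_form p (tensor_comp p U G)) = pull d G c"
    by (simp add: pull_def tensor_form_comp[abs_def])
  show ?thesis
    unfolding Edet_def Res_def eq d_def[symmetric] c_def[symmetric] resultant_pull[OF d]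
    by (rule mult.commute)
qed

end
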